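(* Let $T\in\mathbf{R}^{n+p}$ be a constant vector and let $\Sigma^n\subset\mathbf{R}^{n+p}$ be a submanifold. Let $\Sigma_s\subset\mathbf{R}^{n+p}$ be a compactly supported variation of $\Sigma=\Sigma_0$ with normal variation vector field $V=\partial_s|_{s=0}\Sigma_s$. Then $$\frac{\partial}{\partial s}\Big|_{s=0}F(\Sigma_s)=\int_\Sigma\langle T^\perp-H, V\rangle\, e^{\langle T,x\rangle}\,d\mu_\Sigma .$$
   Context: Submanifolds and variations are smooth, and submanifolds are without boundary. $F(\Sigma)=\int_\Sigma e^{\langle T,x\rangle}d\mu$, where $x$ is the position vector and $d\mu$ the induced volume measure. If $F(\Sigma)=\infty$, the derivative is that of the integral over a compact region containing the support of the variation (outside of which $\Sigma_s$ does not change). $(\cdot)^\perp$ is projection onto the normal space of $\Sigma$, and $H$ is the mean curvature vector, the trace of the second fundamental form $A(X,Y)=(\overline\nabla_XY)^\perp$, with $\overline\nabla$ the Euclidean connection. *)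

theory Defs
  imports "HOL-Analysis.Analysis"
begin

text \<open>Smooth maps. On a set that need not be open, smooth means: locally the restriction of a
  smooth map defined on an open subset of the ambient space.\<close>

primrec Ck_on :: "nat \<Rightarrow> ('a::euclidean_space \<Rightarrow> 'b::real_normed_vector) \<Rightarrow> 'a set \<Rightarrow> bool" where
  "Ck_on 0 f U \<longleftrightarrow> continuous_on U f"
| "Ck_on (Suc k) f U \<longleftrightarrow> (\<forall>x\<in>U. f differentiable (at x)) \<and>
     (\<forall>v. Ck_on k (\<lambda>x. frechet_derivative f (at x) v) U)"

definition smooth_on :: "'a::euclidean_space set \<Rightarrow> ('a \<Rightarrow> 'b::real_normed_vector) \<Rightarrow> bool" where
  "smooth_on S f \<longleftrightarrow> (\<forall>x\<in>S. \<exists>U g. open U \<and> x \<in> U \<and> (\<forall>k. Ck_on k g U) \<and> (\<forall>y\<in>S \<inter> U. f y = g y))"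

text \<open>Submanifolds (without boundary) are smooth embedded submanifolds; the dimension is the
  cardinality of the index type \<open>'n\<close>.\<close>

definition local_param ::
    "'a::euclidean_space set \<Rightarrow> (real^'n::finite) set \<Rightarrow> (real^'n \<Rightarrow> 'a) \<Rightarrow> bool" where
  "local_param \<Sigma> U \<psi> \<longleftrightarrow> open U \<and> smooth_on U \<psi> \<and>
     (\<forall>u\<in>U. inj (frechet_derivative \<psi> (at u))) \<and>
     openin (top_of_set \<Sigma>) (\<psi> ` U) \<and> (\<exists>g. homeomorphism U (\<psi> ` U) \<psi> g)"

definition submanifold :: "'n::finite itself \<Rightarrow> 'a::euclidean_space set \<Rightarrow> bool" where
  "submanifold (_ :: 'n itself) \<Sigma> \<longleftrightarrow>
     (\<forall>x\<in>\<Sigma>. \<exists>(U :: (real^'n) set) \<psi>. local_param \<Sigma> U \<psi> \<and> x \<in> \<psi> ` U)"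

definition tangent_space_at :: "'a::euclidean_space set \<Rightarrow> 'a \<Rightarrow> 'a set" where
  "tangent_space_at \<Sigma> x = {v. \<exists>(\<gamma> :: real \<Rightarrow> 'a) \<delta>. \<delta> > 0 \<and> smooth_on {-\<delta><..<\<delta>} \<gamma> \<and>
     \<gamma> ` {-\<delta><..<\<delta>} \<subseteq> \<Sigma> \<and> \<gamma> 0 = x \<and> (\<gamma> has_vector_derivative v) (at 0)}"

definition normal_space_at :: "'a::euclidean_space set \<Rightarrow> 'a \<Rightarrow> 'a set" where
  "normal_space_at \<Sigma> x = orthogonal_comp (tangent_space_at \<Sigma> x)"

definition normal_proj :: "'a::euclidean_space set \<Rightarrow> 'a \<Rightarrow> 'a \<Rightarrow> 'a" where
  "normal_proj \<Sigma> x v = (THE w. w \<in> normal_space_at \<Sigma> x \<and> v - w \<in> tangent_space_at \<Sigma> x)"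

text \<open>\<open>Y\<close> is a smooth vector field near \<open>x\<close> that is tangent to \<open>\<Sigma>\<close> along \<open>\<Sigma>\<close>.\<close>

definition tangent_field_near :: "'a::euclidean_space set \<Rightarrow> 'a \<Rightarrow> ('a \<Rightarrow> 'a) \<Rightarrow> bool" where
  "tangent_field_near \<Sigma> x Y \<longleftrightarrow>
     (\<exists>W. open W \<and> x \<in> W \<and> smooth_on W Y \<and> (\<forall>y\<in>W \<inter> \<Sigma>. Y y \<in> tangent_space_at \<Sigma> y))"

text \<open>The normal part of the Euclidean derivative of \<open>Y\<close> in the direction \<open>u\<close>, where \<open>Y\<close> extends \<open>v\<close>
  to a local tangent field. For \<open>u\<close>, \<open>v\<close> tangent at \<open>x\<close> the value does not depend on the extension.\<close>

definition second_fundamental_form :: "'a::euclidean_space set \<Rightarrow> 'a \<Rightarrow> 'a \<Rightarrow> 'a \<Rightarrow> 'a" where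
  "second_fundamental_form \<Sigma> x u v =
     (let Y = (SOME Y. tangent_field_near \<Sigma> x Y \<and> Y x = v)
      in normal_proj \<Sigma> x (frechet_derivative Y (at x) u))"

definition orthonormal_basis_of :: "'a::euclidean_space set \<Rightarrow> 'a set \<Rightarrow> bool" where
  "orthonormal_basis_of L B \<longleftrightarrow>
     B \<subseteq> L \<and> pairwise orthogonal B \<and> (\<forall>e\<in>B. norm e = 1) \<and> span B = L"

text \<open>The trace does not depend on the orthonormal basis of the tangent space.\<close>

definition mean_curvature :: "'a::euclidean_space set \<Rightarrow> 'a \<Rightarrow> 'a" where
  "mean_curvature \<Sigma> x =
     (let B = (SOME B. orthonormal_basis_of (tangent_space_at \<Sigma> x) B)
      in \<Sum>e\<in>B. second_fundamental_form \<Sigma> x e e)"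

text \<open>The induced volume measure: the Borel measure on \<open>\<Sigma>\<close> given by
  \<open>sqrt (det g) du\<close> in every local parametrization, \<open>g\<close> being the induced metric.\<close>

definition volume_density :: "(real^'n::finite \<Rightarrow> 'a::euclidean_space) \<Rightarrow> real^'n \<Rightarrow> real" where
  "volume_density \<psi> u = sqrt (det (\<chi> i j.
     frechet_derivative \<psi> (at u) (axis i 1) \<bullet> frechet_derivative \<psi> (at u) (axis j 1) :: real^'n^'n))"

definition induced_volume :: "'n::finite itself \<Rightarrow> 'a::euclidean_space set \<Rightarrow> 'a measure" where
  "induced_volume (_ :: 'n itself) \<Sigma> = (THE \<mu>. sets \<mu> = sets (restrict_space borel \<Sigma>) \<and>
     (\<forall>(U :: (real^'n) set) \<psi> B. local_param \<Sigma> U \<psi> \<and> B \<in> sets borel \<and> B \<subseteq> \<psi> ` U \<longrightarrow>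
        emeasure \<mu> B = (\<integral>\<^sup>+u\<in>U \<inter> \<psi> -` B. ennreal (volume_density \<psi> u) \<partial>lborel)))"

text \<open>The part over \<open>R\<close> of the weighted volume of \<open>\<Sigma>\<close>, and the weighted volume \<open>F\<close>.\<close>

definition weighted_volume_over ::
    "'n::finite itself \<Rightarrow> 'a::euclidean_space \<Rightarrow> 'a set \<Rightarrow> 'a set \<Rightarrow> ennreal" where
  "weighted_volume_over n T \<Sigma> R = (\<integral>\<^sup>+x\<in>R. ennreal (exp (T \<bullet> x)) \<partial>induced_volume n \<Sigma>)"

definition weighted_volume ::
    "'n::finite itself \<Rightarrow> 'a::euclidean_space \<Rightarrow> 'a set \<Rightarrow> ennreal" where
  "weighted_volume n T \<Sigma> = (\<integral>\<^sup>+x. ennreal (exp (T \<bullet> x)) \<partial>induced_volume n \<Sigma>)"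

text \<open>A variation of \<open>\<Sigma>\<close> is a smooth family \<open>\<phi> s\<close>, \<open>\<bar>s\<bar> < \<epsilon>\<close>, of smooth embeddings of \<open>\<Sigma>\<close> starting at
  the inclusion; the varied submanifolds are the images \<open>\<phi> s ` \<Sigma>\<close>. Having a smooth left inverse
  on the image is what makes \<open>\<phi> s\<close> an embedding, so that the image is again a submanifold.\<close>

definition variation :: "'a::euclidean_space set \<Rightarrow> real \<Rightarrow> (real \<Rightarrow> 'a \<Rightarrow> 'a) \<Rightarrow> bool" where
  "variation \<Sigma> \<epsilon> \<phi> \<longleftrightarrow> \<epsilon> > 0 \<and>
     smooth_on ({-\<epsilon><..<\<epsilon>} \<times> \<Sigma>) (\<lambda>(s, x). \<phi> s x) \<and>
     (\<forall>x\<in>\<Sigma>. \<phi> 0 x = x) \<and>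
     (\<forall>s\<in>{-\<epsilon><..<\<epsilon>}. \<exists>g :: 'a \<Rightarrow> 'a. smooth_on (\<phi> s ` \<Sigma>) g \<and> (\<forall>x\<in>\<Sigma>. g (\<phi> s x) = x))"

definition variation_support :: "'a::euclidean_space set \<Rightarrow> real \<Rightarrow> (real \<Rightarrow> 'a \<Rightarrow> 'a) \<Rightarrow> 'a set" where
  "variation_support \<Sigma> \<epsilon> \<phi> = \<Sigma> \<inter> closure {x\<in>\<Sigma>. \<exists>s\<in>{-\<epsilon><..<\<epsilon>}. \<phi> s x \<noteq> x}"

end

theory Submission
  imports Defs
begin

text \<open>In a chart \<open>\<psi>\<close> of \<open>\<Sigma>\<close> the map \<open>\<phi> s \<circ> \<psi>\<close> is a chart of \<open>\<phi> s ` \<Sigma>\<close> with the same domain, so the weighted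
  volume is locally an integral over a fixed set whose integrand depends smoothly on \<open>s\<close>, and it may
  be differentiated under the integral sign; outside the support nothing changes. For a frame \<open>e i\<close>
  that is orthonormal at a point the logarithmic derivative of the volume density there is
  \<open>\<Sum>i. e i \<bullet> D V (e i)\<close>, and since \<open>V\<close> is normal, differentiating \<open>Y \<bullet> V = 0\<close> for tangent fields \<open>Y\<close> turns
  this into \<open>- H \<bullet> V\<close>. No integration by parts is needed. That the induced volume exists at all rests
  on the change of variables between charts.\<close>

section \<open>Smooth maps\<close>

text \<open>\<open>normal_proj\<close>, \<open>second_fundamental_form\<close>,
  \<open>mean_curvature\<close> and \<open>induced_volume\<close> are defined by choices, so nothing
  can be computed about them before witnesses exist. These rest on one construction: every chart has
  a local inverse that is smooth on an open set of the ambient space. The chosen tangent extensions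
  and orthonormal bases never have to be compared with others: the curvature is only paired with the
  normal vector \<open>V x\<close>, and that pairing is the same for every extension and every
  frame. Differentiability of \<open>V\<close> along \<open>\<Sigma>\<close> is read off from the
  joint smoothness of \<open>\<phi>\<close>: in a chart, \<open>V\<close> is the
  \<open>s\<close>-derivative of \<open>\<phi> s (\<psi> u)\<close>. Symmetry of the second
  derivatives of this map turns the \<open>s\<close>-derivative of a tangent frame into the
  derivative of \<open>V\<close>. Compact sets are cut into finitely many disjoint Borel pieces,
  each inside a compact part of one chart. Disjointness makes volumes add up, so additivity takes
  the place of a partition of unity; compactness of the pieces supplies finiteness and the bound for
  dominated convergence.\<close>

lemma Ck_on_subset: "Ck_on k f U \<Longrightarrow> W \<subseteq> U \<Longrightarrow> Ck_on k f W"
  by (induction k arbitrary: f) (auto intro: continuous_on_subset)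

lemma frechet_derivative_eqI: "(f has_derivative f') (at x) \<Longrightarrow> frechet_derivative f (at x) = f'"
  using frechet_derivative_at by metis

text \<open>Both sides are choices from the same predicate, since functions that agree near
  \<open>x\<close> have the same derivatives there; this covers points without a derivative as
  well.\<close>

lemma frechet_derivative_cong_open:
  assumes "open U" "x \<in> U" "\<And>y. y \<in> U \<Longrightarrow> f y = g y"
  shows "frechet_derivative f (at x) = frechet_derivative g (at x)"
proof -
  have "(f has_derivative D) (at x) \<longleftrightarrow> (g has_derivative D) (at x)" for D
    using assms has_derivative_transform_within_open by metis
  then show ?thesis
    unfolding frechet_derivative_def by simp
qed

lemma Ck_on_has_derivative:
  "Ck_on (Suc k) f U \<Longrightarrow> x \<in> U \<Longrightarrow> (f has_derivative frechet_derivative f (at x)) (at x)"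
  using frechet_derivative_works by auto

lemma Ck_on_cong:
  assumes "open U" "\<And>x. x \<in> U \<Longrightarrow> f x = g x" "Ck_on k f U"
  shows "Ck_on k g U"
  using assms
proof (induction k arbitrary: f g)
  case 0
  then show ?case by (auto cong: continuous_on_cong)
next
  case (Suc k)
  have der: "(g has_derivative frechet_derivative f (at x)) (at x)" if "x \<in> U" for x
    using has_derivative_transform_within_open[OF Ck_on_has_derivative[OF Suc.prems(3) that]
        Suc.prems(1) that Suc.prems(2)] .
  have "Ck_on k (\<lambda>x. frechet_derivative g (at x) v) U" for v
    by (rule Suc.IH[of "\<lambda>x. frechet_derivative f (at x) v"])
      (use Suc.prems in \<open>auto simp: frechet_derivative_eqI[OF der]\<close>)
  then show ?case
    using der by (auto simp: differentiable_def)
qed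

text \<open>\<open>Ck_on\<close> speaks of \<open>frechet_derivative\<close> itself. This rule
  accepts any explicitly known derivative \<open>D\<close>, the form in which the product, chain and
  quotient rules deliver it.\<close>

lemma Ck_on_SucI:
  assumes U: "open U" and der: "\<And>x. x \<in> U \<Longrightarrow> (f has_derivative D x) (at x)"
    and D: "\<And>v. Ck_on k (\<lambda>x. D x v) U"
  shows "Ck_on (Suc k) f U"
proof -
  have "Ck_on k (\<lambda>x. frechet_derivative f (at x) v) U" for v
    by (rule Ck_on_cong[OF U _ D[of v]]) (simp add: frechet_derivative_eqI[OF der])
  then show ?thesis
    using der by (auto simp: differentiable_def)
qed

lemma Ck_on_SucD: "Ck_on (Suc k) f U \<Longrightarrow> Ck_on k f U"
proof (induction k arbitrary: f)
  case 0
  then show ?case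
    by (auto intro: continuous_at_imp_continuous_on differentiable_imp_continuous_within)
qed simp

lemma Ck_on_le: "j \<le> k \<Longrightarrow> Ck_on k f U \<Longrightarrow> Ck_on j f U"
  by (induction rule: dec_induct) (auto dest: Ck_on_SucD simp del: Ck_on.simps)

lemma Ck_on_imp_continuous_on: "Ck_on k f U \<Longrightarrow> continuous_on U f"
  using Ck_on_le[of 0 k f U] by simp

lemma Ck_on_locally:
  assumes "\<And>x. x \<in> U \<Longrightarrow> \<exists>W. open W \<and> x \<in> W \<and> Ck_on k f W"
  shows "Ck_on k f U"
  using assms
proof (induction k arbitrary: f)
  case 0
  then show ?case
    by (meson Ck_on.simps(1) continuous_at_imp_continuous_on continuous_on_eq_continuous_at)
next
  case (Suc k)
  show ?case
    unfolding Ck_on.simps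
  proof (intro conjI ballI allI)
    show "f differentiable at x" if "x \<in> U" for x
      using Suc.prems[OF that] by auto
    show "Ck_on k (\<lambda>x. frechet_derivative f (at x) v) U" for v
      by (rule Suc.IH) (use Suc.prems in force)
  qed
qed

lemma Ck_on_const [simp]: "Ck_on k (\<lambda>x. c) U"
  by (induction k arbitrary: c) auto

lemma Ck_on_bounded_linear:
  assumes "bounded_linear L" shows "Ck_on k L U"
proof (cases k)
  case 0
  then show ?thesis using assms by (simp add: linear_continuous_on)
next
  case (Suc m)
  have "(L has_derivative L) (at x)" for x
    using assms by (rule bounded_linear_imp_has_derivative)
  then show ?thesis
    using Suc by (auto simp: frechet_derivative_eqI[of L L] differentiable_def)
qed

lemma Ck_on_ident: "Ck_on k (\<lambda>x. x) U"
  by (rule Ck_on_bounded_linear) (rule bounded_linear_ident)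

lemma Ck_on_add:
  assumes "open U" "Ck_on k f U" "Ck_on k g U"
  shows "Ck_on k (\<lambda>x. f x + g x) U"
  using assms
proof (induction k arbitrary: f g)
  case 0
  then show ?case by (auto intro: continuous_intros)
next
  case (Suc k)
  show ?case
  proof (rule Ck_on_SucI[OF Suc.prems(1)])
    show "((\<lambda>x. f x + g x) has_derivative
        (\<lambda>v. frechet_derivative f (at x) v + frechet_derivative g (at x) v)) (at x)" if "x \<in> U" for x
      using Suc.prems that by (intro has_derivative_add Ck_on_has_derivative)
  qed (use Suc in auto)
qed

lemma Ck_on_sum:
  assumes "open U" "finite I" "\<And>i. i \<in> I \<Longrightarrow> Ck_on k (f i) U"
  shows "Ck_on k (\<lambda>x. \<Sum>i\<in>I. f i x) U"
  using assms(2,3) by (induction I rule: finite_induct) (auto intro: Ck_on_add assms(1))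

text \<open>The product rule returns two products of the same bilinear map, so the induction on
  \<open>k\<close> runs with \<open>f\<close> and \<open>g\<close> arbitrary.\<close>

lemma Ck_on_bilinear:
  assumes "bounded_bilinear pr" "open U" "Ck_on k f U" "Ck_on k g U"
  shows "Ck_on k (\<lambda>x. pr (f x) (g x)) U"
  using assms(3,4)
proof (induction k arbitrary: f g)
  case 0
  then show ?case using bounded_bilinear.continuous_on[OF assms(1)] by auto
next
  case (Suc k)
  show ?case
  proof (rule Ck_on_SucI[OF assms(2)])
    show "((\<lambda>x. pr (f x) (g x)) has_derivative
        (\<lambda>v. pr (f x) (frechet_derivative g (at x) v) + pr (frechet_derivative f (at x) v) (g x))) (at x)"
      if "x \<in> U" for x
      by (rule bounded_bilinear.FDERIV[OF assms(1)]) (use Suc.prems that in \<open>blast intro: Ck_on_has_derivative\<close>)+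
    show "Ck_on k (\<lambda>x. pr (f x) (frechet_derivative g (at x) v) + pr (frechet_derivative f (at x) v) (g x)) U" for v
      using Suc.prems Ck_on_SucD[OF Suc.prems(1)] Ck_on_SucD[OF Suc.prems(2)]
      by (intro Ck_on_add assms(2) Suc.IH) auto
  qed
qed

lemmas Ck_on_inner = Ck_on_bilinear[OF bounded_bilinear_inner]
lemmas Ck_on_scaleR = Ck_on_bilinear[OF bounded_bilinear_scaleR]
lemmas Ck_on_mult = Ck_on_bilinear[OF bounded_bilinear_mult]

lemma Ck_on_prod:
  fixes f :: "'i \<Rightarrow> 'a::euclidean_space \<Rightarrow> real"
  assumes "open U" "finite I" "\<And>i. i \<in> I \<Longrightarrow> Ck_on k (f i) U"
  shows "Ck_on k (\<lambda>x. \<Prod>i\<in>I. f i x) U"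
  using assms(2,3)
proof (induction I rule: finite_induct)
  case (insert i I)
  then show ?case using Ck_on_mult[OF assms(1), of k "f i" "\<lambda>x. \<Prod>i\<in>I. f i x"] by simp
qed simp

lemma Ck_on_compose:
  fixes f :: "'a::euclidean_space \<Rightarrow> 'b::euclidean_space" and g :: "'b \<Rightarrow> 'c::real_normed_vector"
  assumes "open U" "open W" "f ` U \<subseteq> W" "Ck_on k f U" "Ck_on k g W"
  shows "Ck_on k (\<lambda>x. g (f x)) U"
  using assms(4,5)
proof (induction k arbitrary: g)
  case 0
  then show ?case
    using assms(3) by (auto intro: continuous_on_compose2)
next
  case (Suc k)
  \<comment> \<open>\<open>Ck_on\<close> controls \<open>frechet_derivative g\<close> in fixed
    directions only, while in the chain rule the direction varies with \<open>x\<close>. Expanding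
    it in the basis leaves the fixed directions \<open>b\<close> with scalar coefficients.\<close>
  let ?D = "\<lambda>x v. \<Sum>b\<in>Basis. (frechet_derivative f (at x) v \<bullet> b) *\<^sub>R frechet_derivative g (at (f x)) b"
  show ?case
  proof (rule Ck_on_SucI[OF assms(1)])
    show "((\<lambda>x. g (f x)) has_derivative ?D x) (at x)" if "x \<in> U" for x
    proof -
      have f: "(f has_derivative frechet_derivative f (at x)) (at x)"
        using Suc.prems(1) that by (rule Ck_on_has_derivative)
      have g: "(g has_derivative frechet_derivative g (at (f x))) (at (f x))"
        using Suc.prems(2) that assms(3) by (blast intro: Ck_on_has_derivative)
      have rep: "frechet_derivative g (at (f x)) w = (\<Sum>b\<in>Basis. (w \<bullet> b) *\<^sub>R frechet_derivative g (at (f x)) b)" for w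
        using linear_sum[OF has_derivative_linear[OF g], of "\<lambda>b. (w \<bullet> b) *\<^sub>R b" Basis]
        by (simp add: euclidean_representation linear_cmul[OF has_derivative_linear[OF g]])
      have "?D x = frechet_derivative g (at (f x)) \<circ> frechet_derivative f (at x)"
        unfolding o_def by (rule ext, rule rep[symmetric])
      then show ?thesis
        using diff_chain_at[OF f g] by (simp add: o_def)
    qed
    show "Ck_on k (\<lambda>x. ?D x v) U" for v
    proof (rule Ck_on_sum[OF assms(1) finite_Basis])
      fix b :: 'b
      have *: "Ck_on k (\<lambda>x. frechet_derivative f (at x) v) U" "Ck_on k (\<lambda>x. frechet_derivative g (at x) b) W"
        using Suc.prems by simp_all
      show "Ck_on k (\<lambda>x. (frechet_derivative f (at x) v \<bullet> b) *\<^sub>R frechet_derivative g (at (f x)) b) U"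
        by (rule Ck_on_scaleR[OF assms(1) Ck_on_inner[OF assms(1) *(1) Ck_on_const]
              Suc.IH[OF Ck_on_SucD[OF Suc.prems(1)] *(2)]])
    qed
  qed
qed

lemma Ck_on_linear_compose:
  fixes f :: "'a::euclidean_space \<Rightarrow> 'b::euclidean_space"
  assumes "bounded_linear L" "open U" "Ck_on k f U"
  shows "Ck_on k (\<lambda>x. L (f x)) U"
  by (rule Ck_on_compose[OF assms(2) open_UNIV subset_UNIV assms(3) Ck_on_bounded_linear[OF assms(1)]])

lemma Ck_on_Pair:
  fixes f :: "'a::euclidean_space \<Rightarrow> 'b::euclidean_space" and g :: "'a \<Rightarrow> 'c::euclidean_space"
  assumes "open U" "Ck_on k f U" "Ck_on k g U"
  shows "Ck_on k (\<lambda>x. (f x, g x)) U"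
proof -
  have "bounded_linear (\<lambda>y. (y, 0::'c))" "bounded_linear (\<lambda>y. (0::'b, y))"
    by (auto intro!: bounded_linear_Pair bounded_linear_ident bounded_linear_zero)
  from Ck_on_add[OF assms(1) Ck_on_linear_compose[OF this(1) assms(1,2)] Ck_on_linear_compose[OF this(2) assms(1,3)]]
  show ?thesis by simp
qed

lemma Ck_on_vec_lambda:
  fixes f :: "'n::finite \<Rightarrow> 'a::euclidean_space \<Rightarrow> real"
  assumes "open U" "\<And>i. Ck_on k (f i) U"
  shows "Ck_on k (\<lambda>x. \<chi> i. f i x) U"
proof (rule Ck_on_cong[OF assms(1)])
  show "Ck_on k (\<lambda>x. \<Sum>i\<in>UNIV. f i x *\<^sub>R axis i 1) U"
    using assms by (intro Ck_on_sum Ck_on_scaleR Ck_on_const) auto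
  show "(\<Sum>i\<in>UNIV. f i x *\<^sub>R axis i 1) = (\<chi> i. f i x)" for x
    by (simp add: vec_eq_iff axis_def if_distrib cong: if_cong)
qed

lemma Ck_on_inverse:
  fixes f :: "'a::euclidean_space \<Rightarrow> real"
  assumes "open U" "Ck_on k f U" "\<And>x. x \<in> U \<Longrightarrow> f x \<noteq> 0"
  shows "Ck_on k (\<lambda>x. inverse (f x)) U"
  using assms(2)
proof (induction k)
  case 0
  then show ?case using assms(3) by (auto intro: continuous_intros)
next
  case (Suc k)
  \<comment> \<open>The derivative as iterated products that contain \<open>inverse (f x)\<close>
    itself, so that the induction hypothesis applies to those factors.\<close>
  let ?D = "\<lambda>x v. - 1 * (inverse (f x) * (frechet_derivative f (at x) v * inverse (f x)))"
  show ?case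
  proof (rule Ck_on_SucI[OF assms(1)])
    show "((\<lambda>x. inverse (f x)) has_derivative ?D x) (at x)" if "x \<in> U" for x
      using Deriv.has_derivative_inverse[OF assms(3)[OF that] Ck_on_has_derivative[OF Suc.prems that]]
      by (simp add: mult.assoc)
    show "Ck_on k (\<lambda>x. ?D x v) U" for v
      using Suc.prems Suc.IH[OF Ck_on_SucD[OF Suc.prems]]
      by (intro Ck_on_mult Ck_on_const assms(1)) auto
  qed
qed

lemma Ck_on_det:
  fixes A :: "'a::euclidean_space \<Rightarrow> 'n::finite \<Rightarrow> 'n \<Rightarrow> real"
  assumes "open U" "\<And>i j. Ck_on k (\<lambda>x. A x i j) U"
  shows "Ck_on k (\<lambda>x. det (\<chi> i j. A x i j)) U"
proof -
  have "Ck_on k (\<lambda>x. \<Prod>i\<in>UNIV. A x i (p i)) U" for p :: "'n \<Rightarrow> 'n"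
    using assms by (intro Ck_on_prod) auto
  then have "Ck_on k (\<lambda>x. \<Sum>p\<in>{p. p permutes (UNIV :: 'n set)}. of_int (sign p) * (\<Prod>i\<in>UNIV. A x i (p i))) U"
    by (intro Ck_on_sum Ck_on_mult Ck_on_const assms(1)) (auto simp: finite_permutations)
  then show ?thesis
    by (simp add: det_def)
qed

text \<open>On an open set the map can serve as its own local extension; conversely it agrees with
  each extension on an open set and inherits its derivatives.\<close>

lemma smooth_on_open_iff:
  assumes "open U"
  shows "smooth_on U f \<longleftrightarrow> (\<forall>k. Ck_on k f U)"
proof
  assume *: "smooth_on U f"
  show "\<forall>k. Ck_on k f U"
  proof (intro allI Ck_on_locally)
    fix k x assume "x \<in> U"
    then obtain W g where W: "open W" "x \<in> W" "\<forall>k. Ck_on k g W" "\<forall>y\<in>U \<inter> W. f y = g y"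
      using * unfolding smooth_on_def by metis
    have "Ck_on k f (U \<inter> W)"
      by (rule Ck_on_cong[of _ g]) (use W assms Ck_on_subset[of k g W "U \<inter> W"] in auto)
    then show "\<exists>W. open W \<and> x \<in> W \<and> Ck_on k f W"
      using \<open>x \<in> U\<close> W assms by blast
  qed
next
  assume "\<forall>k. Ck_on k f U"
  then show "smooth_on U f"
    using assms unfolding smooth_on_def by blast
qed

lemma smooth_on_imp_continuous_on:
  assumes "smooth_on S f" shows "continuous_on S f"
  unfolding continuous_on_eq_continuous_within
proof
  fix x assume x: "x \<in> S"
  then obtain W g where W: "open W" "x \<in> W" "\<forall>k. Ck_on k g W" "\<forall>y\<in>S \<inter> W. f y = g y"
    using assms unfolding smooth_on_def by metis
  then have "continuous (at x) g"
    using Ck_on_imp_continuous_on continuous_on_eq_continuous_at by blast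
  then have "continuous (at x within S) g"
    by (rule continuous_at_imp_continuous_at_within)
  moreover have "eventually (\<lambda>y. g y = f y) (at x within S)"
    unfolding eventually_at_topological using W by auto
  ultimately show "continuous (at x within S) f"
    unfolding continuous_within using W x by (auto intro: Lim_transform_eventually)
qed

text \<open>By Cramer's rule the derivative of the local inverse is a rational expression in the
  derivative of the given map at the preimage, so each order of differentiability gives the next.\<close>

lemma smooth_inverse_function:
  fixes f :: "real^'n::finite \<Rightarrow> real^'n"
  assumes U: "open U" and f: "\<And>k. Ck_on k f U" and x0: "x0 \<in> U"
    and inj: "inj (frechet_derivative f (at x0))"
  obtains U' V g where "open U'" "U' \<subseteq> U" "x0 \<in> U'" "open V" "f x0 \<in> V"
    "homeomorphism U' V f g" "\<And>k. Ck_on k g V"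
proof -
  let ?D = "\<lambda>x. frechet_derivative f (at x)"
  have der: "(f has_derivative ?D x) (at x)" if "x \<in> U" for x
    using Ck_on_has_derivative[OF f that] .
  define f' where "f' x = Blinfun (?D x)" for x
  have f': "blinfun_apply (f' x) = ?D x" if "x \<in> U" for x
    unfolding f'_def using has_derivative_bounded_linear[OF der[OF that]] by (rule bounded_linear_Blinfun_apply)
  \<comment> \<open>The inverse function theorem wants the derivative continuous as an
    operator-valued map. In finite dimension continuity on each fixed vector suffices, and this is
    what \<open>Ck_on\<close> gives.\<close>
  have "continuous_on U (\<lambda>x. f' x i)" for i
    using f[of "Suc 0"] by (simp add: f' cong: continuous_on_cong)
  then have cont: "continuous_on U f'"
    by (intro continuous_on_blinfun_componentwise) auto
  have "linear (?D x0)" using der[OF x0] has_derivative_linear by blast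
  then obtain L where L: "linear L" "L \<circ> ?D x0 = id"
    using linear_injective_left_inverse inj by blast
  define invf where "invf = Blinfun L"
  have "blinfun_apply invf = L"
    unfolding invf_def using L(1) by (simp add: bounded_linear_Blinfun_apply linear_conv_bounded_linear)
  then have inv: "invf o\<^sub>L f' x0 = id_blinfun"
    using L(2) f'[OF x0] by (intro blinfun_eqI) (simp add: fun_eq_iff)
  have derf: "(f has_derivative blinfun_apply (f' x)) (at x)" if "x \<in> U" for x
    using der f' that by simp
  obtain U' V g g' where *: "open U'" "U' \<subseteq> U" "x0 \<in> U'" "open V" "f x0 \<in> V" "homeomorphism U' V f g"
    "\<And>y. y \<in> V \<Longrightarrow> (g has_derivative (g' y)) (at y)"
    "\<And>y. y \<in> V \<Longrightarrow> g' y = inv (blinfun_apply (f'(g y)))"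
    "\<And>y. y \<in> V \<Longrightarrow> bij (blinfun_apply (f'(g y)))"
    by (rule inverse_function_theorem[OF U derf cont x0 inv]) blast+
  have gU: "g y \<in> U" if "y \<in> V" for y
    using *(2,6) that by (auto simp: homeomorphism_def)
  let ?M = "\<lambda>y. matrix (?D (g y))"
  have M: "det (?M y) \<noteq> 0" "?M y *v g' y v = v" if "y \<in> V" for y v
  proof -
    have lin: "linear (?D (g y))" using der[OF gU[OF that]] has_derivative_linear by blast
    have bij: "bij (?D (g y))" using *(9)[OF that] f' gU that by simp
    show "det (?M y) \<noteq> 0"
      using lin bij bij_is_inj det_nz_iff_inj matrix_vector_mul(2) by metis
    have "?D (g y) (g' y v) = v"
      using *(8)[OF that] f' gU that bij by (simp add: bij_is_surj surj_f_inv_f)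
    then show "?M y *v g' y v = v"
      using lin by (simp add: matrix_works)
  qed
  have "Ck_on k g V" for k
  proof (induction k)
    case 0
    then show ?case using *(6) by (simp add: homeomorphism_def)
  next
    case (Suc k)
    have ent: "Ck_on k (\<lambda>y. ?M y $ i $ j) V" for i j
    proof -
      have "Ck_on k (\<lambda>y. ?D (g y) (axis j 1)) V"
        by (rule Ck_on_compose[OF *(4) U _ Suc]) (use gU f[of "Suc k"] in auto)
      then have "Ck_on k (\<lambda>y. ?D (g y) (axis j 1) \<bullet> axis i 1) V"
        by (intro Ck_on_inner *(4)) auto
      then show ?thesis by (simp add: matrix_def inner_axis)
    qed
    show ?case
    proof (rule Ck_on_SucI[OF *(4) *(7)])
      fix v
      \<comment> \<open>Cramer's solution \<open>w\<close> of \<open>?M y *v w = v\<close>, with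
        division written as multiplication by an inverse so that the closure rules apply.\<close>
      let ?c = "\<lambda>y. \<chi> m. det (\<chi> i j. if j = m then v $ i else ?M y $ i $ j) * inverse (det (\<chi> i j. ?M y $ i $ j))"
      show "Ck_on k (\<lambda>y. g' y v) V"
      proof (rule Ck_on_cong[OF *(4)])
        show "?c y = g' y v" if "y \<in> V" for y
          using cramer[OF M(1)[OF that], of "g' y v" v] M(2)[OF that, of v]
          by (simp add: divide_inverse)
        have "Ck_on k (\<lambda>y. if j = m then v $ i else ?M y $ i $ j) V" for i j m
          by (cases "j = m") (simp_all add: ent)
        then show "Ck_on k ?c V"
          using M(1) by (intro Ck_on_vec_lambda Ck_on_mult Ck_on_det Ck_on_inverse *(4) ent) auto
      qed
    qed
  qed
  then show ?thesis using that * by blast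
qed

section \<open>Second derivatives and change of variables\<close>

lemma has_derivative_imp_DERIV_line:
  fixes f :: "'a::real_normed_vector \<Rightarrow> real"
  assumes "(f has_derivative D) (at (p + s *\<^sub>R v))"
  shows "((\<lambda>s. f (p + s *\<^sub>R v)) has_real_derivative D v) (at s)"
proof -
  have "((\<lambda>s. p + s *\<^sub>R v) has_derivative (\<lambda>s. s *\<^sub>R v)) (at s)"
    by (auto intro!: derivative_eq_intros)
  from has_derivative_compose[OF this assms]
  have "((\<lambda>s. f (p + s *\<^sub>R v)) has_derivative (\<lambda>t. t *\<^sub>R D v)) (at s)"
    by (simp add: linear_cmul[OF has_derivative_linear[OF assms]])
  then show ?thesis
    by (rule has_derivative_imp_has_field_derivative) simp
qed

text \<open>The mean value theorem is applied twice: along \<open>v\<close> to the increment of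
  \<open>f\<close> over \<open>h w\<close>, then along \<open>w\<close> to the derivative in
  direction \<open>v\<close>. The left side is symmetric in \<open>v\<close> and \<open>w\<close>,
  and this is the source of the symmetry of second derivatives.\<close>

lemma second_difference_eq_second_derivative:
  fixes f :: "'a::euclidean_space \<Rightarrow> real"
  assumes f: "Ck_on (Suc (Suc 0)) f U" and h: "0 < h"
    and U: "\<And>s t. 0 \<le> s \<Longrightarrow> s \<le> h \<Longrightarrow> 0 \<le> t \<Longrightarrow> t \<le> h \<Longrightarrow> x + s *\<^sub>R v + t *\<^sub>R w \<in> U"
  shows "\<exists>s t. 0 \<le> s \<and> s \<le> h \<and> 0 \<le> t \<and> t \<le> h \<and>
    f (x + h *\<^sub>R v + h *\<^sub>R w) - f (x + h *\<^sub>R v) - f (x + h *\<^sub>R w) + f x =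
    h * (h * frechet_derivative (\<lambda>y. frechet_derivative f (at y) v) (at (x + s *\<^sub>R v + t *\<^sub>R w)) w)"
proof -
  let ?fv = "\<lambda>y. frechet_derivative f (at y) v"
  have fv: "Ck_on (Suc 0) ?fv U" using f by simp
  have 1: "((\<lambda>s. f ((x + c) + s *\<^sub>R v)) has_real_derivative ?fv ((x + c) + s *\<^sub>R v)) (at s)"
    if "(x + c) + s *\<^sub>R v \<in> U" for s c
    using has_derivative_imp_DERIV_line[OF Ck_on_has_derivative[OF f that]] .
  have 2: "((\<lambda>t. ?fv (p + t *\<^sub>R w)) has_real_derivative frechet_derivative ?fv (at (p + t *\<^sub>R w)) w) (at t)"
    if "p + t *\<^sub>R w \<in> U" for t p
    using has_derivative_imp_DERIV_line[OF Ck_on_has_derivative[OF fv that]] .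
  have "((\<lambda>s. f ((x + h *\<^sub>R w) + s *\<^sub>R v) - f ((x + 0) + s *\<^sub>R v)) has_real_derivative
      ?fv ((x + h *\<^sub>R w) + s *\<^sub>R v) - ?fv ((x + 0) + s *\<^sub>R v)) (at s)" if "0 \<le> s" "s \<le> h" for s
    using U[of s h] U[of s 0] that h
    by (intro DERIV_diff 1) (auto simp: algebra_simps)
  from MVT2[OF h this] obtain s where s: "0 < s" "s < h" and
    eq1: "f (x + h *\<^sub>R w + h *\<^sub>R v) - f (x + h *\<^sub>R v) - (f (x + h *\<^sub>R w) - f x) =
      h * (?fv (x + h *\<^sub>R w + s *\<^sub>R v) - ?fv (x + s *\<^sub>R v))"
    by auto
  have "((\<lambda>t. ?fv ((x + s *\<^sub>R v) + t *\<^sub>R w)) has_real_derivative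
      frechet_derivative ?fv (at ((x + s *\<^sub>R v) + t *\<^sub>R w)) w) (at t)" if "0 \<le> t" "t \<le> h" for t
    using U[of s t] that s by (intro 2) auto
  from MVT2[OF h this] obtain t where t: "0 < t" "t < h" and
    "?fv (x + s *\<^sub>R v + h *\<^sub>R w) - ?fv (x + s *\<^sub>R v) = h * frechet_derivative ?fv (at (x + s *\<^sub>R v + t *\<^sub>R w)) w"
    by auto
  with eq1 s t show ?thesis
    by (intro exI[of _ s] exI[of _ t]) (simp add: algebra_simps)
qed

lemma second_derivative_symmetric_real:
  fixes f :: "'a::euclidean_space \<Rightarrow> real"
  assumes U: "open U" and f: "Ck_on (Suc (Suc 0)) f U" and x: "x \<in> U"
  shows "frechet_derivative (\<lambda>y. frechet_derivative f (at y) v) (at x) w =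
    frechet_derivative (\<lambda>y. frechet_derivative f (at y) w) (at x) v"
proof (rule ccontr)
  define D where "D v w y = frechet_derivative (\<lambda>y. frechet_derivative f (at y) v) (at y) w" for v w y
  assume "\<not> ?thesis"
  then have ne: "D v w x \<noteq> D w v x" by (simp add: D_def)
  \<comment> \<open>Half of the gap: numbers closer than \<open>e\<close> to the two unequal
    derivatives cannot coincide.\<close>
  define e where "e = \<bar>D v w x - D w v x\<bar> / 2"
  have e: "e > 0" using ne by (simp add: e_def)
  have "continuous_on U (D v w)" for v w
    using f unfolding D_def by simp
  then have cont: "isCont (D v w) x" for v w
    using U x continuous_on_eq_continuous_at by blast
  have ev: "eventually (\<lambda>y. \<bar>D v w y - D v w x\<bar> < e) (nhds x)" for v w
    using cont[of v w] e unfolding isCont_def tendsto_iff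
    by (auto simp: dist_real_def eventually_nhds_conv_at)
  have "eventually (\<lambda>y. \<bar>D v w y - D v w x\<bar> < e \<and> \<bar>D w v y - D w v x\<bar> < e \<and> y \<in> U) (nhds x)"
    using ev[of v w] ev[of w v] eventually_nhds_in_open[OF U x] by eventually_elim auto
  then obtain \<delta> where \<delta>: "\<delta> > 0" and
    near: "\<And>y. dist y x < \<delta> \<Longrightarrow> \<bar>D v w y - D v w x\<bar> < e \<and> \<bar>D w v y - D w v x\<bar> < e \<and> y \<in> U"
    by (auto simp: eventually_nhds_metric)
  \<comment> \<open>This size keeps the parallelogram spanned by \<open>h v\<close> and
    \<open>h w\<close> within distance \<open>\<delta>\<close> of \<open>x\<close>; the summand 1
    keeps the denominator positive and the estimate strict.\<close>
  define h where "h = \<delta> / (norm v + norm w + 1)"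
  have pos: "norm v + norm w + 1 > 0" by (smt (verit) norm_ge_zero)
  have h: "h > 0" "h * (norm v + norm w) < \<delta>"
    using \<delta> pos by (auto simp: h_def field_simps)
  have small: "dist (x + s *\<^sub>R v + t *\<^sub>R w) x < \<delta>" if "0 \<le> s" "s \<le> h" "0 \<le> t" "t \<le> h" for s t
  proof -
    have "dist (x + s *\<^sub>R v + t *\<^sub>R w) x = norm (s *\<^sub>R v + t *\<^sub>R w)"
      by (simp add: dist_norm add.assoc)
    also have "\<dots> \<le> s * norm v + t * norm w"
      using norm_triangle_ineq[of "s *\<^sub>R v" "t *\<^sub>R w"] that by simp
    also have "\<dots> \<le> h * norm v + h * norm w"
      using that by (intro add_mono mult_right_mono) auto
    finally show ?thesis using h(2) by (simp add: algebra_simps)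
  qed
  have small': "dist (x + s *\<^sub>R w + t *\<^sub>R v) x < \<delta>" if "0 \<le> s" "s \<le> h" "0 \<le> t" "t \<le> h" for s t
    using small[of t s] that by (simp add: add.commute add.left_commute)
  obtain s t where st: "0 \<le> s" "s \<le> h" "0 \<le> t" "t \<le> h" and
    1: "f (x + h *\<^sub>R v + h *\<^sub>R w) - f (x + h *\<^sub>R v) - f (x + h *\<^sub>R w) + f x = h * (h * D v w (x + s *\<^sub>R v + t *\<^sub>R w))"
    using second_difference_eq_second_derivative[OF f h(1), of x v w] small near unfolding D_def by blast
  obtain s' t' where st': "0 \<le> s'" "s' \<le> h" "0 \<le> t'" "t' \<le> h" and
    2: "f (x + h *\<^sub>R w + h *\<^sub>R v) - f (x + h *\<^sub>R w) - f (x + h *\<^sub>R v) + f x = h * (h * D w v (x + s' *\<^sub>R w + t' *\<^sub>R v))"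
    using second_difference_eq_second_derivative[OF f h(1), of x w v] small' near unfolding D_def by blast
  have E: "x + h *\<^sub>R v + h *\<^sub>R w = x + h *\<^sub>R w + h *\<^sub>R v" by (simp add: algebra_simps)
  have "f (x + h *\<^sub>R v + h *\<^sub>R w) - f (x + h *\<^sub>R v) - f (x + h *\<^sub>R w) + f x =
      f (x + h *\<^sub>R w + h *\<^sub>R v) - f (x + h *\<^sub>R w) - f (x + h *\<^sub>R v) + f x"
    unfolding E by simp
  then have "h * (h * D v w (x + s *\<^sub>R v + t *\<^sub>R w)) = h * (h * D w v (x + s' *\<^sub>R w + t' *\<^sub>R v))"
    unfolding 1 2 .
  then have "D v w (x + s *\<^sub>R v + t *\<^sub>R w) = D w v (x + s' *\<^sub>R w + t' *\<^sub>R v)"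
    using h(1) by simp
  moreover have "\<bar>D v w (x + s *\<^sub>R v + t *\<^sub>R w) - D v w x\<bar> < e" using near small[OF st] by blast
  moreover have "\<bar>D w v (x + s' *\<^sub>R w + t' *\<^sub>R v) - D w v x\<bar> < e" using near small'[OF st'] by blast
  ultimately show False unfolding e_def by (smt (verit) field_sum_of_halves)
qed

lemma frechet_derivative_inner_const:
  assumes "f differentiable (at x)"
  shows "frechet_derivative (\<lambda>y. f y \<bullet> b) (at x) = (\<lambda>v. frechet_derivative f (at x) v \<bullet> b)"
  using has_derivative_inner_left[OF assms[unfolded frechet_derivative_works]]
  by (rule frechet_derivative_eqI)

lemma second_derivative_symmetric:
  fixes f :: "'a::euclidean_space \<Rightarrow> 'b::euclidean_space"
  assumes U: "open U" and f: "Ck_on (Suc (Suc 0)) f U" and x: "x \<in> U"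
  shows "frechet_derivative (\<lambda>y. frechet_derivative f (at y) v) (at x) w =
    frechet_derivative (\<lambda>y. frechet_derivative f (at y) w) (at x) v"
proof (rule euclidean_eqI)
  fix b :: 'b assume "b \<in> Basis"
  have fb: "Ck_on (Suc (Suc 0)) (\<lambda>y. f y \<bullet> b) U"
    using U f by (intro Ck_on_inner Ck_on_const)
  have "frechet_derivative (\<lambda>y. frechet_derivative (\<lambda>y. f y \<bullet> b) (at y) v) (at x) w =
      frechet_derivative (\<lambda>y. frechet_derivative f (at y) v) (at x) w \<bullet> b" for v w
  proof -
    have "frechet_derivative (\<lambda>y. frechet_derivative (\<lambda>y. f y \<bullet> b) (at y) v) (at x) =
        frechet_derivative (\<lambda>y. frechet_derivative f (at y) v \<bullet> b) (at x)"
      using f by (intro frechet_derivative_cong_open[OF U x]) (simp add: frechet_derivative_inner_const)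
    also have "\<dots> = (\<lambda>w. frechet_derivative (\<lambda>y. frechet_derivative f (at y) v) (at x) w \<bullet> b)"
      using f x by (intro frechet_derivative_inner_const) simp
    finally show ?thesis by simp
  qed
  then show "frechet_derivative (\<lambda>y. frechet_derivative f (at y) v) (at x) w \<bullet> b =
    frechet_derivative (\<lambda>y. frechet_derivative f (at y) w) (at x) v \<bullet> b"
    using second_derivative_symmetric_real[OF U fb x, of v w] by simp
qed

text \<open>The change-of-variables theorem of the library needs a well-ordered index type, so it is
  carried over from a well-ordered copy of the index type.\<close>

typedef 'n ordered_index = "{..<CARD('n::finite)}"
  by (auto intro: exI[of _ 0])

instantiation ordered_index :: (finite) "{finite, wellorder}"
begin

definition "x \<le> y \<longleftrightarrow> Rep_ordered_index x \<le> Rep_ordered_index y"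
definition "x < y \<longleftrightarrow> Rep_ordered_index x < Rep_ordered_index y"

instance
proof
  have "range (Rep_ordered_index :: 'a ordered_index \<Rightarrow> nat) \<subseteq> {..<CARD('a)}"
    using Rep_ordered_index by auto
  then show "finite (UNIV :: 'a ordered_index set)"
    by (metis Rep_ordered_index_inject finite_imageD finite_lessThan finite_subset injI)
next
  fix P and a :: "'a ordered_index"
  assume "\<And>x :: 'a ordered_index. (\<And>y. y < x \<Longrightarrow> P y) \<Longrightarrow> P x"
  then show "P a"
    unfolding less_ordered_index_def
    by (induction "Rep_ordered_index a" arbitrary: a rule: less_induct) blast
qed (auto simp: less_eq_ordered_index_def less_ordered_index_def Rep_ordered_index_inject)

end

lemma ex_bij_ordered_index: "\<exists>p :: 'n ordered_index \<Rightarrow> 'n::finite. bij p"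
proof -
  have "CARD('n ordered_index) = CARD('n)"
    using type_definition.card[OF type_definition_ordered_index[where 'n='n]] by simp
  then show ?thesis
    using finite_same_card_bij[of "UNIV :: 'n ordered_index set" "UNIV :: 'n set"] by auto
qed

section \<open>Permutations of coordinates: Lebesgue measure and determinants\<close>

lemma prod_Basis_vec:
  fixes f :: "real^'n::finite \<Rightarrow> 'b::comm_monoid_mult"
  shows "(\<Prod>b\<in>Basis. f b) = (\<Prod>i\<in>UNIV. f (axis i 1))"
proof -
  have B: "Basis = (\<lambda>i. axis i (1::real) :: real^'n) ` UNIV"
    by (auto simp: Basis_vec_def)
  moreover have "inj (\<lambda>i. axis i (1::real) :: real^'n)"
    by (auto simp: inj_on_def axis_eq_axis)
  ultimately show ?thesis
    unfolding B by (simp add: prod.reindex)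
qed

definition vec_reindex :: "('m \<Rightarrow> 'n) \<Rightarrow> real^'n \<Rightarrow> real^'m::finite" where
  "vec_reindex p x = (\<chi> i. x $ p i)"

lemma linear_vec_reindex: "linear (vec_reindex p)"
  by (auto simp: vec_reindex_def linear_iff vec_eq_iff)

lemma vec_reindex_inverse:
  "bij p \<Longrightarrow> vec_reindex p (vec_reindex (inv p) x) = x"
  "bij p \<Longrightarrow> vec_reindex (inv p) (vec_reindex p y) = y"
  by (simp_all add: vec_reindex_def vec_eq_iff bij_is_inj bij_is_surj surj_f_inv_f)

text \<open>Lebesgue measure is determined by its values on boxes, and the preimage of a box is the
  box with its sides permuted, which has the same product of side lengths.\<close>

lemma distr_lborel_vec_reindex:
  fixes p :: "'m::finite \<Rightarrow> 'n::finite"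
  assumes "bij p"
  shows "distr lborel borel (vec_reindex p) = lborel"
proof (rule lborel_eqI[symmetric])
  have meas: "vec_reindex p \<in> borel_measurable lborel"
    using linear_vec_reindex[of p] by (simp add: linear_continuous_on linear_linear borel_measurable_continuous_onI)
  fix l u :: "real^'m" assume lu: "\<And>b. b \<in> Basis \<Longrightarrow> l \<bullet> b \<le> u \<bullet> b"
  then have lu': "l $ i \<le> u $ i" for i
    using lu[of "axis i 1"] by (auto simp: inner_axis Basis_vec_def)
  let ?q = "vec_reindex (inv p) :: real^'m \<Rightarrow> real^'n"
  have "vec_reindex p -` box l u = box (?q l) (?q u)"
    by (auto simp: mem_box_cart vec_reindex_def) (metis assms bij_inv_eq_iff)+
  then have "emeasure (distr lborel borel (vec_reindex p)) (box l u) = emeasure lborel (box (?q l) (?q u))"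
    using meas by (subst emeasure_distr) auto
  also have "\<dots> = (\<Prod>b\<in>Basis. (?q u - ?q l) \<bullet> b)"
    using lu' by (intro emeasure_lborel_box) (auto simp: Basis_vec_def inner_axis vec_reindex_def)
  also have "\<dots> = (\<Prod>i\<in>UNIV. ennreal (u $ inv p i - l $ inv p i))"
    using lu' by (simp add: prod_Basis_vec inner_axis vec_reindex_def prod_ennreal)
  also have "\<dots> = (\<Prod>i\<in>UNIV. ennreal (u $ i - l $ i))"
    by (rule prod.reindex_bij_betw) (use assms bij_imp_bij_inv in auto)
  also have "\<dots> = (\<Prod>b\<in>Basis. (u - l) \<bullet> b)"
    using lu' by (simp add: prod_Basis_vec inner_axis prod_ennreal)
  finally show "emeasure (distr lborel borel (vec_reindex p)) (box l u) = (\<Prod>b\<in>Basis. (u - l) \<bullet> b)" .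
qed simp

text \<open>Conjugation by \<open>p\<close> matches the permutations in the two Leibniz sums and
  preserves their signs.\<close>

lemma det_reindex:
  fixes p :: "'m::finite \<Rightarrow> 'n::finite" and A :: "real^'n^'n"
  assumes "bij p"
  shows "det (\<chi> i j. A $ p i $ p j :: real^'m^'m) = det A"
proof -
  have inj: "inj p" using assms by (rule bij_is_inj)
  let ?m = "map_permutation UNIV p"
  have m_app: "?m q (p i) = p (q i)" for q i
    using inj by (simp add: map_permutation_apply)
  have bb: "bij_betw ?m {q. q permutes (UNIV :: 'm set)} {q. q permutes (UNIV :: 'n set)}"
  proof (rule bij_betw_byWitness[where f' = "map_permutation UNIV (inv p)"])
    have inj': "inj (inv p)"
      using bij_imp_bij_inv[OF assms] by (rule bij_is_inj)
    show "\<forall>q\<in>{q. q permutes UNIV}. map_permutation UNIV (inv p) (?m q) = q"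
      using assms inj by (auto intro!: map_permutation_compose_inv)
    show "\<forall>q\<in>{q. q permutes UNIV}. ?m (map_permutation UNIV (inv p) q) = q"
      using assms bij_imp_bij_inv[OF assms] inj'
      by (auto intro!: map_permutation_compose_inv simp: bij_is_surj surj_f_inv_f)
    show "?m ` {q. q permutes UNIV} \<subseteq> {q. q permutes UNIV}"
      using assms by (auto intro!: map_permutation_permutes)
    show "map_permutation UNIV (inv p) ` {q. q permutes UNIV} \<subseteq> {q. q permutes UNIV}"
      using bij_imp_bij_inv[OF assms] by (auto intro!: map_permutation_permutes)
  qed
  have "det A = (\<Sum>q | q permutes (UNIV :: 'm set). of_int (sign (?m q)) * (\<Prod>i\<in>UNIV. A $ i $ ?m q i))"
    unfolding det_def by (rule sum.reindex_bij_betw[OF bb, symmetric])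
  also have "\<dots> = (\<Sum>q | q permutes (UNIV :: 'm set). of_int (sign q) * (\<Prod>i\<in>UNIV. A $ p i $ p (q i)))"
  proof (intro sum.cong refl)
    fix q assume q: "q \<in> {q. q permutes (UNIV :: 'm set)}"
    have "(\<Prod>i\<in>UNIV. A $ i $ ?m q i) = (\<Prod>i\<in>UNIV. A $ p i $ ?m q (p i))"
      by (rule prod.reindex_bij_betw[OF assms, symmetric])
    moreover have "sign (?m q) = sign q"
      using q inj by (intro sign_map_permutation) auto
    ultimately show "of_int (sign (?m q)) * (\<Prod>i\<in>UNIV. A $ i $ ?m q i) =
       of_int (sign q) * (\<Prod>i\<in>UNIV. A $ p i $ p (q i))"
      by (simp add: m_app)
  qed
  finally show ?thesis by (simp add: det_def)
qed

text \<open>Passage between the Lebesgue integral and the gauge integral, in terms of which the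
  change of variables is stated. Only finite values \<open>r\<close> are covered.\<close>

lemma nn_integral_eq_iff_has_integral:
  fixes f :: "'a::euclidean_space \<Rightarrow> real"
  assumes "(\<lambda>x. indicator S x * f x) \<in> borel_measurable borel" "\<And>x. x \<in> S \<Longrightarrow> 0 \<le> f x" "0 \<le> r"
  shows "(\<integral>\<^sup>+x\<in>S. ennreal (f x) \<partial>lborel) = ennreal r \<longleftrightarrow> (f has_integral r) S"
proof
  assume *: "(\<integral>\<^sup>+x\<in>S. ennreal (f x) \<partial>lborel) = ennreal r"
  have "(\<integral>\<^sup>+x. ennreal (indicator S x * f x) \<partial>lborel) = (\<integral>\<^sup>+x\<in>S. ennreal (f x) \<partial>lborel)"
    by (intro nn_integral_cong) (auto simp: indicator_def)
  then have "((\<lambda>x. indicator S x * f x) has_integral r) UNIV"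
    using assms * by (intro nn_integral_has_integral) (auto simp: indicator_def)
  moreover have "(\<lambda>x. indicator S x * f x) = (\<lambda>x. if x \<in> S then f x else 0)"
    by (auto simp: indicator_def)
  ultimately show "(f has_integral r) S"
    by (simp add: has_integral_restrict_UNIV)
qed (use assms nn_integral_has_integral_lebesgue' in blast)

text \<open>An extended nonnegative number is determined by which real it equals, if any. So the
  equivalence of the \<open>has_integral\<close> statements for every finite \<open>r\<close> also
  settles the case of infinite integrals.\<close>

lemma nn_integral_change_of_variables_wellorder:
  fixes f :: "real^'n::{finite,wellorder} \<Rightarrow> real" and g :: "real^'n::_ \<Rightarrow> real^'n::_"
  assumes "\<And>x. x \<in> S \<Longrightarrow> (g has_derivative g' x) (at x within S)"
      and "\<And>y. y \<in> T \<Longrightarrow> (h has_derivative h' y) (at y within T)"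
      and f: "\<And>y. y \<in> T \<Longrightarrow> 0 \<le> f y"
      and g: "\<And>x. x \<in> S \<Longrightarrow> g x \<in> T \<and> h(g x) = x"
      and "\<And>y. y \<in> T \<Longrightarrow> h y \<in> S \<and> g(h y) = y"
      and "\<And>y. y \<in> T \<Longrightarrow> h' y \<circ> g'(h y) = id"
      and m1: "(\<lambda>x. indicator S x * (\<bar>det (matrix (g' x))\<bar> * f (g x))) \<in> borel_measurable borel"
      and m2: "(\<lambda>y. indicator T y * f y) \<in> borel_measurable borel"
    shows "(\<integral>\<^sup>+x\<in>S. ennreal (\<bar>det (matrix (g' x))\<bar> * f (g x)) \<partial>lborel) = (\<integral>\<^sup>+y\<in>T. ennreal (f y) \<partial>lborel)"
      (is "?L = ?R")
proof -
  have *: "?L = ennreal r \<longleftrightarrow> ?R = ennreal r" if "0 \<le> r" for r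
  proof -
    have "?L = ennreal r \<longleftrightarrow> ((\<lambda>x. \<bar>det (matrix (g' x))\<bar> * f (g x)) has_integral r) S"
      using f g by (intro nn_integral_eq_iff_has_integral m1 that) auto
    also have "\<dots> \<longleftrightarrow> (f has_integral r) T"
      by (rule cov_invertible_nonneg_eq[OF assms(1-6)])
    also have "\<dots> \<longleftrightarrow> ?R = ennreal r"
      using nn_integral_eq_iff_has_integral[OF m2 f that] by simp
    finally show ?thesis .
  qed
  show ?thesis
    by (cases ?L; cases ?R) (use * in \<open>auto simp: ennreal_neq_top top_neq_ennreal\<close>)
qed

lemma matrix_reindex:
  fixes p :: "'m::finite \<Rightarrow> 'n::finite" and G :: "real^'n \<Rightarrow> real^'n"
  assumes "bij p"
  shows "matrix (vec_reindex p \<circ> G \<circ> vec_reindex (inv p)) = (\<chi> i j. matrix G $ p i $ p j)"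
proof -
  have "inv p i = j \<longleftrightarrow> i = p j" for i j
    using bij_inv_eq_iff[OF assms, of j i] by auto
  then have "vec_reindex (inv p) (axis j (1::real)) = axis (p j) 1" for j
    by (simp add: vec_reindex_def vec_eq_iff axis_def)
  then show ?thesis
    by (auto simp: matrix_def vec_eq_iff vec_reindex_def)
qed

lemma nn_integral_change_of_variables:
  fixes f :: "real^'n::finite \<Rightarrow> real" and g :: "real^'n \<Rightarrow> real^'n"
  assumes dg: "\<And>x. x \<in> S \<Longrightarrow> (g has_derivative g' x) (at x within S)"
      and dh: "\<And>y. y \<in> T \<Longrightarrow> (h has_derivative h' y) (at y within T)"
      and f: "\<And>y. y \<in> T \<Longrightarrow> 0 \<le> f y"
      and g: "\<And>x. x \<in> S \<Longrightarrow> g x \<in> T \<and> h(g x) = x"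
      and h: "\<And>y. y \<in> T \<Longrightarrow> h y \<in> S \<and> g(h y) = y"
      and id: "\<And>y. y \<in> T \<Longrightarrow> h' y \<circ> g'(h y) = id"
      and m1: "(\<lambda>x. indicator S x * (\<bar>det (matrix (g' x))\<bar> * f (g x))) \<in> borel_measurable borel"
      and m2: "(\<lambda>y. indicator T y * f y) \<in> borel_measurable borel"
    shows "(\<integral>\<^sup>+x\<in>S. ennreal (\<bar>det (matrix (g' x))\<bar> * f (g x)) \<partial>lborel) = (\<integral>\<^sup>+y\<in>T. ennreal (f y) \<partial>lborel)"
proof -
  obtain p :: "'n ordered_index \<Rightarrow> 'n" where p: "bij p" using ex_bij_ordered_index by blast
  let ?q = "vec_reindex p :: real^'n \<Rightarrow> real^'n ordered_index"
  let ?r = "vec_reindex (inv p) :: real^'n ordered_index \<Rightarrow> real^'n"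
  note inv = vec_reindex_inverse[OF p]
  have lin: "bounded_linear ?q" "bounded_linear ?r"
    using linear_vec_reindex linear_conv_bounded_linear by blast+
  have meas: "?q \<in> borel_measurable borel" "?r \<in> borel_measurable borel"
    using lin by (auto simp: linear_continuous_on borel_measurable_continuous_onI)
  have distr: "lborel = distr lborel borel ?r"
    using distr_lborel_vec_reindex[OF bij_imp_bij_inv[OF p]] by simp
  \<comment> \<open>\<open>?r\<close> preserves Lebesgue measure, so both sides of the claim move to
    the well-ordered copy; the Jacobian determinant is unchanged there by
    \<open>det_reindex\<close>.\<close>
  have nn: "(\<integral>\<^sup>+x\<in>A. ennreal (k x) \<partial>lborel) = (\<integral>\<^sup>+y\<in>?r -` A. ennreal (k (?r y)) \<partial>lborel)"
    if "(\<lambda>x. indicator A x * k x) \<in> borel_measurable borel" for A k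
  proof -
    have "(\<integral>\<^sup>+x\<in>A. ennreal (k x) \<partial>lborel) = (\<integral>\<^sup>+x. ennreal (indicator A x * k x) \<partial>lborel)"
      by (intro nn_integral_cong) (auto simp: indicator_def)
    also have "\<dots> = (\<integral>\<^sup>+x. ennreal (indicator A (?r x) * k (?r x)) \<partial>lborel)"
      using that meas by (subst distr, subst nn_integral_distr) auto
    also have "\<dots> = (\<integral>\<^sup>+y\<in>?r -` A. ennreal (k (?r y)) \<partial>lborel)"
      by (intro nn_integral_cong) (auto simp: indicator_def)
    finally show ?thesis .
  qed
  let ?G' = "\<lambda>x. ?q \<circ> g' (?r x) \<circ> ?r" and ?H' = "\<lambda>x. ?q \<circ> h' (?r x) \<circ> ?r"
  have der: "((?q \<circ> k \<circ> ?r) has_derivative (?q \<circ> k' \<circ> ?r)) (at x within ?r -` A)"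
    if "(k has_derivative k') (at (?r x) within A)" for k k' x A
  proof -
    have "(k has_derivative k') (at (?r x) within ?r ` (?r -` A))"
      using that by (rule has_derivative_subset) auto
    from has_derivative_in_compose[OF bounded_linear_imp_has_derivative[OF lin(2)] this]
    have "((\<lambda>x. k (?r x)) has_derivative (\<lambda>x. k' (?r x))) (at x within ?r -` A)" .
    from bounded_linear.has_derivative[OF lin(1) this] show ?thesis
      by (simp add: o_def)
  qed
  have det: "det (matrix (?G' x)) = det (matrix (g' (?r x)))" for x
    using matrix_reindex[OF p] det_reindex[OF p] by simp
  have m1': "(\<lambda>x. indicator (?r -` S) x * (\<bar>det (matrix (?G' x))\<bar> * f (?r ((?q \<circ> g \<circ> ?r) x)))) \<in> borel_measurable borel"
  proof -
    have "(\<lambda>x. indicator (?r -` S) x * (\<bar>det (matrix (?G' x))\<bar> * f (?r ((?q \<circ> g \<circ> ?r) x)))) =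
        (\<lambda>x. indicator S x * (\<bar>det (matrix (g' x))\<bar> * f (g x))) \<circ> ?r"
      using det by (auto simp: fun_eq_iff indicator_def inv)
    then show ?thesis using measurable_comp[OF meas(2) m1] by simp
  qed
  have m2': "(\<lambda>y. indicator (?r -` T) y * f (?r y)) \<in> borel_measurable borel"
    using measurable_comp[OF meas(2) m2] by (simp add: o_def indicator_def)
  have "(\<integral>\<^sup>+x\<in>S. ennreal (\<bar>det (matrix (g' x))\<bar> * f (g x)) \<partial>lborel) =
      (\<integral>\<^sup>+x\<in>?r -` S. ennreal (\<bar>det (matrix (g' (?r x)))\<bar> * f (g (?r x))) \<partial>lborel)"
    by (rule nn[OF m1])
  also have "\<dots> = (\<integral>\<^sup>+x\<in>?r -` S. ennreal (\<bar>det (matrix (?G' x))\<bar> * f (?r ((?q \<circ> g \<circ> ?r) x))) \<partial>lborel)"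
    using det by (intro nn_integral_cong) (auto simp: indicator_def inv)
  also have "\<dots> = (\<integral>\<^sup>+x\<in>?r -` T. ennreal (f (?r x)) \<partial>lborel)"
  proof (rule nn_integral_change_of_variables_wellorder[where h = "?q \<circ> h \<circ> ?r" and h' = ?H'])
    show "((?q \<circ> g \<circ> ?r) has_derivative ?G' x) (at x within ?r -` S)" if "x \<in> ?r -` S" for x
      using that by (intro der dg) auto
    show "((?q \<circ> h \<circ> ?r) has_derivative ?H' x) (at x within ?r -` T)" if "x \<in> ?r -` T" for x
      using that by (intro der dh) auto
    show "?H' y \<circ> ?G' ((?q \<circ> h \<circ> ?r) y) = Fun.id" if "y \<in> ?r -` T" for y
      using id[of "?r y"] that by (auto simp: fun_eq_iff inv)
  qed (use f g h inv m1' m2' in \<open>auto simp: o_def\<close>)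
  also have "\<dots> = (\<integral>\<^sup>+y\<in>T. ennreal (f y) \<partial>lborel)"
    by (rule nn[OF m2, symmetric])
  finally show ?thesis .
qed

section \<open>Charts and curvature\<close>

definition gram :: "(real^'n::finite \<Rightarrow> 'a::euclidean_space) \<Rightarrow> real^'n^'n" where
  "gram L = (\<chi> i j. L (axis i 1) \<bullet> L (axis j 1))"

lemma volume_density_eq_gram: "volume_density \<psi> u = sqrt (det (gram (frechet_derivative \<psi> (at u))))"
  by (simp add: volume_density_def gram_def)

lemma linear_axis_expansion:
  fixes L :: "real^'n::finite \<Rightarrow> 'b::real_vector"
  assumes "linear L" shows "L x = (\<Sum>k\<in>UNIV. x $ k *\<^sub>R L (axis k 1))"
proof -
  have "x = (\<Sum>k\<in>UNIV. x $ k *\<^sub>R axis k 1)"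
    by (simp add: vec_eq_iff axis_def if_distrib cong: if_cong)
  then have "L x = L (\<Sum>k\<in>UNIV. x $ k *\<^sub>R axis k 1)" by simp
  then show ?thesis by (simp add: linear_sum[OF assms] linear_cmul[OF assms])
qed

text \<open>\<open>gram (L \<circ> A)\<close> is \<open>gram L\<close> multiplied by
  \<open>matrix A\<close> on the right and by its transpose on the left. This governs changes of
  chart as well as changes of frame.\<close>

lemma det_gram_compose:
  fixes L :: "real^'n::finite \<Rightarrow> 'a::euclidean_space" and A :: "real^'n \<Rightarrow> real^'n"
  assumes L: "linear L"
  shows "det (gram (L \<circ> A)) = (det (matrix A))\<^sup>2 * det (gram L)"
proof -
  have LA: "L (A (axis i 1)) = (\<Sum>k\<in>UNIV. matrix A $ k $ i *\<^sub>R L (axis k 1))" for i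
    using linear_axis_expansion[OF L, of "A (axis i 1)"] by (simp add: matrix_def)
  have "gram (L \<circ> A) = transpose (matrix A) ** (gram L ** matrix A)"
    unfolding vec_eq_iff
  proof (intro allI)
    fix i j
    let ?m = "\<lambda>k i. matrix A $ k $ i"
    have "gram (L \<circ> A) $ i $ j = (\<Sum>k\<in>UNIV. \<Sum>l\<in>UNIV. ?m k i * (?m l j * (L (axis k 1) \<bullet> L (axis l 1))))"
      unfolding gram_def o_def by (simp only: LA vec_lambda_beta inner_sum_left) (simp add: inner_sum_right sum_distrib_left mult.left_commute)
    also have "\<dots> = (transpose (matrix A) ** (gram L ** matrix A)) $ i $ j"
      by (simp add: gram_def matrix_matrix_mult_def transpose_def sum_distrib_left mult_ac)
    finally show "gram (L \<circ> A) $ i $ j = (transpose (matrix A) ** (gram L ** matrix A)) $ i $ j" .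
  qed
  then show ?thesis
    by (simp add: det_mul det_transpose power2_eq_square)
qed

text \<open>Injectivity gives the range dimension \<open>CARD('n)\<close>, so the basis can be
  indexed by \<open>'n\<close>. The preimages \<open>c i\<close> are the coordinate directions along
  which derivatives in a chart are taken.\<close>

lemma orthonormal_frame:
  fixes L :: "real^'n::finite \<Rightarrow> 'a::euclidean_space"
  assumes L: "linear L" "inj L" and B: "orthonormal_basis_of (range L) B"
  obtains e c where "bij_betw e (UNIV :: 'n set) B" "\<And>i. L (c i) = e i"
    "\<And>i j. e i \<bullet> e j = (if i = j then 1 else 0)"
proof -
  have B': "B \<subseteq> range L" "pairwise orthogonal B" "\<And>e. e \<in> B \<Longrightarrow> norm e = 1" "span B = range L"
    using B by (auto simp: orthonormal_basis_of_def)
  then have "0 \<notin> B" using B'(3)[of 0] by auto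
  then have ind: "independent B" using B'(2) by (intro pairwise_orthogonal_independent)
  have "card B = dim (range L)"
    using dim_span[of B] dim_eq_card_independent[OF ind] B'(4) by simp
  also have "\<dots> = CARD('n)"
    using dim_image_eq[OF L(1), of UNIV] L(2) by simp
  finally have "card B = CARD('n)" .
  then obtain e where e: "bij_betw e (UNIV :: 'n set) B"
    using finite_same_card_bij[of "UNIV :: 'n set" B] independent_imp_finite[OF ind] by auto
  have eB: "e i \<in> B" for i using e by (auto simp: bij_betw_def)
  have "\<exists>c. \<forall>i. L (c i) = e i"
    using eB B'(1) by (intro choice) (metis imageE subsetD)
  then obtain c where "\<And>i. L (c i) = e i" by blast
  moreover have "e i \<bullet> e j = (if i = j then 1 else 0)" for i j
  proof (cases "i = j")
    case True
    then show ?thesis using B'(3)[OF eB[of j]] by (simp add: norm_eq_1)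
  next
    case False
    then have "e i \<noteq> e j" using e by (auto simp: bij_betw_def inj_on_def)
    then show ?thesis using False B'(2) eB by (simp add: pairwise_def orthogonal_def)
  qed
  ultimately show ?thesis using e that by blast
qed

lemma ex_orthonormal_basis_of: "subspace S \<Longrightarrow> \<exists>B. orthonormal_basis_of S B"
  unfolding orthonormal_basis_of_def
  by (metis orthonormal_basis_subspace)

text \<open>This is \<open>det_gram_compose\<close> for the map that sends the coordinate axes to
  the vectors \<open>c k\<close>. When the \<open>L (c i)\<close> are orthonormal the left side is
  1, so the squared factor is the reciprocal of the Gram determinant.\<close>

lemma det_gram_frame:
  fixes L :: "real^'n::finite \<Rightarrow> 'a::euclidean_space"
  assumes L: "linear L"
  shows "det (\<chi> i j. L (c i) \<bullet> L (c j)) = (det (matrix (\<lambda>x. \<Sum>k\<in>UNIV. x $ k *\<^sub>R c k)))\<^sup>2 * det (gram L)"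
proof -
  let ?A = "\<lambda>x :: real^'n. \<Sum>k\<in>UNIV. x $ k *\<^sub>R c k"
  have "?A (axis i 1) = c i" for i
    by (simp add: axis_def if_distrib[of "\<lambda>x. x *\<^sub>R _"] cong: if_cong)
  then have "(\<chi> i j. L (c i) \<bullet> L (c j)) = gram (L \<circ> ?A)"
    by (simp add: gram_def)
  then show ?thesis
    using det_gram_compose[OF L, of ?A] by simp
qed

text \<open>An orthonormal basis of the range makes a square times \<open>det (gram L)\<close> equal
  to 1, which excludes values that are not positive.\<close>

lemma det_gram_pos:
  fixes L :: "real^'n::finite \<Rightarrow> 'a::euclidean_space"
  assumes "linear L" "inj L"
  shows "det (gram L) > 0"
proof -
  obtain B where "orthonormal_basis_of (range L) B"
    using ex_orthonormal_basis_of[OF linear_subspace_image[OF assms(1) subspace_UNIV]] by blast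
  then obtain e c where ec: "\<And>i. L (c i) = e i" "\<And>i j::'n. e i \<bullet> e j = (if i = j then 1 else 0)"
    using orthonormal_frame[OF assms] by metis
  have "(\<chi> i j. L (c i) \<bullet> L (c j)) = (mat 1 :: real^'n^'n)"
    by (simp add: ec mat_def)
  then have *: "(det (matrix (\<lambda>x. \<Sum>k\<in>UNIV. x $ k *\<^sub>R c k)))\<^sup>2 * det (gram L) = 1"
    using det_gram_frame[OF assms(1), of c] by simp
  show ?thesis
  proof (rule ccontr)
    assume "\<not> ?thesis"
    then have "(det (matrix (\<lambda>x. \<Sum>k\<in>UNIV. x $ k *\<^sub>R c k)))\<^sup>2 * det (gram L) \<le> 0"
      by (intro mult_nonneg_nonpos) auto
    with * show False by simp
  qed
qed

section \<open>Inverses of charts and tangent spaces\<close>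

context
  fixes \<Sigma> :: "'a::euclidean_space set" and U :: "(real^'n::finite) set" and \<psi> :: "real^'n \<Rightarrow> 'a"
  assumes lp: "local_param \<Sigma> U \<psi>"
begin

lemma local_param_open: "open U"
  using lp by (simp add: local_param_def)

lemma local_param_Ck: "Ck_on k \<psi> U"
  using lp smooth_on_open_iff[of U \<psi>] by (auto simp: local_param_def)

lemma local_param_has_derivative: "u \<in> U \<Longrightarrow> (\<psi> has_derivative frechet_derivative \<psi> (at u)) (at u)"
  using Ck_on_has_derivative[OF local_param_Ck] .

lemma local_param_linear: "u \<in> U \<Longrightarrow> linear (frechet_derivative \<psi> (at u))"
  using has_derivative_linear[OF local_param_has_derivative] .

lemma local_param_inj: "u \<in> U \<Longrightarrow> inj (frechet_derivative \<psi> (at u))"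
  using lp by (simp add: local_param_def)

lemma local_param_inj_on: "inj_on \<psi> U"
  using lp by (auto simp: local_param_def homeomorphism_def intro: inj_on_inverseI)

lemma local_param_openin: "openin (top_of_set \<Sigma>) (\<psi> ` U)"
  using lp by (simp add: local_param_def)

lemma local_param_subset: "\<psi> ` U \<subseteq> \<Sigma>"
  using local_param_openin openin_imp_subset by blast

lemma local_param_open_map:
  assumes "open V" "V \<subseteq> U" shows "openin (top_of_set \<Sigma>) (\<psi> ` V)"
proof -
  obtain g where g: "homeomorphism U (\<psi> ` U) \<psi> g"
    using lp by (auto simp: local_param_def)
  have "openin (top_of_set U) V" using assms by (simp add: open_subset)
  then have "openin (top_of_set (\<psi> ` U)) (\<psi> ` V)"
    using homeomorphism_imp_open_map[OF g] by blast
  then show ?thesis using local_param_openin openin_trans by blast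
qed

text \<open>A left inverse \<open>L\<close> of the derivative at \<open>u0\<close> makes
  \<open>L \<circ> \<psi>\<close> a map between spaces of equal dimension whose derivative at
  \<open>u0\<close> is the identity. Its local inverse composed with \<open>L\<close> is
  \<open>\<rho>\<close>, smooth on an open set of the ambient space. From this extension of the
  inverse chart come the tangent spaces, the tangent fields and the differentiability of transition
  maps.\<close>

lemma local_param_ambient_inverse:
  assumes u0: "u0 \<in> U"
  obtains W \<rho> where "open W" "\<psi> u0 \<in> W" "\<And>k. Ck_on k \<rho> W" "\<rho> ` W \<subseteq> U"
    "\<And>y. y \<in> W \<Longrightarrow> y \<in> \<Sigma> \<Longrightarrow> \<psi> (\<rho> y) = y" "\<And>u. u \<in> U \<Longrightarrow> \<psi> u \<in> W \<Longrightarrow> \<rho> (\<psi> u) = u"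
proof -
  obtain L where L: "linear L" "L \<circ> frechet_derivative \<psi> (at u0) = id"
    using linear_injective_left_inverse[OF local_param_linear local_param_inj] u0 by blast
  have bl: "bounded_linear L" using L(1) linear_conv_bounded_linear by blast
  let ?h = "\<lambda>u. L (\<psi> u)"
  have hk: "Ck_on k ?h U" for k
    using Ck_on_linear_compose[OF bl local_param_open local_param_Ck] .
  have "frechet_derivative ?h (at u0) = id"
    using frechet_derivative_eqI[OF bounded_linear.has_derivative[OF bl local_param_has_derivative[OF u0]]] L(2)
    by (simp add: o_def id_def)
  then have "inj (frechet_derivative ?h (at u0))" by simp
  then obtain U' V g where *: "open U'" "U' \<subseteq> U" "u0 \<in> U'" "open V" "?h u0 \<in> V"
    "homeomorphism U' V ?h g" "\<And>k. Ck_on k g V"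
    using smooth_inverse_function[OF local_param_open hk u0] by blast
  \<comment> \<open>Embeddedness enters here: \<open>W0\<close> keeps out the parts of
    \<open>\<Sigma>\<close> that may come close to \<open>\<psi> u0\<close> without belonging to the
    image of \<open>U'\<close>.\<close>
  obtain W0 where W0: "open W0" "\<psi> ` U' = \<Sigma> \<inter> W0"
    using local_param_open_map[OF *(1,2)] by (auto simp: openin_open)
  define W where "W = W0 \<inter> L -` V"
  have "open (L -` V)"
    by (rule open_vimage[OF *(4) linear_continuous_on[OF bl]])
  then have W: "open W" using W0 by (auto simp: W_def)
  have LW: "L ` W \<subseteq> V" by (auto simp: W_def)
  have retract: "\<exists>u\<in>U'. y = \<psi> u \<and> g (L y) = u" if y: "y \<in> W" "y \<in> \<Sigma>" for y
  proof -
    obtain u where "u \<in> U'" "y = \<psi> u" using y W0 by (auto simp: W_def)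
    then show ?thesis using *(6) by (auto simp: homeomorphism_def)
  qed
  show ?thesis
  proof
    show "open W" by fact
    show "\<psi> u0 \<in> W" using *(3,5) W0 by (auto simp: W_def)
    show "Ck_on k (\<lambda>y. g (L y)) W" for k
      by (rule Ck_on_compose[OF W *(4) LW Ck_on_bounded_linear[OF bl] *(7)])
    show "(\<lambda>y. g (L y)) ` W \<subseteq> U"
      using LW *(2) homeomorphism_image2[OF *(6)] by blast
    show "\<psi> (g (L y)) = y" if "y \<in> W" "y \<in> \<Sigma>" for y
      using retract[OF that] by auto
    show "g (L (\<psi> u)) = u" if u: "u \<in> U" "\<psi> u \<in> W" for u
    proof -
      obtain u' where "u' \<in> U'" "\<psi> u = \<psi> u'" "g (L (\<psi> u)) = u'"
        using retract[OF u(2)] u(1) local_param_subset by blast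
      moreover from this(1) have "u' \<in> U" using *(2) by blast
      ultimately show ?thesis using inj_onD[OF local_param_inj_on _ u(1), of u'] by simp
    qed
  qed
qed

text \<open>Straight lines in the chart give curves with every velocity in the range. Conversely, a
  curve \<open>\<gamma>\<close> in \<open>\<Sigma>\<close> equals
  \<open>\<psi> \<circ> \<rho> \<circ> \<gamma>\<close> near 0 with \<open>\<rho>\<close>
  differentiable, so the chain rule puts its velocity in the range.\<close>

lemma tangent_space_at_local_param:
  assumes u0: "u0 \<in> U"
  shows "tangent_space_at \<Sigma> (\<psi> u0) = range (frechet_derivative \<psi> (at u0))"
proof (intro equalityI subsetI)
  fix v assume "v \<in> range (frechet_derivative \<psi> (at u0))"
  then obtain c where v: "v = frechet_derivative \<psi> (at u0) c" by blast
  let ?l = "\<lambda>t. u0 + t *\<^sub>R c"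
  have lk: "Ck_on k ?l T" if "open T" for k T
    by (intro Ck_on_add Ck_on_scaleR Ck_on_const Ck_on_ident that)
  have "open (?l -` U)"
    using local_param_open by (intro open_vimage) (auto intro!: continuous_intros)
  moreover have "0 \<in> ?l -` U" using u0 by simp
  ultimately obtain \<delta> where \<delta>: "\<delta> > 0" "ball 0 \<delta> \<subseteq> ?l -` U"
    by (rule openE)
  then have sub: "?l ` {-\<delta><..<\<delta>} \<subseteq> U"
    by (auto simp: ball_def dist_real_def subset_iff)
  have "smooth_on {-\<delta><..<\<delta>} (\<lambda>t. \<psi> (?l t))"
    by (subst smooth_on_open_iff)
      (auto intro!: Ck_on_compose[OF _ local_param_open sub lk local_param_Ck])
  moreover have "((\<lambda>t. \<psi> (?l t)) has_vector_derivative v) (at 0)"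
  proof -
    have "(?l has_derivative (\<lambda>t. t *\<^sub>R c)) (at 0)"
      by (auto intro!: derivative_eq_intros)
    from has_derivative_compose[OF this, of \<psi> "frechet_derivative \<psi> (at u0)"]
    show ?thesis
      using local_param_has_derivative[OF u0] linear_cmul[OF local_param_linear[OF u0]]
      by (simp add: has_vector_derivative_def v)
  qed
  moreover have "(\<lambda>t. \<psi> (?l t)) ` {-\<delta><..<\<delta>} \<subseteq> \<Sigma>"
    using sub local_param_subset by auto
  ultimately show "v \<in> tangent_space_at \<Sigma> (\<psi> u0)"
    using \<delta>(1) unfolding tangent_space_at_def
    by (intro CollectI exI[of _ "\<lambda>t. \<psi> (?l t)"] exI[of _ \<delta>]) auto
next
  fix v assume "v \<in> tangent_space_at \<Sigma> (\<psi> u0)"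
  then obtain \<gamma> \<delta> where \<gamma>: "\<delta> > 0" "\<gamma> ` {-\<delta><..<\<delta>} \<subseteq> \<Sigma>" "\<gamma> 0 = \<psi> u0"
    "(\<gamma> has_vector_derivative v) (at (0::real))"
    by (auto simp: tangent_space_at_def)
  obtain W \<rho> where W: "open W" "\<psi> u0 \<in> W" "\<And>k. Ck_on k \<rho> W" "\<rho> ` W \<subseteq> U"
    "\<And>y. y \<in> W \<Longrightarrow> y \<in> \<Sigma> \<Longrightarrow> \<psi> (\<rho> y) = y" "\<And>u. u \<in> U \<Longrightarrow> \<psi> u \<in> W \<Longrightarrow> \<rho> (\<psi> u) = u"
    by (rule local_param_ambient_inverse[OF u0]) blast
  have d\<gamma>: "(\<gamma> has_derivative (\<lambda>t. t *\<^sub>R v)) (at 0)" using \<gamma>(4) by (simp add: has_vector_derivative_def)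
  have d\<rho>: "(\<rho> has_derivative frechet_derivative \<rho> (at (\<gamma> 0))) (at (\<gamma> 0))"
    using Ck_on_has_derivative[OF W(3,2)] \<gamma>(3) by simp
  have \<rho>0: "\<rho> (\<gamma> 0) = u0" using W(6)[OF u0] W(2) \<gamma>(3) by simp
  then have d\<psi>: "(\<psi> has_derivative frechet_derivative \<psi> (at u0)) (at (\<rho> (\<gamma> 0)))"
    using local_param_has_derivative[OF u0] by simp
  have 1: "((\<lambda>t. \<psi> (\<rho> (\<gamma> t))) has_derivative
      (\<lambda>t. frechet_derivative \<psi> (at u0) (frechet_derivative \<rho> (at (\<gamma> 0)) (t *\<^sub>R v)))) (at 0)"
    using has_derivative_compose[OF has_derivative_compose[OF d\<gamma> d\<rho>] d\<psi>] .
  have "continuous (at 0) \<gamma>" using d\<gamma> has_derivative_continuous by blast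
  then have "eventually (\<lambda>t. \<gamma> t \<in> W) (nhds 0)"
    using W(1,2) \<gamma>(3) by (simp add: continuous_at_open eventually_nhds)
  moreover have "eventually (\<lambda>t. t \<in> {-\<delta><..<\<delta>}) (nhds 0)"
    using \<gamma>(1) by (intro eventually_nhds_in_open) auto
  ultimately have "eventually (\<lambda>t. \<psi> (\<rho> (\<gamma> t)) = \<gamma> t) (nhds 0)"
    by eventually_elim (use \<gamma>(2) W(5) in blast)
  then have ev: "eventually (\<lambda>t. \<psi> (\<rho> (\<gamma> t)) = \<gamma> t) (at 0 within UNIV)" and at0: "\<psi> (\<rho> (\<gamma> 0)) = \<gamma> 0"
    by (auto simp: eventually_nhds_conv_at)
  have "(\<gamma> has_derivative
      (\<lambda>t. frechet_derivative \<psi> (at u0) (frechet_derivative \<rho> (at (\<gamma> 0)) (t *\<^sub>R v)))) (at 0)"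
    using has_derivative_transform_eventually[OF 1 ev] at0 by simp
  from fun_cong[OF has_derivative_unique[OF d\<gamma> this], of 1]
  show "v \<in> range (frechet_derivative \<psi> (at u0))" by auto
qed

lemma subspace_tangent_space_at:
  assumes "u0 \<in> U" shows "subspace (tangent_space_at \<Sigma> (\<psi> u0))"
  unfolding tangent_space_at_local_param[OF assms]
  by (rule linear_subspace_image[OF local_param_linear[OF assms] subspace_UNIV])

end

text \<open>Orthogonal decomposition gives existence; two candidates differ by a vector that is both
  tangent and normal, hence zero. This gives the definite description in \<open>normal_proj\<close>
  its meaning.\<close>

lemma normal_proj_works:
  assumes "subspace (tangent_space_at \<Sigma> x)"
  shows "normal_proj \<Sigma> x v \<in> normal_space_at \<Sigma> x" "v - normal_proj \<Sigma> x v \<in> tangent_space_at \<Sigma> x"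
proof -
  let ?T = "tangent_space_at \<Sigma> x"
  have "\<exists>!w. w \<in> normal_space_at \<Sigma> x \<and> v - w \<in> ?T"
  proof (rule ex_ex1I)
    obtain y z where "y \<in> span ?T" "\<And>w. w \<in> span ?T \<Longrightarrow> orthogonal z w" "v = y + z"
      using orthogonal_subspace_decomp_exists[of ?T v] by metis
    then show "\<exists>w. w \<in> normal_space_at \<Sigma> x \<and> v - w \<in> ?T"
      using assms by (intro exI[of _ z])
        (auto simp: normal_space_at_def orthogonal_comp_def orthogonal_commute span_eq_iff[THEN iffD2, OF assms])
  next
    fix w w' assume w: "w \<in> normal_space_at \<Sigma> x \<and> v - w \<in> ?T" and w': "w' \<in> normal_space_at \<Sigma> x \<and> v - w' \<in> ?T"
    have "(v - w') - (v - w) \<in> ?T" using subspace_diff[OF assms] w w' by blast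
    then have "w - w' \<in> ?T" by simp
    moreover have "w - w' \<in> orthogonal_comp ?T"
      using w w' subspace_orthogonal_comp[of ?T] by (auto simp: normal_space_at_def intro: subspace_diff)
    ultimately have "orthogonal (w - w') (w - w')" by (auto simp: orthogonal_comp_def)
    then show "w = w'" by (simp add: orthogonal_def)
  qed
  from theI'[OF this] show "normal_proj \<Sigma> x v \<in> normal_space_at \<Sigma> x" "v - normal_proj \<Sigma> x v \<in> ?T"
    by (simp_all add: normal_proj_def)
qed

text \<open>The part removed by the projection is tangent. So the projection may be dropped in front
  of a normal vector, both for \<open>T\<close> and in the second fundamental form.\<close>

lemma normal_proj_inner_normal:
  assumes "subspace (tangent_space_at \<Sigma> x)" "\<nu> \<in> normal_space_at \<Sigma> x"
  shows "normal_proj \<Sigma> x v \<bullet> \<nu> = v \<bullet> \<nu>"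
proof -
  have "(v - normal_proj \<Sigma> x v) \<bullet> \<nu> = 0"
    using normal_proj_works(2)[OF assms(1), of v] assms(2)
    unfolding normal_space_at_def orthogonal_comp_def orthogonal_def by blast
  then show ?thesis by (simp add: inner_diff_left)
qed

text \<open>The coordinate field of the chart with constant coefficients \<open>c\<close>, extended
  off \<open>\<Sigma>\<close> through \<open>\<rho>\<close>. It is the witness for the choice in
  \<open>second_fundamental_form\<close>.\<close>

lemma ex_tangent_field_near:
  assumes lp: "local_param \<Sigma> U \<psi>" and u0: "u0 \<in> U" and v: "v \<in> tangent_space_at \<Sigma> (\<psi> u0)"
  shows "\<exists>Y. tangent_field_near \<Sigma> (\<psi> u0) Y \<and> Y (\<psi> u0) = v"
proof -
  obtain c where c: "v = frechet_derivative \<psi> (at u0) c"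
    using v tangent_space_at_local_param[OF lp u0] by auto
  obtain W \<rho> where W: "open W" "\<psi> u0 \<in> W" "\<And>k. Ck_on k \<rho> W" "\<rho> ` W \<subseteq> U"
    "\<And>y. y \<in> W \<Longrightarrow> y \<in> \<Sigma> \<Longrightarrow> \<psi> (\<rho> y) = y" "\<And>u. u \<in> U \<Longrightarrow> \<psi> u \<in> W \<Longrightarrow> \<rho> (\<psi> u) = u"
    by (rule local_param_ambient_inverse[OF lp u0]) blast
  let ?Y = "\<lambda>y. frechet_derivative \<psi> (at (\<rho> y)) c"
  have dk: "Ck_on k (\<lambda>u. frechet_derivative \<psi> (at u) c) U" for k
    using local_param_Ck[OF lp, of "Suc k"] by simp
  have "Ck_on k ?Y W" for k
    by (rule Ck_on_compose[OF W(1) local_param_open[OF lp] W(4,3) dk])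
  then have "smooth_on W ?Y" using W(1) smooth_on_open_iff by blast
  moreover have "?Y y \<in> tangent_space_at \<Sigma> y" if "y \<in> W \<inter> \<Sigma>" for y
    using tangent_space_at_local_param[OF lp, of "\<rho> y"] W(4,5) that by auto
  ultimately have "tangent_field_near \<Sigma> (\<psi> u0) ?Y"
    using W(1,2) unfolding tangent_field_near_def by blast
  moreover have "?Y (\<psi> u0) = v" using c W(6)[OF u0 W(2)] by simp
  ultimately show ?thesis by blast
qed

text \<open>Differentiating the orthogonality of a tangent field and a normal field moves the derivative
  from the tangent field to the normal field.\<close>

lemma second_fundamental_form_inner_normal:
  assumes lp: "local_param \<Sigma> U \<psi>" and u0: "u0 \<in> U" and v: "v \<in> tangent_space_at \<Sigma> (\<psi> u0)"
    and N: "\<And>u. u \<in> U \<Longrightarrow> N u \<in> normal_space_at \<Sigma> (\<psi> u)"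
    and N': "(N has_derivative N') (at u0)"
  shows "second_fundamental_form \<Sigma> (\<psi> u0) (frechet_derivative \<psi> (at u0) c) v \<bullet> N u0 = - (v \<bullet> N' c)"
proof -
  \<comment> \<open>The very extension chosen by the definition; only its smoothness, its tangency
    and its value at the point are used, so the choice does not matter.\<close>
  define Y where "Y = (SOME Y. tangent_field_near \<Sigma> (\<psi> u0) Y \<and> Y (\<psi> u0) = v)"
  have Y: "tangent_field_near \<Sigma> (\<psi> u0) Y" "Y (\<psi> u0) = v"
    using someI_ex[OF ex_tangent_field_near[OF lp u0 v]] unfolding Y_def by auto
  obtain W where W: "open W" "\<psi> u0 \<in> W" "smooth_on W Y" "\<And>y. y \<in> W \<Longrightarrow> y \<in> \<Sigma> \<Longrightarrow> Y y \<in> tangent_space_at \<Sigma> y"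
    using Y(1) unfolding tangent_field_near_def by blast
  let ?D = "frechet_derivative \<psi> (at u0)" and ?DY = "frechet_derivative Y (at (\<psi> u0))"
  have "Ck_on (Suc 0) Y W" using W smooth_on_open_iff by blast
  then have dY: "(Y has_derivative ?DY) (at (\<psi> u0))" using W(2) Ck_on_has_derivative by blast
  have 1: "((\<lambda>u. Y (\<psi> u) \<bullet> N u) has_derivative (\<lambda>h. Y (\<psi> u0) \<bullet> N' h + ?DY (?D h) \<bullet> N u0)) (at u0)"
    using has_derivative_inner[OF has_derivative_compose[OF local_param_has_derivative[OF lp u0] dY] N'] .
  \<comment> \<open>Tangent against normal vanishes identically on a neighbourhood of
    \<open>u0\<close>, so the derivative computed in fact 1 is zero.\<close>
  have 2: "((\<lambda>u. Y (\<psi> u) \<bullet> N u) has_derivative (\<lambda>h. 0)) (at u0)"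
  proof (rule has_derivative_transform_within_open)
    show "open (U \<inter> \<psi> -` W)"
      using W(1) local_param_open[OF lp] Ck_on_imp_continuous_on[OF local_param_Ck[OF lp]]
      by (simp add: continuous_open_preimage)
    show "((\<lambda>u. 0) has_derivative (\<lambda>h. 0)) (at u0)" by simp
    show "0 = Y (\<psi> u) \<bullet> N u" if "u \<in> U \<inter> \<psi> -` W" for u
      using that W(4)[of "\<psi> u"] N[of u] local_param_subset[OF lp]
      by (auto simp: normal_space_at_def orthogonal_comp_def orthogonal_def)
  qed (use u0 W(2) in auto)
  have "Y (\<psi> u0) \<bullet> N' c + ?DY (?D c) \<bullet> N u0 = 0"
    using fun_cong[OF has_derivative_unique[OF 1 2], of c] by simp
  moreover have "second_fundamental_form \<Sigma> (\<psi> u0) (?D c) v \<bullet> N u0 = ?DY (?D c) \<bullet> N u0"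
    unfolding second_fundamental_form_def Let_def Y_def[symmetric]
    by (rule normal_proj_inner_normal[OF subspace_tangent_space_at[OF lp u0] N[OF u0]])
  ultimately show ?thesis using Y(2) by simp
qed

text \<open>The frame is the one chosen by the definition of \<open>mean_curvature\<close>, hence
  the existential form. One such frame is enough, because the derivative of the volume density is
  given by the matching sum in every orthonormal frame.\<close>

lemma mean_curvature_inner_normal:
  fixes U :: "(real^'n::finite) set"
  assumes lp: "local_param \<Sigma> U \<psi>" and u0: "u0 \<in> U"
    and N: "\<And>u. u \<in> U \<Longrightarrow> N u \<in> normal_space_at \<Sigma> (\<psi> u)"
    and N': "(N has_derivative N') (at u0)"
  obtains e c where "\<And>i::'n. frechet_derivative \<psi> (at u0) (c i) = e i"
    "\<And>i j. e i \<bullet> e j = (if i = j then 1 else 0)"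
    "mean_curvature \<Sigma> (\<psi> u0) \<bullet> N u0 = - (\<Sum>i\<in>UNIV. e i \<bullet> N' (c i))"
proof -
  let ?T = "tangent_space_at \<Sigma> (\<psi> u0)"
  define B where "B = (SOME B. orthonormal_basis_of ?T B)"
  have B: "orthonormal_basis_of ?T B"
    using someI_ex[OF ex_orthonormal_basis_of[OF subspace_tangent_space_at[OF lp u0]]] unfolding B_def .
  then have "orthonormal_basis_of (range (frechet_derivative \<psi> (at u0))) B"
    by (simp add: tangent_space_at_local_param[OF lp u0])
  then obtain e c where ec: "bij_betw e (UNIV :: 'n set) B" "\<And>i. frechet_derivative \<psi> (at u0) (c i) = e i"
    "\<And>i j. e i \<bullet> e j = (if i = j then 1 else 0)"
    by (rule orthonormal_frame[OF local_param_linear[OF lp u0] local_param_inj[OF lp u0]]) blast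
  have eT: "e i \<in> ?T" for i
    using tangent_space_at_local_param[OF lp u0] ec(2) by (metis rangeI)
  have "mean_curvature \<Sigma> (\<psi> u0) = (\<Sum>i\<in>UNIV. second_fundamental_form \<Sigma> (\<psi> u0) (e i) (e i))"
    unfolding mean_curvature_def Let_def B_def[symmetric] by (rule sum.reindex_bij_betw[OF ec(1), symmetric])
  then have "mean_curvature \<Sigma> (\<psi> u0) \<bullet> N u0 = (\<Sum>i\<in>UNIV. - (e i \<bullet> N' (c i)))"
    using second_fundamental_form_inner_normal[OF lp u0 eT N N'] by (simp add: inner_sum_left flip: ec(2))
  then have "mean_curvature \<Sigma> (\<psi> u0) \<bullet> N u0 = - (\<Sum>i\<in>UNIV. e i \<bullet> N' (c i))"
    by (simp add: sum_negf)
  then show ?thesis using that ec(2,3) by blast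
qed

section \<open>The induced volume\<close>

lemma borel_vimage_continuous_on:
  fixes f :: "'a::topological_space \<Rightarrow> 'b::topological_space"
  assumes "continuous_on A f" "A \<in> sets borel" "B \<in> sets borel"
  shows "A \<inter> f -` B \<in> sets borel"
proof -
  have "f -` B \<inter> space (restrict_space borel A) \<in> sets (restrict_space borel A)"
    using borel_measurable_continuous_on_restrict[OF assms(1)] assms(3) by (rule measurable_sets)
  then show ?thesis
    using assms(2) by (auto simp: sets_restrict_space_iff space_restrict_space Int_commute)
qed

text \<open>Chain rule and \<open>det_gram_compose\<close>; the square root of the squared
  determinant is the absolute Jacobian.\<close>

lemma volume_density_compose:
  fixes \<psi>1 \<psi>2 :: "real^'n::finite \<Rightarrow> 'a::euclidean_space"
  assumes \<tau>: "(\<tau> has_derivative \<tau>') (at u)" and \<psi>2: "(\<psi>2 has_derivative D) (at (\<tau> u))"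
    and W: "open W" "u \<in> W" "\<And>w. w \<in> W \<Longrightarrow> \<psi>2 (\<tau> w) = \<psi>1 w"
  shows "volume_density \<psi>1 u = \<bar>det (matrix \<tau>')\<bar> * volume_density \<psi>2 (\<tau> u)"
proof -
  have "(\<psi>1 has_derivative (\<lambda>h. D (\<tau>' h))) (at u)"
    by (rule has_derivative_transform_within_open[OF has_derivative_compose[OF \<tau> \<psi>2] W])
  then have "frechet_derivative \<psi>1 (at u) = D \<circ> \<tau>'"
    by (simp add: frechet_derivative_eqI o_def)
  moreover have "frechet_derivative \<psi>2 (at (\<tau> u)) = D"
    using \<psi>2 by (rule frechet_derivative_eqI)
  ultimately show ?thesis
    using det_gram_compose[OF has_derivative_linear[OF \<psi>2], of \<tau>']
    by (simp add: volume_density_eq_gram real_sqrt_mult)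
qed

context
  fixes \<Sigma> :: "'a::euclidean_space set" and U :: "(real^'n::finite) set" and \<psi> :: "real^'n \<Rightarrow> 'a"
  assumes lp: "local_param \<Sigma> U \<psi>"
begin

lemma local_param_continuous_on: "continuous_on U \<psi>"
  using Ck_on_imp_continuous_on[OF local_param_Ck[OF lp]] .

lemma local_param_continuous_on_inverse: "continuous_on (\<psi> ` U) (the_inv_into U \<psi>)"
proof -
  obtain g where g: "homeomorphism U (\<psi> ` U) \<psi> g"
    using lp by (auto simp: local_param_def)
  then have "the_inv_into U \<psi> y = g y" if "y \<in> \<psi> ` U" for y
    using that the_inv_into_f_f[OF local_param_inj_on[OF lp]] by (auto simp: homeomorphism_def)
  then show ?thesis
    using g by (simp add: homeomorphism_def cong: continuous_on_cong)
qed

lemma volume_density_pos: "u \<in> U \<Longrightarrow> volume_density \<psi> u > 0"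
  unfolding volume_density_eq_gram
  using det_gram_pos[OF local_param_linear[OF lp] local_param_inj[OF lp]] by simp

lemma volume_density_continuous_on: "continuous_on U (volume_density \<psi>)"
proof -
  have "Ck_on 0 (\<lambda>u. frechet_derivative \<psi> (at u) v) U" for v
    using local_param_Ck[OF lp, of "Suc 0"] by (simp del: Ck_on.simps(1))
  then have "Ck_on 0 (\<lambda>u. det (\<chi> i j. frechet_derivative \<psi> (at u) (axis i 1) \<bullet> frechet_derivative \<psi> (at u) (axis j 1))) U"
    by (intro Ck_on_det Ck_on_inner local_param_open[OF lp])
  then show ?thesis
    unfolding volume_density_def by (auto intro: continuous_on_real_sqrt)
qed

text \<open>An open set is a countable union of compact boxes, and continuous images of compact sets
  are compact.\<close>

lemma local_param_image_borel: "\<psi> ` U \<in> sets borel"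
proof -
  obtain D where D: "countable D" "D \<subseteq> Pow U" "\<And>X. X \<in> D \<Longrightarrow> \<exists>a b. X = cbox a b" "\<Union>D = U"
    using open_countable_Union_open_cbox[OF local_param_open[OF lp]] by metis
  have "\<psi> ` X \<in> sets borel" if "X \<in> D" for X
  proof -
    have "compact (\<psi> ` X)"
      using D(2,3) that local_param_continuous_on
      by (metis PowD compact_cbox compact_continuous_image continuous_on_subset subsetD)
    then show ?thesis by (intro borel_closed compact_imp_closed)
  qed
  then have "(\<Union>X\<in>D. \<psi> ` X) \<in> sets borel"
    using D(1) by (intro sets.countable_UN') auto
  then show ?thesis using D(4) by (simp add: image_Union[symmetric])
qed

lemma local_param_vimage_borel: "B \<in> sets borel \<Longrightarrow> U \<inter> \<psi> -` B \<in> sets borel"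
  by (rule borel_vimage_continuous_on[OF local_param_continuous_on borel_open[OF local_param_open[OF lp]]])

end

text \<open>Near \<open>\<psi>1 u\<close> the inverse of \<open>\<psi>2\<close> is the restriction
  to \<open>\<Sigma>\<close> of the smooth ambient map \<open>\<rho>\<close>, so the transition map
  is a composite of differentiable maps.\<close>

lemma local_param_transition:
  assumes lp1: "local_param \<Sigma> U1 \<psi>1" and lp2: "local_param \<Sigma> U2 \<psi>2"
    and u: "u \<in> U1" "\<psi>1 u \<in> \<psi>2 ` U2"
  shows "(\<lambda>w. the_inv_into U2 \<psi>2 (\<psi>1 w)) differentiable (at u)"
proof -
  obtain u2 where u2: "u2 \<in> U2" "\<psi>1 u = \<psi>2 u2" using u(2) by auto
  obtain W \<rho> where W: "open W" "\<psi>2 u2 \<in> W" "\<And>k. Ck_on k \<rho> W" "\<rho> ` W \<subseteq> U2"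
    "\<And>y. y \<in> W \<Longrightarrow> y \<in> \<Sigma> \<Longrightarrow> \<psi>2 (\<rho> y) = y" "\<And>u. u \<in> U2 \<Longrightarrow> \<psi>2 u \<in> W \<Longrightarrow> \<rho> (\<psi>2 u) = u"
    by (rule local_param_ambient_inverse[OF lp2 u2(1)]) blast
  have op: "open (U1 \<inter> \<psi>1 -` W)"
    using continuous_open_preimage[OF local_param_continuous_on[OF lp1] local_param_open[OF lp1] W(1)] .
  have eq: "\<rho> (\<psi>1 w) = the_inv_into U2 \<psi>2 (\<psi>1 w)" if "w \<in> U1 \<inter> \<psi>1 -` W" for w
  proof -
    have "\<psi>1 w \<in> \<Sigma>" using that local_param_subset[OF lp1] by auto
    then have "\<psi>2 (\<rho> (\<psi>1 w)) = \<psi>1 w" "\<rho> (\<psi>1 w) \<in> U2" using W(4,5) that by auto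
    then show ?thesis using the_inv_into_f_f[OF local_param_inj_on[OF lp2]] by metis
  qed
  have "(\<rho> has_derivative frechet_derivative \<rho> (at (\<psi>1 u))) (at (\<psi>1 u))"
    using Ck_on_has_derivative[OF W(3,2)] u2(2) by simp
  from has_derivative_compose[OF local_param_has_derivative[OF lp1 u(1)] this]
  have "((\<lambda>w. the_inv_into U2 \<psi>2 (\<psi>1 w)) has_derivative
      (\<lambda>h. frechet_derivative \<rho> (at (\<psi>1 u)) (frechet_derivative \<psi>1 (at u) h))) (at u)"
    by (rule has_derivative_transform_within_open[OF _ op _ eq]) (use u u2 W(2) in auto)
  then show ?thesis by (auto simp: differentiable_def)
qed

text \<open>The factor between the two densities is exactly the Jacobian of the transition map, so
  the mass that a chart assigns to \<open>B\<close> depends on \<open>B\<close> alone. The existence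
  of \<open>induced_volume\<close> rests on this consistency.\<close>

lemma volume_density_integral_transition:
  fixes U1 U2 :: "(real^'n::finite) set"
  assumes lp1: "local_param \<Sigma> U1 \<psi>1" and lp2: "local_param \<Sigma> U2 \<psi>2"
    and B: "B \<in> sets borel" "B \<subseteq> \<psi>1 ` U1" "B \<subseteq> \<psi>2 ` U2"
  shows "(\<integral>\<^sup>+u\<in>U1 \<inter> \<psi>1 -` B. ennreal (volume_density \<psi>1 u) \<partial>lborel) =
    (\<integral>\<^sup>+u\<in>U2 \<inter> \<psi>2 -` B. ennreal (volume_density \<psi>2 u) \<partial>lborel)"
proof -
  let ?\<tau> = "\<lambda>u. the_inv_into U2 \<psi>2 (\<psi>1 u)" and ?\<sigma> = "\<lambda>u. the_inv_into U1 \<psi>1 (\<psi>2 u)"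
  let ?D\<tau> = "\<lambda>u. frechet_derivative ?\<tau> (at u)" and ?D\<sigma> = "\<lambda>u. frechet_derivative ?\<sigma> (at u)"
  let ?S = "U1 \<inter> \<psi>1 -` B" and ?T = "U2 \<inter> \<psi>2 -` B"
  have inv: "the_inv_into U1 \<psi>1 y \<in> U1" "\<psi>1 (the_inv_into U1 \<psi>1 y) = y" if "y \<in> \<psi>1 ` U1" for y
    using that local_param_inj_on[OF lp1] by (auto simp: the_inv_into_f_f)
  have inv2: "the_inv_into U2 \<psi>2 y \<in> U2" "\<psi>2 (the_inv_into U2 \<psi>2 y) = y" if "y \<in> \<psi>2 ` U2" for y
    using that local_param_inj_on[OF lp2] by (auto simp: the_inv_into_f_f)
  have inv_app: "the_inv_into U1 \<psi>1 (\<psi>1 u) = u" if "u \<in> U1" for u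
    using the_inv_into_f_f[OF local_param_inj_on[OF lp1] that] .
  have inv2_app: "the_inv_into U2 \<psi>2 (\<psi>2 u) = u" if "u \<in> U2" for u
    using the_inv_into_f_f[OF local_param_inj_on[OF lp2] that] .
  have d\<tau>: "(?\<tau> has_derivative ?D\<tau> u) (at u)" if "u \<in> U1" "\<psi>1 u \<in> \<psi>2 ` U2" for u
    using local_param_transition[OF lp1 lp2 that] by (simp add: frechet_derivative_works)
  have d\<sigma>: "(?\<sigma> has_derivative ?D\<sigma> u) (at u)" if "u \<in> U2" "\<psi>2 u \<in> \<psi>1 ` U1" for u
    using local_param_transition[OF lp2 lp1 that] by (simp add: frechet_derivative_works)
  \<comment> \<open>\<open>B\<close> is merely Borel, so the maps are compared on the open overlap
    of the chart domains, which contains the preimage of \<open>B\<close>.\<close>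
  have open_pre: "open (V1 \<inter> \<eta>1 -` (\<eta>2 ` V2))" if lp: "local_param \<Sigma> V1 \<eta>1" and lp': "local_param \<Sigma> V2 \<eta>2"
    for V1 V2 :: "(real^'n) set" and \<eta>1 \<eta>2
  proof -
    obtain O' where O': "open O'" "\<eta>2 ` V2 = \<Sigma> \<inter> O'"
      using local_param_openin[OF lp'] by (auto simp: openin_open)
    then have "V1 \<inter> \<eta>1 -` (\<eta>2 ` V2) = V1 \<inter> \<eta>1 -` O'" using local_param_subset[OF lp] by auto
    then show ?thesis
      using continuous_open_preimage[OF local_param_continuous_on[OF lp] local_param_open[OF lp] O'(1)] by simp
  qed
  have vd: "volume_density \<psi>1 u = \<bar>det (matrix (?D\<tau> u))\<bar> * volume_density \<psi>2 (?\<tau> u)" if "u \<in> ?S" for u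
  proof (rule volume_density_compose[OF d\<tau> local_param_has_derivative[OF lp2] open_pre[OF lp1 lp2]])
    show "\<psi>2 (?\<tau> w) = \<psi>1 w" if "w \<in> U1 \<inter> \<psi>1 -` (\<psi>2 ` U2)" for w
      using that inv2 by auto
  qed (use that B inv2 in auto)
  have "(\<integral>\<^sup>+u\<in>?S. ennreal (volume_density \<psi>1 u) \<partial>lborel) =
      (\<integral>\<^sup>+u\<in>?S. ennreal (\<bar>det (matrix (?D\<tau> u))\<bar> * volume_density \<psi>2 (?\<tau> u)) \<partial>lborel)"
    by (intro nn_integral_cong) (auto simp: indicator_def vd)
  also have "\<dots> = (\<integral>\<^sup>+u\<in>?T. ennreal (volume_density \<psi>2 u) \<partial>lborel)"
  proof (rule nn_integral_change_of_variables[where h = ?\<sigma> and h' = ?D\<sigma>])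
    show "(?\<tau> has_derivative ?D\<tau> x) (at x within ?S)" if "x \<in> ?S" for x
      using that B by (intro has_derivative_at_withinI[OF d\<tau>]) auto
    show "(?\<sigma> has_derivative ?D\<sigma> x) (at x within ?T)" if "x \<in> ?T" for x
      using that B by (intro has_derivative_at_withinI[OF d\<sigma>]) auto
    show "0 \<le> volume_density \<psi>2 y" if "y \<in> ?T" for y
      using volume_density_pos[OF lp2, of y] that by simp
    show "?\<tau> x \<in> ?T \<and> ?\<sigma> (?\<tau> x) = x" if "x \<in> ?S" for x
    proof -
      have "\<psi>1 x \<in> \<psi>2 ` U2" using that B by auto
      from inv2[OF this] show ?thesis using that inv_app by auto
    qed
    show \<sigma>T: "?\<sigma> y \<in> ?S \<and> ?\<tau> (?\<sigma> y) = y" if "y \<in> ?T" for y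
    proof -
      have "\<psi>2 y \<in> \<psi>1 ` U1" using that B by auto
      from inv[OF this] show ?thesis using that inv2_app by auto
    qed
    show "?D\<sigma> y \<circ> ?D\<tau> (?\<sigma> y) = id" if "y \<in> ?T" for y
    proof -
      let ?x = "?\<sigma> y"
      have x: "?x \<in> U1" "\<psi>1 ?x \<in> \<psi>2 ` U2" "?\<tau> ?x = y"
        using \<sigma>T[OF that] B by auto
      have dy: "(?\<sigma> has_derivative ?D\<sigma> y) (at (?\<tau> ?x))"
        using d\<sigma>[of y] that B x(3) by auto
      have "((\<lambda>w. ?\<sigma> (?\<tau> w)) has_derivative (\<lambda>h. ?D\<sigma> y (?D\<tau> ?x h))) (at ?x)"
        using has_derivative_compose[OF d\<tau>[OF x(1,2)] dy] .
      moreover have "((\<lambda>w. ?\<sigma> (?\<tau> w)) has_derivative (\<lambda>h. h)) (at ?x)"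
      proof (rule has_derivative_transform_within_open[OF has_derivative_ident open_pre[OF lp1 lp2]])
        show "w = ?\<sigma> (?\<tau> w)" if "w \<in> U1 \<inter> \<psi>1 -` (\<psi>2 ` U2)" for w
          using that inv2(2)[of "\<psi>1 w"] inv_app[of w] by simp
      qed (use x in auto)
      ultimately have "(\<lambda>h. ?D\<sigma> y (?D\<tau> ?x h)) = (\<lambda>h. h)"
        by (rule has_derivative_unique)
      then show ?thesis by (simp add: fun_eq_iff)
    qed
    have ind: "(\<lambda>x. indicator (V \<inter> \<eta> -` B) x * volume_density \<eta> x) \<in> borel_measurable borel"
      if lp: "local_param \<Sigma> V \<eta>" for V :: "(real^'n) set" and \<eta>
      using borel_measurable_continuous_on_indicator[OF local_param_vimage_borel[OF lp B(1)]
          continuous_on_subset[OF volume_density_continuous_on[OF lp]]] by simp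
    \<comment> \<open>Measurability is obtained without examining the Jacobian: on \<open>?S\<close>
      the product is the density of \<open>\<psi>1\<close>, which is continuous.\<close>
    have "(\<lambda>x. indicator ?S x * (\<bar>det (matrix (?D\<tau> x))\<bar> * volume_density \<psi>2 (?\<tau> x))) =
        (\<lambda>x. indicator ?S x * volume_density \<psi>1 x)"
      by (auto simp: fun_eq_iff indicator_def vd)
    then show "(\<lambda>x. indicator ?S x * (\<bar>det (matrix (?D\<tau> x))\<bar> * volume_density \<psi>2 (?\<tau> x))) \<in> borel_measurable borel"
      using ind[OF lp1] by simp
    show "(\<lambda>x. indicator ?T x * volume_density \<psi>2 x) \<in> borel_measurable borel"
      by (rule ind[OF lp2])
  qed
  finally show ?thesis .
qed

text \<open>A measure on the Borel sets of the whole ambient space, so that the measures of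
  different charts can be compared and summed. The value 0 off \<open>U\<close> only makes the map
  total; the density vanishes there, so it puts no mass at 0.\<close>

definition chart_measure :: "(real^'n::finite) set \<Rightarrow> (real^'n \<Rightarrow> 'a::euclidean_space) \<Rightarrow> 'a measure" where
  "chart_measure U \<psi> = distr (density lborel (\<lambda>u. ennreal (indicator U u * volume_density \<psi> u))) borel
     (\<lambda>u. if u \<in> U then \<psi> u else 0)"

lemma sets_chart_measure [simp]: "sets (chart_measure U \<psi>) = sets borel"
  by (simp add: chart_measure_def)

lemma space_chart_measure [simp]: "space (chart_measure U \<psi>) = UNIV"
  by (simp add: chart_measure_def)

lemma nn_integral_chart_measure:
  assumes lp: "local_param \<Sigma> U \<psi>" and f: "f \<in> borel_measurable borel"
  shows "(\<integral>\<^sup>+x. f x \<partial>chart_measure U \<psi>) = (\<integral>\<^sup>+u\<in>U. ennreal (volume_density \<psi> u) * f (\<psi> u) \<partial>lborel)"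
proof -
  have U: "U \<in> sets borel" using local_param_open[OF lp] by simp
  have m1: "(\<lambda>u. indicator U u * volume_density \<psi> u) \<in> borel_measurable borel"
    using borel_measurable_continuous_on_indicator[OF U volume_density_continuous_on[OF lp]] by simp
  have m2: "(\<lambda>u. if u \<in> U then \<psi> u else 0) \<in> borel_measurable borel"
    using U local_param_continuous_on[OF lp] by (intro borel_measurable_continuous_on_if) auto
  have "(\<integral>\<^sup>+x. f x \<partial>chart_measure U \<psi>) =
      (\<integral>\<^sup>+u. ennreal (indicator U u * volume_density \<psi> u) * f (if u \<in> U then \<psi> u else 0) \<partial>lborel)"
    unfolding chart_measure_def using m1 m2 f
    by (subst nn_integral_distr, simp, simp, subst nn_integral_density) simp_all
  also have "\<dots> = (\<integral>\<^sup>+u\<in>U. ennreal (volume_density \<psi> u) * f (\<psi> u) \<partial>lborel)"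
    by (intro nn_integral_cong) (auto simp: indicator_def)
  finally show ?thesis .
qed

lemma emeasure_chart_measure:
  assumes lp: "local_param \<Sigma> U \<psi>" and B: "B \<in> sets borel"
  shows "emeasure (chart_measure U \<psi>) B = (\<integral>\<^sup>+u\<in>U \<inter> \<psi> -` B. ennreal (volume_density \<psi> u) \<partial>lborel)"
proof -
  have "emeasure (chart_measure U \<psi>) B = (\<integral>\<^sup>+x. indicator B x \<partial>chart_measure U \<psi>)"
    using B by simp
  also have "\<dots> = (\<integral>\<^sup>+u\<in>U. ennreal (volume_density \<psi> u) * indicator B (\<psi> u) \<partial>lborel)"
    using B by (intro nn_integral_chart_measure[OF lp]) simp
  also have "\<dots> = (\<integral>\<^sup>+u\<in>U \<inter> \<psi> -` B. ennreal (volume_density \<psi> u) \<partial>lborel)"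
    by (intro nn_integral_cong) (auto simp: indicator_def)
  finally show ?thesis .
qed

text \<open>Serves the degenerate cases: an empty family of charts, and the empty piece at the start
  of the induction over a finite cover.\<close>

lemma local_param_empty: "local_param \<Sigma> {} \<psi>"
  by (auto simp: local_param_def smooth_on_def homeomorphism_def)

text \<open>The chart images are relatively open, so the Lindelof property leaves countably many of
  them that still cover \<open>\<Sigma>\<close>.\<close>

lemma submanifold_countable_charts:
  assumes "submanifold TYPE('n::finite) \<Sigma>"
  obtains U :: "nat \<Rightarrow> (real^'n) set" and \<psi> where
    "\<And>i. local_param \<Sigma> (U i) (\<psi> i)" "(\<Union>i. \<psi> i ` U i) = \<Sigma>"
proof -
  define F where "F = {\<psi> ` U | (U :: (real^'n) set) \<psi>. local_param \<Sigma> U \<psi>}"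
  have "\<And>S. S \<in> F \<Longrightarrow> openin (top_of_set \<Sigma>) S"
    by (auto simp: F_def intro: local_param_openin)
  then obtain F' where F': "F' \<subseteq> F" "countable F'" "\<Union>F' = \<Union>F" by (rule Lindelof_openin)
  have UF: "\<Union>F = \<Sigma>"
  proof
    show "\<Union>F \<subseteq> \<Sigma>" unfolding F_def using local_param_subset by blast
    show "\<Sigma> \<subseteq> \<Union>F"
    proof
      fix x assume x: "x \<in> \<Sigma>"
      obtain U :: "(real^'n) set" and \<psi> where U: "local_param \<Sigma> U \<psi>" "x \<in> \<psi> ` U"
        using bspec[OF assms[unfolded submanifold_def] x] by auto
      have "\<psi> ` U \<in> F"
        unfolding F_def by (intro CollectI exI[of _ U] exI[of _ \<psi>] conjI refl U(1))
      then show "x \<in> \<Union>F" using U(2) by (rule UnionI)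
    qed
  qed
  \<comment> \<open>Adding the empty image makes the family nonempty even for empty
    \<open>\<Sigma>\<close>, as the enumeration by \<open>from_nat_into\<close> requires.\<close>
  define G where "G = insert {} F'"
  have "{} \<in> F"
    unfolding F_def by (intro CollectI exI[of _ "{}"] exI[of _ "\<lambda>_. 0"]) (simp add: local_param_empty)
  then have G: "countable G" "G \<noteq> {}" "G \<subseteq> F" "\<Union>G = \<Sigma>"
    using F' UF by (auto simp: G_def)
  have "\<forall>i. \<exists>(U :: (real^'n) set) \<psi>. local_param \<Sigma> U \<psi> \<and> from_nat_into G i = \<psi> ` U"
  proof (intro allI)
    fix i
    have "from_nat_into G i \<in> F" using from_nat_into[OF G(2)] G(3) by blast
    then show "\<exists>(U :: (real^'n) set) \<psi>. local_param \<Sigma> U \<psi> \<and> from_nat_into G i = \<psi> ` U"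
      unfolding F_def by auto
  qed
  then obtain U :: "nat \<Rightarrow> (real^'n) set" and \<psi> where
    *: "\<And>i. local_param \<Sigma> (U i) (\<psi> i)" "\<And>i. from_nat_into G i = \<psi> i ` U i" by metis
  have "(\<Union>i. \<psi> i ` U i) = \<Union>(range (from_nat_into G))" by (simp add: *(2))
  also have "\<dots> = \<Sigma>" using range_from_nat_into[OF G(2,1)] G(4) by simp
  finally show ?thesis using * that by blast
qed

lemma submanifold_borel:
  assumes "submanifold TYPE('n::finite) \<Sigma>" shows "\<Sigma> \<in> sets borel"
proof -
  obtain U :: "nat \<Rightarrow> (real^'n) set" and \<psi> where
    *: "\<And>i. local_param \<Sigma> (U i) (\<psi> i)" "(\<Union>i. \<psi> i ` U i) = \<Sigma>"
    using submanifold_countable_charts[OF assms] by blast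
  have "(\<Union>i. \<psi> i ` U i) \<in> sets borel"
    using local_param_image_borel[OF *(1)] by (intro sets.countable_UN) auto
  then show ?thesis using *(2) by simp
qed

text \<open>Countably many chart images, made disjoint, cut \<open>B\<close> into Borel pieces that
  each lie in one chart, and both measures are sums over these pieces. This gives uniqueness of the
  induced volume and its comparison with the one of a relatively open subset.\<close>

lemma emeasure_eq_if_eq_on_charts:
  assumes \<Omega>: "submanifold TYPE('n::finite) \<Omega>" and B: "B \<in> sets borel" "B \<subseteq> \<Omega>"
    and sets: "\<And>C. C \<in> sets borel \<Longrightarrow> C \<subseteq> \<Omega> \<Longrightarrow> C \<in> sets \<mu> \<and> C \<in> sets \<nu>"
    and eq: "\<And>(U :: (real^'n) set) \<psi> C. local_param \<Omega> U \<psi> \<Longrightarrow> C \<in> sets borel \<Longrightarrow> C \<subseteq> \<psi> ` U \<Longrightarrow>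
      emeasure \<mu> C = emeasure \<nu> C"
  shows "emeasure \<mu> B = emeasure \<nu> B"
proof -
  obtain U :: "nat \<Rightarrow> (real^'n) set" and \<psi> where
    *: "\<And>i. local_param \<Omega> (U i) (\<psi> i)" "(\<Union>i. \<psi> i ` U i) = \<Omega>"
    using submanifold_countable_charts[OF \<Omega>] by blast
  define D where "D = disjointed (\<lambda>i. \<psi> i ` U i)"
  have "range D \<subseteq> sets borel"
    unfolding D_def using local_param_image_borel[OF *(1)] by (intro sets.range_disjointed_sets) auto
  then have D: "D i \<in> sets borel" "D i \<subseteq> \<psi> i ` U i" "D i \<subseteq> \<Omega>" for i
    using disjointed_subset[of "\<lambda>i. \<psi> i ` U i" i] *(2) by (auto simp: D_def)
  have UD: "(\<Union>i. B \<inter> D i) = B"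
    using UN_disjointed_eq[of "\<lambda>i. \<psi> i ` U i"] *(2) B(2) by (auto simp: D_def)
  have disj: "disjoint_family (\<lambda>i. B \<inter> D i)"
    using disjoint_family_disjointed[of "\<lambda>i. \<psi> i ` U i"] by (auto simp: D_def disjoint_family_on_def)
  have s: "range (\<lambda>i. B \<inter> D i) \<subseteq> sets \<mu>" "range (\<lambda>i. B \<inter> D i) \<subseteq> sets \<nu>"
    using sets B D by auto
  have "emeasure \<mu> B = (\<Sum>i. emeasure \<mu> (B \<inter> D i))"
    using suminf_emeasure[OF s(1) disj] UD by simp
  also have "\<dots> = (\<Sum>i. emeasure \<nu> (B \<inter> D i))"
  proof (intro suminf_cong)
    show "emeasure \<mu> (B \<inter> D i) = emeasure \<nu> (B \<inter> D i)" for i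
      by (rule eq[OF *(1)[of i]]) (use B D[of i] in auto)
  qed
  also have "\<dots> = emeasure \<nu> B"
    using suminf_emeasure[OF s(2) disj] UD by simp
  finally show ?thesis .
qed

lemma suminf_swap_ennreal: "(\<Sum>i. \<Sum>n. f n i) = (\<Sum>n. \<Sum>i. f n i)" for f :: "nat \<Rightarrow> nat \<Rightarrow> ennreal"
proof -
  have "(\<Sum>i. \<Sum>n. f n i) = (\<integral>\<^sup>+i. (\<Sum>n. f n i) \<partial>count_space UNIV)"
    by (rule nn_integral_count_space_nat[symmetric])
  also have "\<dots> = (\<Sum>n. \<integral>\<^sup>+i. f n i \<partial>count_space UNIV)"
    by (rule nn_integral_suminf) simp
  finally show ?thesis by (simp add: nn_integral_count_space_nat)
qed

text \<open>The chart measures are added up over disjoint pieces \<open>D i\<close>, one chart per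
  piece. For a set inside any other chart, \<open>volume_density_integral_transition\<close> turns
  every summand into the measure of that chart, and the pieces recombine.\<close>

lemma ex_induced_volume:
  assumes \<Sigma>: "submanifold TYPE('n::finite) \<Sigma>"
  shows "\<exists>\<mu>. sets \<mu> = sets (restrict_space borel \<Sigma>) \<and>
     (\<forall>(U :: (real^'n) set) \<psi> B. local_param \<Sigma> U \<psi> \<and> B \<in> sets borel \<and> B \<subseteq> \<psi> ` U \<longrightarrow>
        emeasure \<mu> B = (\<integral>\<^sup>+u\<in>U \<inter> \<psi> -` B. ennreal (volume_density \<psi> u) \<partial>lborel))"
proof -
  obtain U :: "nat \<Rightarrow> (real^'n) set" and \<psi> where
    *: "\<And>i. local_param \<Sigma> (U i) (\<psi> i)" "(\<Union>i. \<psi> i ` U i) = \<Sigma>"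
    using submanifold_countable_charts[OF \<Sigma>] by blast
  define D where "D = disjointed (\<lambda>i. \<psi> i ` U i)"
  have "range D \<subseteq> sets borel"
    unfolding D_def using local_param_image_borel[OF *(1)] by (intro sets.range_disjointed_sets) auto
  then have D: "D i \<in> sets borel" "D i \<subseteq> \<psi> i ` U i" for i
    using disjointed_subset[of "\<lambda>i. \<psi> i ` U i" i] by (auto simp: D_def)
  have UD: "(\<Union>i. D i) = \<Sigma>"
    using UN_disjointed_eq[of "\<lambda>i. \<psi> i ` U i"] *(2) by (simp add: D_def)
  have disj: "disjoint_family D"
    using disjoint_family_disjointed by (simp add: D_def)
  define m where "m B = (\<Sum>i. emeasure (chart_measure (U i) (\<psi> i)) (B \<inter> D i))" for B
  define N where "N = measure_of UNIV (sets borel) m"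
  have sN: "sets N = sets borel"
    using sets.sigma_sets_eq[of borel] by (simp add: N_def)
  have ca: "countably_additive (sets N) m"
    unfolding countably_additive_def
  proof (intro allI impI)
    fix A :: "nat \<Rightarrow> 'a set" assume A: "range A \<subseteq> sets N" "disjoint_family A"
    have "(\<Sum>n. emeasure (chart_measure (U i) (\<psi> i)) (A n \<inter> D i)) =
        emeasure (chart_measure (U i) (\<psi> i)) (\<Union>n. A n \<inter> D i)" for i
    proof (rule suminf_emeasure)
      show "range (\<lambda>n. A n \<inter> D i) \<subseteq> sets (chart_measure (U i) (\<psi> i))" using A D(1)[of i] sN by auto
      show "disjoint_family (\<lambda>n. A n \<inter> D i)" using A(2) unfolding disjoint_family_on_def by blast
    qed
    then have "m (\<Union> (range A)) = (\<Sum>i. \<Sum>n. emeasure (chart_measure (U i) (\<psi> i)) (A n \<inter> D i))"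
      by (simp add: m_def)
    also have "\<dots> = (\<Sum>n. m (A n))"
      unfolding m_def by (rule suminf_swap_ennreal)
    finally show "(\<Sum>n. m (A n)) = m (\<Union> (range A))" by simp
  qed
  have eN: "emeasure N B = m B" if "B \<in> sets borel" for B
    using emeasure_measure_of[OF N_def _ _ ca] that sN by (auto simp: positive_def m_def)
  let ?\<mu> = "restrict_space N \<Sigma>"
  have sb: "\<Sigma> \<in> sets borel" using submanifold_borel[OF \<Sigma>] .
  have "emeasure ?\<mu> B = (\<integral>\<^sup>+u\<in>V \<inter> \<eta> -` B. ennreal (volume_density \<eta> u) \<partial>lborel)"
    if lp: "local_param \<Sigma> V \<eta>" and B: "B \<in> sets borel" "B \<subseteq> \<eta> ` V" for V :: "(real^'n) set" and \<eta> B
  proof -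
    have BS: "B \<subseteq> \<Sigma>" using B local_param_subset[OF lp] by auto
    have "emeasure ?\<mu> B = m B"
      using eN[OF B(1)] BS sb sN by (subst emeasure_restrict_space) auto
    also have "\<dots> = (\<Sum>i. emeasure (chart_measure V \<eta>) (B \<inter> D i))"
      unfolding m_def
    proof (intro suminf_cong)
      fix i
      have "B \<inter> D i \<in> sets borel" using B D by auto
      then show "emeasure (chart_measure (U i) (\<psi> i)) (B \<inter> D i) = emeasure (chart_measure V \<eta>) (B \<inter> D i)"
        unfolding emeasure_chart_measure[OF *(1) \<open>B \<inter> D i \<in> sets borel\<close>]
          emeasure_chart_measure[OF lp \<open>B \<inter> D i \<in> sets borel\<close>]
        using B D(2)[of i] by (intro volume_density_integral_transition[OF *(1) lp]) auto
    qed
    also have "\<dots> = emeasure (chart_measure V \<eta>) (\<Union>i. B \<inter> D i)"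
    proof (rule suminf_emeasure)
      show "range (\<lambda>i. B \<inter> D i) \<subseteq> sets (chart_measure V \<eta>)" using B D(1) by auto
      show "disjoint_family (\<lambda>i. B \<inter> D i)" using disj unfolding disjoint_family_on_def by blast
    qed
    also have "(\<Union>i. B \<inter> D i) = B" using UD BS by auto
    also have "emeasure (chart_measure V \<eta>) B = (\<integral>\<^sup>+u\<in>V \<inter> \<eta> -` B. ennreal (volume_density \<eta> u) \<partial>lborel)"
      by (rule emeasure_chart_measure[OF lp B(1)])
    finally show ?thesis .
  qed
  moreover have "sets ?\<mu> = sets (restrict_space borel \<Sigma>)"
    by (rule sets_restrict_space_cong[OF sN])
  ultimately show ?thesis by blast
qed

text \<open>Existence by gluing and uniqueness by \<open>emeasure_eq_if_eq_on_charts\<close> give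
  the definite description its meaning. Everything later about \<open>induced_volume\<close> goes
  through these two properties.\<close>

lemma induced_volume_works:
  assumes \<Sigma>: "submanifold TYPE('n::finite) \<Sigma>"
  shows "sets (induced_volume TYPE('n) \<Sigma>) = sets (restrict_space borel \<Sigma>)"
    and "\<And>(U :: (real^'n) set) \<psi> B. local_param \<Sigma> U \<psi> \<Longrightarrow> B \<in> sets borel \<Longrightarrow> B \<subseteq> \<psi> ` U \<Longrightarrow>
      emeasure (induced_volume TYPE('n) \<Sigma>) B = (\<integral>\<^sup>+u\<in>U \<inter> \<psi> -` B. ennreal (volume_density \<psi> u) \<partial>lborel)"
proof -
  let ?P = "\<lambda>\<mu>. sets \<mu> = sets (restrict_space borel \<Sigma>) \<and>
     (\<forall>(U :: (real^'n) set) \<psi> B. local_param \<Sigma> U \<psi> \<and> B \<in> sets borel \<and> B \<subseteq> \<psi> ` U \<longrightarrow>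
        emeasure \<mu> B = (\<integral>\<^sup>+u\<in>U \<inter> \<psi> -` B. ennreal (volume_density \<psi> u) \<partial>lborel))"
  have sb: "\<Sigma> \<in> sets borel" using submanifold_borel[OF \<Sigma>] .
  have "\<exists>!\<mu>. ?P \<mu>"
  proof (rule ex_ex1I)
    show "\<exists>\<mu>. ?P \<mu>" by (rule ex_induced_volume[OF \<Sigma>])
    fix \<mu> \<nu> assume \<mu>: "?P \<mu>" and \<nu>: "?P \<nu>"
    show "\<mu> = \<nu>"
    proof (rule measure_eqI)
      show "sets \<mu> = sets \<nu>" using \<mu> \<nu> by simp
      fix B assume "B \<in> sets \<mu>"
      then have B: "B \<in> sets borel" "B \<subseteq> \<Sigma>" using \<mu> sb by (auto simp: sets_restrict_space_iff)
      show "emeasure \<mu> B = emeasure \<nu> B"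
      proof (rule emeasure_eq_if_eq_on_charts[OF \<Sigma> B])
        show "C \<in> sets \<mu> \<and> C \<in> sets \<nu>" if "C \<in> sets borel" "C \<subseteq> \<Sigma>" for C
          using that \<mu> \<nu> sb by (auto simp: sets_restrict_space_iff)
        show "emeasure \<mu> C = emeasure \<nu> C"
          if "local_param \<Sigma> U \<psi>" "C \<in> sets borel" "C \<subseteq> \<psi> ` U" for U :: "(real^'n) set" and \<psi> C
          using \<mu> \<nu> that by metis
      qed
    qed
  qed
  from theI'[OF this] have "?P (induced_volume TYPE('n) \<Sigma>)"
    unfolding induced_volume_def .
  then show "sets (induced_volume TYPE('n) \<Sigma>) = sets (restrict_space borel \<Sigma>)"
    "\<And>(U :: (real^'n) set) \<psi> B. local_param \<Sigma> U \<psi> \<Longrightarrow> B \<in> sets borel \<Longrightarrow> B \<subseteq> \<psi> ` U \<Longrightarrow>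
      emeasure (induced_volume TYPE('n) \<Sigma>) B = (\<integral>\<^sup>+u\<in>U \<inter> \<psi> -` B. ennreal (volume_density \<psi> u) \<partial>lborel)"
    by blast+
qed

lemma space_induced_volume:
  assumes "submanifold TYPE('n::finite) \<Sigma>"
  shows "space (induced_volume TYPE('n) \<Sigma>) = \<Sigma>"
  using sets_eq_imp_space_eq[OF induced_volume_works(1)[OF assms]] by (simp add: space_restrict_space)

lemma sets_induced_volume_iff:
  assumes "submanifold TYPE('n::finite) \<Sigma>"
  shows "B \<in> sets (induced_volume TYPE('n) \<Sigma>) \<longleftrightarrow> B \<in> sets borel \<and> B \<subseteq> \<Sigma>"
  using induced_volume_works(1)[OF assms] submanifold_borel[OF assms] by (auto simp: sets_restrict_space_iff)

text \<open>\<open>induced_volume\<close> lives on a submanifold and \<open>chart_measure\<close> on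
  the whole space. Restricted to a common set they become equal as measures, so that integrals carry
  over.\<close>

lemma restrict_space_eq_if_emeasure_eq_on:
  assumes A: "A \<in> sets \<mu>" "A \<in> sets \<nu>"
    and sets: "\<And>C. C \<subseteq> A \<Longrightarrow> C \<in> sets \<mu> \<longleftrightarrow> C \<in> sets borel" "\<And>C. C \<subseteq> A \<Longrightarrow> C \<in> sets \<nu> \<longleftrightarrow> C \<in> sets borel"
    and eq: "\<And>C. C \<in> sets borel \<Longrightarrow> C \<subseteq> A \<Longrightarrow> emeasure \<mu> C = emeasure \<nu> C"
  shows "restrict_space \<mu> A = restrict_space \<nu> A"
proof (rule measure_eqI)
  have A': "A \<inter> space \<mu> \<in> sets \<mu>" "A \<inter> space \<nu> \<in> sets \<nu>" using A by auto
  show "sets (restrict_space \<mu> A) = sets (restrict_space \<nu> A)"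
    using A' sets by (auto simp: sets_restrict_space_iff)
  fix C assume "C \<in> sets (restrict_space \<mu> A)"
  then have "C \<subseteq> A" "C \<in> sets borel" using A' sets(1) by (auto simp: sets_restrict_space_iff)
  then show "emeasure (restrict_space \<mu> A) C = emeasure (restrict_space \<nu> A) C"
    using A' eq by (simp add: emeasure_restrict_space)
qed

lemma nn_integral_eq_if_restrict_space_eq:
  assumes "A \<in> sets \<mu>" "A \<in> sets \<nu>" "restrict_space \<mu> A = restrict_space \<nu> A"
  shows "(\<integral>\<^sup>+x\<in>A. f x \<partial>\<mu>) = (\<integral>\<^sup>+x\<in>A. f x \<partial>\<nu>)"
  using nn_integral_restrict_space[of A \<mu> f] nn_integral_restrict_space[of A \<nu> f] assms by simp

lemma restrict_space_induced_volume_chart: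
  fixes U :: "(real^'n::finite) set"
  assumes \<Sigma>: "submanifold TYPE('n) \<Sigma>" and lp: "local_param \<Sigma> U \<psi>"
    and B: "B \<in> sets borel" "B \<subseteq> \<psi> ` U"
  shows "restrict_space (induced_volume TYPE('n) \<Sigma>) B = restrict_space (chart_measure U \<psi>) B"
proof -
  have BS: "B \<subseteq> \<Sigma>" using B local_param_subset[OF lp] by auto
  show ?thesis
    using B BS induced_volume_works(2)[OF \<Sigma> lp] emeasure_chart_measure[OF lp]
    by (intro restrict_space_eq_if_emeasure_eq_on) (auto simp: sets_induced_volume_iff[OF \<Sigma>])
qed

lemma nn_integral_induced_volume_chart:
  fixes U :: "(real^'n::finite) set"
  assumes \<Sigma>: "submanifold TYPE('n) \<Sigma>" and lp: "local_param \<Sigma> U \<psi>"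
    and B: "B \<in> sets borel" "B \<subseteq> \<psi> ` U" and f: "f \<in> borel_measurable borel"
  shows "(\<integral>\<^sup>+x\<in>B. f x \<partial>induced_volume TYPE('n) \<Sigma>) =
    (\<integral>\<^sup>+u\<in>U \<inter> \<psi> -` B. ennreal (volume_density \<psi> u) * f (\<psi> u) \<partial>lborel)"
proof -
  have BS: "B \<subseteq> \<Sigma>" using B local_param_subset[OF lp] by auto
  have "(\<integral>\<^sup>+x\<in>B. f x \<partial>induced_volume TYPE('n) \<Sigma>) = (\<integral>\<^sup>+x\<in>B. f x \<partial>chart_measure U \<psi>)"
    using B BS restrict_space_induced_volume_chart[OF \<Sigma> lp B]
    by (intro nn_integral_eq_if_restrict_space_eq) (auto simp: sets_induced_volume_iff[OF \<Sigma>])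
  also have "\<dots> = (\<integral>\<^sup>+u\<in>U. ennreal (volume_density \<psi> u) * (f (\<psi> u) * indicator B (\<psi> u)) \<partial>lborel)"
    using B f by (intro nn_integral_chart_measure[OF lp]) auto
  also have "\<dots> = (\<integral>\<^sup>+u\<in>U \<inter> \<psi> -` B. ennreal (volume_density \<psi> u) * f (\<psi> u) \<partial>lborel)"
    by (intro nn_integral_cong) (auto simp: indicator_def)
  finally show ?thesis .
qed

section \<open>Relatively open parts of a submanifold\<close>

lemma local_param_subset_domain:
  assumes lp: "local_param \<Sigma> U \<psi>" and V: "open V" "V \<subseteq> U"
  shows "local_param \<Sigma> V \<psi>"
proof -
  obtain g where g: "homeomorphism U (\<psi> ` U) \<psi> g" using lp by (auto simp: local_param_def)
  have "homeomorphism V (\<psi> ` V) \<psi> g"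
    by (rule homeomorphism_of_subsets[OF g V(2) subset_refl refl])
  moreover have "smooth_on V \<psi>"
    using Ck_on_subset[OF local_param_Ck[OF lp] V(2)] by (simp add: smooth_on_open_iff[OF V(1)])
  ultimately show ?thesis
    using V lp local_param_open_map[OF lp V] unfolding local_param_def by blast
qed

lemma submanifold_openin:
  assumes \<Sigma>: "submanifold TYPE('n::finite) \<Sigma>" and \<Omega>: "openin (top_of_set \<Sigma>) \<Omega>"
  shows "submanifold TYPE('n) \<Omega>"
  unfolding submanifold_def
proof
  fix x assume x: "x \<in> \<Omega>"
  then have "x \<in> \<Sigma>" using openin_imp_subset[OF \<Omega>] by auto
  from bspec[OF \<Sigma>[unfolded submanifold_def] this]
  obtain U :: "(real^'n) set" and \<psi> where lp: "local_param \<Sigma> U \<psi>" "x \<in> \<psi> ` U"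
    by auto
  obtain W where W: "open W" "\<Omega> = \<Sigma> \<inter> W" using \<Omega> by (auto simp: openin_open)
  let ?V = "U \<inter> \<psi> -` W"
  have V: "open ?V" "?V \<subseteq> U"
    using continuous_open_preimage[OF local_param_continuous_on[OF lp(1)] local_param_open[OF lp(1)] W(1)] by auto
  note lpV = local_param_subset_domain[OF lp(1) V]
  have "openin (top_of_set \<Omega>) (\<psi> ` ?V)"
  proof (rule openin_subset_trans[OF local_param_openin[OF lpV] _ openin_imp_subset[OF \<Omega>]])
    show "\<psi> ` ?V \<subseteq> \<Omega>" using W local_param_subset[OF lp(1)] by auto
  qed
  then have "local_param \<Omega> ?V \<psi>" using lpV unfolding local_param_def by blast
  moreover have "x \<in> \<psi> ` ?V" using lp(2) x W by auto
  ultimately show "\<exists>(U :: (real^'n) set) \<psi>. local_param \<Omega> U \<psi> \<and> x \<in> \<psi> ` U" by blast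
qed

text \<open>Charts of \<open>\<Omega>\<close> are charts of \<open>\<Sigma>\<close>, so the two
  measures agree on Borel subsets of \<open>\<Omega>\<close>. Applied to the complement of the
  support inside \<open>\<Sigma>\<close> and inside the varied submanifold, this shows that the
  volume there does not change.\<close>

lemma nn_integral_induced_volume_openin:
  assumes \<Sigma>: "submanifold TYPE('n::finite) \<Sigma>" and \<Omega>: "openin (top_of_set \<Sigma>) \<Omega>"
    and B: "B \<in> sets borel" "B \<subseteq> \<Omega>"
  shows "(\<integral>\<^sup>+x\<in>B. f x \<partial>induced_volume TYPE('n) \<Sigma>) = (\<integral>\<^sup>+x\<in>B. f x \<partial>induced_volume TYPE('n) \<Omega>)"
proof -
  have sub: "\<Omega> \<subseteq> \<Sigma>" using openin_imp_subset[OF \<Omega>] .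
  note \<Omega>' = submanifold_openin[OF \<Sigma> \<Omega>]
  have "emeasure (induced_volume TYPE('n) \<Sigma>) C = emeasure (induced_volume TYPE('n) \<Omega>) C"
    if C: "C \<in> sets borel" "C \<subseteq> \<Omega>" for C
  proof (rule emeasure_eq_if_eq_on_charts[OF \<Omega>' C])
    show "A \<in> sets (induced_volume TYPE('n) \<Sigma>) \<and> A \<in> sets (induced_volume TYPE('n) \<Omega>)"
      if "A \<in> sets borel" "A \<subseteq> \<Omega>" for A
      using that sub by (auto simp: sets_induced_volume_iff[OF \<Sigma>] sets_induced_volume_iff[OF \<Omega>'])
    fix U :: "(real^'n) set" and \<psi> A
    assume lp: "local_param \<Omega> U \<psi>" and A: "A \<in> sets borel" "A \<subseteq> \<psi> ` U"
    then have "local_param \<Sigma> U \<psi>"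
      using openin_trans[OF _ \<Omega>] unfolding local_param_def by blast
    then show "emeasure (induced_volume TYPE('n) \<Sigma>) A = emeasure (induced_volume TYPE('n) \<Omega>) A"
      using induced_volume_works(2)[OF \<Sigma> _ A] induced_volume_works(2)[OF \<Omega>' lp A] by simp
  qed
  then show ?thesis
    using B sub
    by (intro nn_integral_eq_if_restrict_space_eq restrict_space_eq_if_emeasure_eq_on)
      (auto simp: sets_induced_volume_iff[OF \<Sigma>] sets_induced_volume_iff[OF \<Omega>'])
qed

section \<open>Variations in charts\<close>

lemma variation_support_subset: "variation_support \<Sigma> \<epsilon> \<phi> \<subseteq> \<Sigma>"
  by (simp add: variation_support_def)

lemma variation_fixes_outside_support:
  assumes "x \<in> \<Sigma>" "x \<notin> variation_support \<Sigma> \<epsilon> \<phi>" "s \<in> {-\<epsilon><..<\<epsilon>}"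
  shows "\<phi> s x = x"
  using assms closure_subset[of "{x\<in>\<Sigma>. \<exists>s\<in>{-\<epsilon><..<\<epsilon>}. \<phi> s x \<noteq> x}"]
  unfolding variation_support_def by blast

context
  fixes \<Sigma> :: "'a::euclidean_space set" and \<epsilon> :: real and \<phi> :: "real \<Rightarrow> 'a \<Rightarrow> 'a"
  assumes var: "variation \<Sigma> \<epsilon> \<phi>"
begin

lemma variation_continuous_on:
  assumes "s \<in> {-\<epsilon><..<\<epsilon>}" shows "continuous_on \<Sigma> (\<phi> s)"
proof -
  have "continuous_on ({-\<epsilon><..<\<epsilon>} \<times> \<Sigma>) (\<lambda>(s, x). \<phi> s x)"
    using var smooth_on_imp_continuous_on by (auto simp: variation_def)
  moreover have "continuous_on \<Sigma> (\<lambda>x. (s, x))" by (intro continuous_intros)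
  moreover have "(\<lambda>x. (s, x)) ` \<Sigma> \<subseteq> {-\<epsilon><..<\<epsilon>} \<times> \<Sigma>" using assms by auto
  ultimately show ?thesis using continuous_on_compose2 by fastforce
qed

text \<open>The smooth left inverse is continuous, and on the image it is a two-sided
  inverse.\<close>

lemma variation_homeomorphism:
  assumes "s \<in> {-\<epsilon><..<\<epsilon>}"
  obtains g where "smooth_on (\<phi> s ` \<Sigma>) g" "homeomorphism \<Sigma> (\<phi> s ` \<Sigma>) (\<phi> s) g"
proof -
  obtain g where g: "smooth_on (\<phi> s ` \<Sigma>) g" "\<And>x. x \<in> \<Sigma> \<Longrightarrow> g (\<phi> s x) = x"
    using var assms unfolding variation_def by metis
  have "homeomorphism \<Sigma> (\<phi> s ` \<Sigma>) (\<phi> s) g"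
    using g variation_continuous_on[OF assms] smooth_on_imp_continuous_on[OF g(1)]
    by (auto simp: homeomorphism_def image_iff)
  then show ?thesis using g that by blast
qed

lemma variation_inj_on: "s \<in> {-\<epsilon><..<\<epsilon>} \<Longrightarrow> inj_on (\<phi> s) \<Sigma>"
  by (rule variation_homeomorphism) (auto simp: homeomorphism_def intro: inj_on_inverseI)

lemma variation_openin:
  assumes "s \<in> {-\<epsilon><..<\<epsilon>}" "openin (top_of_set \<Sigma>) \<Omega>"
  shows "openin (top_of_set (\<phi> s ` \<Sigma>)) (\<phi> s ` \<Omega>)"
  using variation_homeomorphism[OF assms(1)] homeomorphism_imp_open_map[OF _ assms(2)] by metis

text \<open>The image of \<open>B\<close> is the preimage of \<open>B\<close> under the continuous
  inverse, inside the Borel image of \<open>\<Sigma>\<close>.\<close>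

lemma variation_image_borel:
  assumes s: "s \<in> {-\<epsilon><..<\<epsilon>}" and "\<phi> s ` \<Sigma> \<in> sets borel" "B \<in> sets borel" "B \<subseteq> \<Sigma>"
  shows "\<phi> s ` B \<in> sets borel"
proof -
  obtain g where g: "homeomorphism \<Sigma> (\<phi> s ` \<Sigma>) (\<phi> s) g" using variation_homeomorphism[OF s] by blast
  then have "\<phi> s ` B = \<phi> s ` \<Sigma> \<inter> g -` B"
    using assms(4) by (auto simp: homeomorphism_def)
  then show ?thesis
    using borel_vimage_continuous_on[of "\<phi> s ` \<Sigma>" g B] g assms by (simp add: homeomorphism_def)
qed

text \<open>The smoothness of \<open>\<phi>\<close> is given through local extensions off
  \<open>\<Sigma>\<close>. Composing these with the chart yields a smooth map on an open subset of a
  Euclidean space, where derivatives in \<open>s\<close> and \<open>u\<close> can be taken and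
  interchanged.\<close>

lemma variation_chart_Ck:
  assumes lp: "local_param \<Sigma> U \<psi>"
  shows "Ck_on k (\<lambda>p. \<phi> (fst p) (\<psi> (snd p))) ({-\<epsilon><..<\<epsilon>} \<times> U)"
proof (rule Ck_on_locally)
  fix p :: "real \<times> _" assume p: "p \<in> {-\<epsilon><..<\<epsilon>} \<times> U"
  let ?I = "{-\<epsilon><..<\<epsilon>} \<times> U" and ?q = "\<lambda>p. (fst p, \<psi> (snd p))"
  have I: "open ?I" using local_param_open[OF lp] by (simp add: open_Times)
  have "?q p \<in> {-\<epsilon><..<\<epsilon>} \<times> \<Sigma>" using p local_param_subset[OF lp] by auto
  then obtain W g where W: "open W" "?q p \<in> W" "\<And>k. Ck_on k g W"
    "\<And>y. y \<in> {-\<epsilon><..<\<epsilon>} \<times> \<Sigma> \<Longrightarrow> y \<in> W \<Longrightarrow> (\<lambda>(s, x). \<phi> s x) y = g y"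
    using var unfolding variation_def smooth_on_def by (metis IntI)
  have snd: "Ck_on k (\<lambda>p. \<psi> (snd p)) ?I" for k
    by (rule Ck_on_compose[OF I local_param_open[OF lp] _ Ck_on_bounded_linear[OF bounded_linear_snd] local_param_Ck[OF lp]]) auto
  have q: "Ck_on k ?q ?I" for k
    by (rule Ck_on_Pair[OF I Ck_on_bounded_linear[OF bounded_linear_fst] snd])
  let ?O = "?I \<inter> ?q -` W"
  have O: "open ?O"
    using continuous_open_preimage[OF Ck_on_imp_continuous_on[OF q] I W(1)] .
  have "Ck_on k (\<lambda>p. g (?q p)) ?O"
    by (rule Ck_on_compose[OF O W(1) _ Ck_on_subset[OF q] W(3)]) auto
  then have "Ck_on k (\<lambda>p. \<phi> (fst p) (\<psi> (snd p))) ?O"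
  proof (rule Ck_on_cong[OF O, rotated])
    show "g (?q p) = \<phi> (fst p) (\<psi> (snd p))" if "p \<in> ?O" for p
      using W(4)[of "?q p"] that local_param_subset[OF lp] by auto
  qed
  then show "\<exists>W. open W \<and> p \<in> W \<and> Ck_on k (\<lambda>p. \<phi> (fst p) (\<psi> (snd p))) W"
    using O p W(2) by blast
qed

lemma variation_slice_derivative:
  assumes lp: "local_param \<Sigma> U \<psi>" and s: "s \<in> {-\<epsilon><..<\<epsilon>}" and u: "u \<in> U"
  shows "((\<lambda>u. \<phi> s (\<psi> u)) has_derivative
    (\<lambda>c. frechet_derivative (\<lambda>p. \<phi> (fst p) (\<psi> (snd p))) (at (s, u)) (0, c))) (at u)"
proof -
  have "((\<lambda>u. (s, u)) has_derivative (\<lambda>c. (0, c))) (at u)"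
    by (auto intro!: derivative_eq_intros)
  from has_derivative_compose[OF this Ck_on_has_derivative[OF variation_chart_Ck[OF lp]]]
  show ?thesis using s u by simp
qed

text \<open>A local smooth extension \<open>h\<close> of the left inverse satisfies
  \<open>h \<circ> \<phi> s \<circ> \<psi> = \<psi>\<close>, so by the chain rule the derivative of
  \<open>\<phi> s \<circ> \<psi>\<close> is injective. The topological conditions carry over along
  the homeomorphism \<open>\<phi> s\<close>.\<close>

lemma variation_local_param:
  assumes lp: "local_param \<Sigma> U \<psi>" and s: "s \<in> {-\<epsilon><..<\<epsilon>}"
  shows "local_param (\<phi> s ` \<Sigma>) U (\<lambda>u. \<phi> s (\<psi> u))"
proof -
  let ?\<Psi> = "\<lambda>u. \<phi> s (\<psi> u)"
  obtain g where g: "smooth_on (\<phi> s ` \<Sigma>) g" "homeomorphism \<Sigma> (\<phi> s ` \<Sigma>) (\<phi> s) g"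
    using variation_homeomorphism[OF s] by blast
  have inv: "g (\<phi> s x) = x" if "x \<in> \<Sigma>" for x using g(2) that by (simp add: homeomorphism_def)
  have U: "open U" using local_param_open[OF lp] .
  have k: "Ck_on k ?\<Psi> U" for k
  proof -
    have *: "Ck_on k (\<lambda>u. (s, u)) U"
      by (rule Ck_on_Pair[OF U Ck_on_const Ck_on_ident])
    have "open ({-\<epsilon><..<\<epsilon>} \<times> U)" using U by (simp add: open_Times)
    moreover have "(\<lambda>u. (s, u)) ` U \<subseteq> {-\<epsilon><..<\<epsilon>} \<times> U" using s by auto
    ultimately show ?thesis using Ck_on_compose[OF U _ _ * variation_chart_Ck[OF lp]] by simp
  qed
  have "inj (frechet_derivative ?\<Psi> (at u))" if u: "u \<in> U" for u
  proof -
    have "?\<Psi> u \<in> \<phi> s ` \<Sigma>" using u local_param_subset[OF lp] by auto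
    then obtain W h where W: "open W" "?\<Psi> u \<in> W" "\<And>k. Ck_on k h W" "\<And>y. y \<in> \<phi> s ` \<Sigma> \<Longrightarrow> y \<in> W \<Longrightarrow> g y = h y"
      using g(1) unfolding smooth_on_def by (metis IntI)
    have dh: "(h has_derivative frechet_derivative h (at (?\<Psi> u))) (at (?\<Psi> u))"
      using Ck_on_has_derivative[OF W(3,2)] .
    have "((\<lambda>w. h (?\<Psi> w)) has_derivative (\<lambda>c. frechet_derivative h (at (?\<Psi> u)) (frechet_derivative ?\<Psi> (at u) c))) (at u)"
      using has_derivative_compose[OF Ck_on_has_derivative[OF k u] dh] .
    then have "(\<psi> has_derivative (\<lambda>c. frechet_derivative h (at (?\<Psi> u)) (frechet_derivative ?\<Psi> (at u) c))) (at u)"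
    proof (rule has_derivative_transform_within_open)
      show "open (U \<inter> ?\<Psi> -` W)"
        using continuous_open_preimage[OF Ck_on_imp_continuous_on[OF k] U W(1)] .
      show "h (?\<Psi> w) = \<psi> w" if "w \<in> U \<inter> ?\<Psi> -` W" for w
      proof -
        have "\<psi> w \<in> \<Sigma>" using that local_param_subset[OF lp] by auto
        then show ?thesis using W(4)[of "?\<Psi> w"] that inv by auto
      qed
    qed (use u W(2) in auto)
    then have "frechet_derivative \<psi> (at u) = (\<lambda>c. frechet_derivative h (at (?\<Psi> u)) (frechet_derivative ?\<Psi> (at u) c))"
      by (rule frechet_derivative_eqI)
    then have "inj (\<lambda>c. frechet_derivative h (at (?\<Psi> u)) (frechet_derivative ?\<Psi> (at u) c))"
      using local_param_inj[OF lp u] by simp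
    then show ?thesis by (auto simp: inj_on_def)
  qed
  moreover have "openin (top_of_set (\<phi> s ` \<Sigma>)) (?\<Psi> ` U)"
    using variation_openin[OF s local_param_openin[OF lp]] by (simp add: image_image)
  moreover have "\<exists>h. homeomorphism U (?\<Psi> ` U) ?\<Psi> h"
  proof -
    obtain r where r: "homeomorphism U (\<psi> ` U) \<psi> r" using lp by (auto simp: local_param_def)
    have "homeomorphism (\<psi> ` U) (\<phi> s ` \<psi> ` U) (\<phi> s) g"
      by (rule homeomorphism_of_subsets[OF g(2) local_param_subset[OF lp] subset_refl refl])
    from homeomorphism_compose[OF r this] show ?thesis
      by (auto simp: o_def image_image)
  qed
  moreover have "smooth_on U ?\<Psi>" using k U smooth_on_open_iff by blast
  ultimately show ?thesis using U unfolding local_param_def by blast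
qed

lemma variation_submanifold:
  assumes \<Sigma>: "submanifold TYPE('n::finite) \<Sigma>" and s: "s \<in> {-\<epsilon><..<\<epsilon>}"
  shows "submanifold TYPE('n) (\<phi> s ` \<Sigma>)"
  unfolding submanifold_def
proof
  fix y assume "y \<in> \<phi> s ` \<Sigma>"
  then obtain x where x: "x \<in> \<Sigma>" "y = \<phi> s x" by auto
  from bspec[OF \<Sigma>[unfolded submanifold_def] x(1)]
  obtain U :: "(real^'n) set" and \<psi> where lp: "local_param \<Sigma> U \<psi>" "x \<in> \<psi> ` U" by auto
  have "y \<in> (\<lambda>u. \<phi> s (\<psi> u)) ` U" using lp(2) x(2) by auto
  then show "\<exists>(U :: (real^'n) set) \<psi>. local_param (\<phi> s ` \<Sigma>) U \<psi> \<and> y \<in> \<psi> ` U"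
    using variation_local_param[OF lp(1) s] by blast
qed

end

section \<open>First derivatives of determinants\<close>

lemma has_real_derivative_prod:
  fixes f :: "'i \<Rightarrow> real \<Rightarrow> real"
  assumes "\<And>i. i \<in> I \<Longrightarrow> (f i has_real_derivative f' i) (at x)"
  shows "((\<lambda>x. \<Prod>i\<in>I. f i x) has_real_derivative (\<Sum>i\<in>I. f' i * (\<Prod>j\<in>I - {i}. f j x))) (at x)"
proof -
  have "((\<lambda>x. \<Prod>i\<in>I. f i x) has_derivative (\<lambda>y. \<Sum>i\<in>I. (f' i * y) * (\<Prod>j\<in>I - {i}. f j x))) (at x)"
    using assms unfolding has_field_derivative_def by (rule has_derivative_prod)
  then show ?thesis
    by (rule has_derivative_imp_has_field_derivative) (simp add: sum_distrib_left sum_distrib_right mult_ac)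
qed

text \<open>A permutation other than the identity moves at least two indices, so its Leibniz term
  has at least two vanishing factors and derivative zero. The identity contributes the
  trace.\<close>

lemma det_has_derivative_at_identity:
  fixes M :: "real \<Rightarrow> 'n::finite \<Rightarrow> 'n \<Rightarrow> real"
  assumes der: "\<And>i j. ((\<lambda>s. M s i j) has_real_derivative M' i j) (at s)"
    and one: "\<And>i j. M s i j = (if i = j then 1 else 0)"
  shows "((\<lambda>s. det (\<chi> i j. M s i j)) has_real_derivative (\<Sum>i\<in>UNIV. M' i i)) (at s)"
proof -
  let ?P = "{p. p permutes (UNIV :: 'n set)}"
  let ?D = "\<lambda>p :: 'n \<Rightarrow> 'n. \<Sum>i\<in>UNIV. M' i (p i) * (\<Prod>j\<in>UNIV - {i}. M s j (p j))"
  have "((\<lambda>s. \<Sum>p\<in>?P. of_int (sign p) * (\<Prod>i\<in>UNIV. M s i (p i))) has_real_derivative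
      (\<Sum>p\<in>?P. of_int (sign p) * ?D p)) (at s)"
    by (intro DERIV_sum DERIV_cmult has_real_derivative_prod der)
  moreover have "(\<Sum>p\<in>?P. of_int (sign p) * ?D p) = (\<Sum>p\<in>?P. if p = id then \<Sum>i\<in>UNIV. M' i i else 0)"
  proof (intro sum.cong refl)
    fix p assume p: "p \<in> ?P"
    show "of_int (sign p) * ?D p = (if p = id then \<Sum>i\<in>UNIV. M' i i else 0)"
    proof (cases "p = id")
      case True
      then show ?thesis by (simp add: one)
    next
      case False
      have "(\<Prod>j\<in>UNIV - {i}. M s j (p j)) = 0" for i
      proof -
        obtain a where a: "p a \<noteq> a" using False by (auto simp: fun_eq_iff)
        have "\<exists>j. j \<noteq> i \<and> p j \<noteq> j"
        proof (cases "a = i")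
          case True
          \<comment> \<open>If the moved index is the one whose factor is differentiated, its image
            is another moved index, by injectivity.\<close>
          have "p (p a) \<noteq> p a" using a p permutes_inj[of p UNIV] by (auto dest: injD)
          then show ?thesis using a True by (intro exI[of _ "p a"]) auto
        qed (use a in auto)
        then obtain j where "j \<noteq> i" "p j \<noteq> j" by blast
        then have "M s j (p j) = 0" by (simp add: one)
        then show ?thesis using \<open>j \<noteq> i\<close> by (intro prod_zero) auto
      qed
      then have "?D p = 0" by (intro sum.neutral ballI) (simp only: mult_zero_right)
      then show ?thesis using False by simp
    qed
  qed
  moreover have "(\<Sum>p\<in>?P. if p = id then \<Sum>i\<in>UNIV. M' i i else 0) = (\<Sum>i\<in>UNIV. M' i i)"
    by (subst sum.delta) (auto simp: permutes_id finite_permutations)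
  ultimately show ?thesis by (simp add: det_def)
qed

text \<open>In a frame that is orthonormal for the undeformed metric the Gram matrix starts at the
  identity, so only the trace of its derivative enters.\<close>

lemma sqrt_det_gram_derivative:
  fixes L :: "real \<Rightarrow> real^'n::finite \<Rightarrow> 'a::euclidean_space"
  assumes lin: "\<And>s. s \<in> {-\<epsilon><..<\<epsilon>} \<Longrightarrow> linear (L s)" and \<epsilon>: "\<epsilon> > 0"
    and der: "\<And>i. ((\<lambda>s. L s (c i)) has_vector_derivative d i) (at 0)"
    and e: "\<And>i. L 0 (c i) = e i" "\<And>i j :: 'n. e i \<bullet> e j = (if i = j then 1 else 0)"
  shows "((\<lambda>s. sqrt (det (gram (L s)))) has_real_derivative sqrt (det (gram (L 0))) * (\<Sum>i\<in>UNIV. e i \<bullet> d i)) (at 0)"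
proof -
  \<comment> \<open>The determinant of the change from the coordinate axes to the frame
    \<open>c\<close>; it does not depend on \<open>s\<close> and drops out as a constant
    factor.\<close>
  let ?C = "det (matrix (\<lambda>x :: real^'n. \<Sum>k\<in>UNIV. x $ k *\<^sub>R c k))"
  let ?M = "\<lambda>s i j. L s (c i) \<bullet> L s (c j)"
  have M: "det (\<chi> i j. ?M s i j) = ?C\<^sup>2 * det (gram (L s))" if "s \<in> {-\<epsilon><..<\<epsilon>}" for s
    using det_gram_frame[OF lin[OF that]] .
  have "(\<chi> i j. ?M 0 i j) = (mat 1 :: real^'n^'n)" by (simp add: e mat_def)
  then have one: "det (\<chi> i j. ?M 0 i j) = 1" by simp
  have C: "?C \<noteq> 0" using M[of 0] one \<epsilon> by auto
  have "((\<lambda>s. ?M s i j) has_real_derivative (e i \<bullet> d j + d i \<bullet> e j)) (at 0)" for i j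
    using has_derivative_inner[OF der[of i, unfolded has_vector_derivative_def] der[of j, unfolded has_vector_derivative_def]]
    by (rule has_derivative_imp_has_field_derivative) (simp add: e algebra_simps)
  then have "((\<lambda>s. det (\<chi> i j. ?M s i j)) has_real_derivative (\<Sum>i\<in>UNIV. e i \<bullet> d i + d i \<bullet> e i)) (at 0)"
    by (rule det_has_derivative_at_identity) (simp add: e)
  then have "((\<lambda>s. sqrt (det (\<chi> i j. ?M s i j))) has_real_derivative
      (\<Sum>i\<in>UNIV. e i \<bullet> d i + d i \<bullet> e i) * (inverse (sqrt (det (\<chi> i j. ?M 0 i j))) / 2)) (at 0)"
    using DERIV_chain2[OF DERIV_real_sqrt, of "\<lambda>s. det (\<chi> i j. ?M s i j)" 0] one
    by (simp add: mult.commute)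
  \<comment> \<open>The two equal terms of the product rule cancel the 1/2 of the square
    root.\<close>
  moreover have "(\<Sum>i\<in>UNIV. e i \<bullet> d i + d i \<bullet> e i) * (inverse (sqrt (det (\<chi> i j. ?M 0 i j))) / 2) = (\<Sum>i\<in>UNIV. e i \<bullet> d i)"
    using one by (simp add: inner_commute flip: sum_distrib_left)
  ultimately have "((\<lambda>s. sqrt (det (\<chi> i j. ?M s i j))) has_real_derivative (\<Sum>i\<in>UNIV. e i \<bullet> d i)) (at 0)"
    by simp
  from DERIV_cmult[OF this, of "inverse \<bar>?C\<bar>"]
  have *: "((\<lambda>s. inverse \<bar>?C\<bar> * sqrt (det (\<chi> i j. ?M s i j))) has_real_derivative inverse \<bar>?C\<bar> * (\<Sum>i\<in>UNIV. e i \<bullet> d i)) (at 0)" .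
  have eq: "inverse \<bar>?C\<bar> * sqrt (det (\<chi> i j. ?M s i j)) = sqrt (det (gram (L s)))" if "s \<in> {-\<epsilon><..<\<epsilon>}" for s
    using C unfolding M[OF that] by (simp add: real_sqrt_mult)
  have "sqrt (det (gram (L 0))) = inverse \<bar>?C\<bar>"
    using eq[of 0] one \<epsilon> by simp
  moreover have "((\<lambda>s. sqrt (det (gram (L s)))) has_real_derivative inverse \<bar>?C\<bar> * (\<Sum>i\<in>UNIV. e i \<bullet> d i)) (at 0)"
    by (rule has_field_derivative_transform_within_open[OF * open_greaterThanLessThan[of "-\<epsilon>" \<epsilon>] _ eq]) (use \<epsilon> in auto)
  ultimately show ?thesis by simp
qed

section \<open>Differentiation of the weighted volume in a chart\<close>

lemma Ck_on_real_derivative: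
  fixes f :: "real \<Rightarrow> real"
  assumes "open U" "\<And>x. x \<in> U \<Longrightarrow> (f has_real_derivative f' x) (at x)" "continuous_on U f'"
  shows "Ck_on (Suc 0) f U"
proof (rule Ck_on_SucI[OF assms(1), where D = "\<lambda>x h. f' x * h"])
  show "(f has_derivative (\<lambda>h. f' x * h)) (at x)" if "x \<in> U" for x
    using assms(2)[OF that] by (simp add: has_field_derivative_def)
  show "Ck_on 0 (\<lambda>x. f' x * v) U" for v
    using continuous_on_mult_right[OF assms(3)] by simp
qed

lemma Ck_on_frechet_derivative: "Ck_on (Suc k) f U \<Longrightarrow> Ck_on k (\<lambda>x. frechet_derivative f (at x) v) U"
  by simp

lemma Ck_on_exp: "Ck_on (Suc 0) (exp :: real \<Rightarrow> real) UNIV"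
  by (rule Ck_on_real_derivative[where f' = exp]) (auto intro!: DERIV_exp continuous_intros)

lemma Ck_on_sqrt: "Ck_on (Suc 0) sqrt {0<..}"
  by (rule Ck_on_real_derivative[where f' = "\<lambda>x. inverse (sqrt x) / 2"])
    (auto intro!: DERIV_real_sqrt continuous_intros)

text \<open>The partial derivative in the first variable as a directional derivative, the form that
  \<open>Ck_on\<close> controls.\<close>

lemma Ck_on_curve_derivative:
  fixes F :: "real \<times> 'b::euclidean_space \<Rightarrow> 'c::real_normed_vector"
  assumes "Ck_on (Suc k) F W" "(s, u) \<in> W"
  shows "((\<lambda>s. F (s, u)) has_vector_derivative frechet_derivative F (at (s, u)) (1, 0)) (at s)"
proof -
  have F: "(F has_derivative frechet_derivative F (at (s, u))) (at (s, u))"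
    using Ck_on_has_derivative[OF assms] .
  have "((\<lambda>s. (s, u)) has_derivative (\<lambda>t. (t, 0))) (at s)"
    by (auto intro!: derivative_eq_intros)
  from has_derivative_compose[OF this F]
  have "((\<lambda>s. F (s, u)) has_derivative (\<lambda>t. frechet_derivative F (at (s, u)) (t, 0))) (at s)" .
  moreover have "(\<lambda>t. frechet_derivative F (at (s, u)) (t, 0)) = (\<lambda>t. t *\<^sub>R frechet_derivative F (at (s, u)) (1, 0))"
  proof
    fix t :: real
    have "t *\<^sub>R (1, 0) = (t, 0::'b)" by simp
    with linear_cmul[OF has_derivative_linear[OF F], of t "(1, 0)"]
    show "frechet_derivative F (at (s, u)) (t, 0) = t *\<^sub>R frechet_derivative F (at (s, u)) (1, 0)"
      by (simp only:)
  qed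
  ultimately show ?thesis unfolding has_vector_derivative_def by (simp only:)
qed

lemma compact_set_integrable:
  fixes f :: "'b::euclidean_space \<Rightarrow> real"
  assumes "compact C" "continuous_on C f" "A \<in> sets borel" "A \<subseteq> C"
  shows "set_integrable lborel A f"
proof -
  have "set_integrable lborel C f"
    unfolding set_integrable_def using assms(1,2) by (rule borel_integrable_compact)
  from set_integrable_subset[OF this] show ?thesis using assms(3,4) by simp
qed

text \<open>Dominated convergence: on a compact product the \<open>s\<close>-derivative is bounded,
  and by the mean value inequality the same bound holds for all difference quotients.\<close>

lemma has_real_derivative_set_integral:
  fixes F :: "real \<times> 'b::euclidean_space \<Rightarrow> real"
  assumes \<epsilon>: "\<epsilon> > 0" and F: "Ck_on (Suc 0) F ({-\<epsilon><..<\<epsilon>} \<times> U)"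
    and C: "compact C" "C \<subseteq> U" and A: "A \<in> sets borel" "A \<subseteq> C"
  shows "((\<lambda>s. LINT u:A|lborel. F (s, u)) has_real_derivative
    (LINT u:A|lborel. frechet_derivative F (at (0, u)) (1, 0))) (at 0)"
proof -
  let ?D = "\<lambda>p. frechet_derivative F (at p) (1, 0)"
  \<comment> \<open>Half of the radius, so that a closed and therefore compact interval around 0
    fits inside the open one.\<close>
  define \<delta> where "\<delta> = \<epsilon> / 2"
  have \<delta>: "0 < \<delta>" "\<delta> < \<epsilon>" using \<epsilon> by (auto simp: \<delta>_def)
  have contF: "continuous_on ({-\<epsilon><..<\<epsilon>} \<times> U) F" and contD: "continuous_on ({-\<epsilon><..<\<epsilon>} \<times> U) ?D"
    using Ck_on_imp_continuous_on[OF F] F by simp_all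
  have "compact ({-\<delta>..\<delta>} \<times> C)" using C by (intro compact_Times) auto
  moreover have sub: "{-\<delta>..\<delta>} \<times> C \<subseteq> {-\<epsilon><..<\<epsilon>} \<times> U" using \<delta> C(2) by auto
  ultimately have "bounded (?D ` ({-\<delta>..\<delta>} \<times> C))"
    by (intro compact_imp_bounded compact_continuous_image continuous_on_subset[OF contD])
  then obtain B where B: "\<And>p. p \<in> {-\<delta>..\<delta>} \<times> C \<Longrightarrow> \<bar>?D p\<bar> \<le> B"
    by (auto simp: bounded_iff)
  have slice: "continuous_on C (\<lambda>u. F (s, u))" if "s \<in> {-\<epsilon><..<\<epsilon>}" for s
    using that C(2) by (intro continuous_on_compose2[OF contF]) (auto intro!: continuous_intros)
  have sliceD: "continuous_on C (\<lambda>u. ?D (0, u))"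
    using \<epsilon> C(2) by (intro continuous_on_compose2[OF contD]) (auto intro!: continuous_intros)
  have der: "((\<lambda>s. F (s, u)) has_real_derivative ?D (s, u)) (at s)" if "s \<in> {-\<epsilon><..<\<epsilon>}" "u \<in> U" for s u
    using Ck_on_curve_derivative[OF F, of s u] that by (simp add: has_real_derivative_iff_has_vector_derivative)
  have int: "set_integrable lborel A (\<lambda>u. F (s, u))" if "s \<in> {-\<epsilon><..<\<epsilon>}" for s
    by (rule compact_set_integrable[OF C(1) slice[OF that] A])
  let ?q = "\<lambda>s u. indicator A u *\<^sub>R ((F (s, u) - F (0, u)) / s)"
  \<comment> \<open>The limit is tested along sequences, for which dominated convergence is
    stated.\<close>
  have "((\<lambda>s. ((LINT u:A|lborel. F (s, u)) - (LINT u:A|lborel. F (0, u))) / (s - 0)) \<longlongrightarrow>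
      (LINT u:A|lborel. ?D (0, u))) (at 0 within {-\<delta><..<\<delta>})"
    unfolding tendsto_at_iff_sequentially
  proof (intro allI impI)
    fix X :: "nat \<Rightarrow> real" assume X: "\<forall>i. X i \<in> {-\<delta><..<\<delta>} - {0}" "X \<longlonglongrightarrow> 0"
    have X': "X i \<in> {-\<epsilon><..<\<epsilon>}" "X i \<noteq> 0" for i
    proof -
      have "X i \<in> {-\<delta><..<\<delta>} - {0}" using X(1) by blast
      then show "X i \<in> {-\<epsilon><..<\<epsilon>}" "X i \<noteq> 0" using \<delta>(2) by auto
    qed
    have 0: "0 \<in> {-\<epsilon><..<\<epsilon>}" using \<epsilon> by auto
    have lim: "(\<lambda>i. LINT u|lborel. ?q (X i) u) \<longlonglongrightarrow> (LINT u|lborel. indicator A u *\<^sub>R ?D (0, u))"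
    proof (rule integral_dominated_convergence[where w = "\<lambda>u. indicator A u *\<^sub>R B"])
      show "integrable lborel (\<lambda>u. indicator A u *\<^sub>R B)"
        using compact_set_integrable[OF C(1) _ A, of "\<lambda>_. B"] by (simp add: set_integrable_def)
      show "(\<lambda>u. indicator A u *\<^sub>R ?D (0, u)) \<in> borel_measurable lborel"
        using compact_set_integrable[OF C(1) sliceD A] by (simp add: set_integrable_def borel_measurable_integrable)
      show "?q (X i) \<in> borel_measurable lborel" for i
      proof -
        have "set_integrable lborel A (\<lambda>u. (F (X i, u) - F (0, u)) / X i)"
          by (intro set_integrable_divide set_integral_diff int X' 0)
        then show ?thesis by (simp add: set_integrable_def borel_measurable_integrable)
      qed
      show "AE u in lborel. (\<lambda>i. ?q (X i) u) \<longlonglongrightarrow> indicator A u *\<^sub>R ?D (0, u)"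
      proof (intro AE_I2)
        fix u
        show "(\<lambda>i. ?q (X i) u) \<longlonglongrightarrow> indicator A u *\<^sub>R ?D (0, u)"
        proof (cases "u \<in> A")
          case True
          then have "((\<lambda>s. (F (s, u) - F (0, u)) / (s - 0)) \<longlongrightarrow> ?D (0, u)) (at 0)"
            using der[OF 0, of u] A(2) C(2) by (auto simp: has_field_derivative_iff)
          then have "(\<lambda>i. (F (X i, u) - F (0, u)) / (X i - 0)) \<longlonglongrightarrow> ?D (0, u)"
            by (rule filterlim_compose) (use X X' in \<open>auto simp: filterlim_at\<close>)
          then show ?thesis using True by simp
        qed simp
      qed
      show "AE u in lborel. norm (?q (X i) u) \<le> indicator A u *\<^sub>R B" for i
      proof (intro AE_I2)
        fix u
        show "norm (?q (X i) u) \<le> indicator A u *\<^sub>R B"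
        proof (cases "u \<in> A")
          case True
          then have u: "u \<in> C" "u \<in> U" using A C by auto
          have Xi: "X i \<in> {-\<delta><..<\<delta>}" using X(1) by blast
          have "norm (F (X i, u) - F (0, u)) \<le> B * norm (X i - 0)"
          proof (rule field_differentiable_bound[where S = "{-\<delta><..<\<delta>}" and f' = "\<lambda>s. ?D (s, u)"])
            show "((\<lambda>s. F (s, u)) has_field_derivative ?D (s, u)) (at s within {-\<delta><..<\<delta>})" if "s \<in> {-\<delta><..<\<delta>}" for s
              using has_field_derivative_at_within[OF der[of s u]] that \<delta> u(2) by auto
            show "norm (?D (s, u)) \<le> B" if "s \<in> {-\<delta><..<\<delta>}" for s
              using B[of "(s, u)"] that u(1) by auto
          qed (use Xi \<delta> in auto)
          then show ?thesis using True X'(2)[of i] by (simp add: field_simps)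
        qed simp
      qed
    qed
    have q_eq: "(LINT u|lborel. ?q (X i) u) = ((LINT u:A|lborel. F (X i, u)) - (LINT u:A|lborel. F (0, u))) / (X i - 0)" for i
      using set_integral_diff(2)[OF int[OF X'(1)[of i]] int[OF 0]]
        set_integral_divide_zero[where M = lborel and A = A and f = "\<lambda>u. F (X i, u) - F (0, u)" and a = "X i"]
      by (simp add: set_lebesgue_integral_def)
    show "((\<lambda>s. ((LINT u:A|lborel. F (s, u)) - (LINT u:A|lborel. F (0, u))) / (s - 0)) \<circ> X) \<longlonglongrightarrow>
        (LINT u:A|lborel. ?D (0, u))"
      using lim[unfolded q_eq] by (simp only: o_def set_lebesgue_integral_def)
  qed
  then show ?thesis
    using \<delta> by (simp add: has_field_derivative_iff at_within_open[of 0 "{-\<delta><..<\<delta>}"])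
qed

text \<open>The integrand of the weighted volume of the varied submanifold, pulled back by the chart
  \<open>\<phi> s \<circ> \<psi>\<close>. Time and chart point form a single argument, so that joint
  regularity is expressed by \<open>Ck_on\<close>.\<close>

definition weighted_density ::
    "'a::euclidean_space \<Rightarrow> (real \<Rightarrow> 'a \<Rightarrow> 'a) \<Rightarrow> (real^'n::finite \<Rightarrow> 'a) \<Rightarrow> real \<times> (real^'n) \<Rightarrow> real" where
  "weighted_density T \<phi> \<psi> p =
     volume_density (\<lambda>u. \<phi> (fst p) (\<psi> u)) (snd p) * exp (T \<bullet> \<phi> (fst p) (\<psi> (snd p)))"

text \<open>The Gram determinant stays positive because \<open>\<phi> s \<circ> \<psi>\<close> is an
  immersion, so the square root is applied only where it is differentiable.\<close>

lemma weighted_density_Ck: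
  assumes var: "variation \<Sigma> \<epsilon> \<phi>" and lp: "local_param \<Sigma> U \<psi>"
  shows "Ck_on (Suc 0) (weighted_density T \<phi> \<psi>) ({-\<epsilon><..<\<epsilon>} \<times> U)"
proof -
  let ?I = "{-\<epsilon><..<\<epsilon>} \<times> U" and ?\<Phi> = "\<lambda>p. \<phi> (fst p) (\<psi> (snd p))"
  have I: "open ?I" using local_param_open[OF lp] by (simp add: open_Times)
  note \<Phi> = variation_chart_Ck[OF var lp]
  have D: "Ck_on (Suc 0) (\<lambda>p. frechet_derivative ?\<Phi> (at p) v) ?I" for v
    by (rule Ck_on_frechet_derivative[OF \<Phi>])
  let ?G = "\<lambda>p. det (\<chi> i j. frechet_derivative ?\<Phi> (at p) (0, axis i 1) \<bullet> frechet_derivative ?\<Phi> (at p) (0, axis j 1))"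
  have G: "Ck_on (Suc 0) ?G ?I"
    by (intro Ck_on_det Ck_on_inner I D)
  have vd: "volume_density (\<lambda>u. \<phi> (fst p) (\<psi> u)) (snd p) = sqrt (?G p)" if "p \<in> ?I" for p
    using variation_slice_derivative[OF var lp, of "fst p" "snd p"] that
    by (auto simp: volume_density_def frechet_derivative_eqI)
  have pos: "?G ` ?I \<subseteq> {0<..}"
  proof
    fix x assume "x \<in> ?G ` ?I"
    then obtain p where p: "p \<in> ?I" "x = ?G p" by auto
    have "0 < volume_density (\<lambda>u. \<phi> (fst p) (\<psi> u)) (snd p)"
      using p(1) by (intro volume_density_pos[OF variation_local_param[OF var lp]]) auto
    then show "x \<in> {0<..}" using vd[OF p(1)] p(2) by simp
  qed
  have 1: "Ck_on (Suc 0) (\<lambda>p. sqrt (?G p)) ?I"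
    by (rule Ck_on_compose[OF I open_greaterThan pos G Ck_on_sqrt])
  have 2: "Ck_on (Suc 0) (\<lambda>p. exp (T \<bullet> ?\<Phi> p)) ?I"
    by (rule Ck_on_compose[OF I open_UNIV subset_UNIV Ck_on_inner[OF I Ck_on_const \<Phi>] Ck_on_exp])
  show ?thesis
    by (rule Ck_on_cong[OF I _ Ck_on_mult[OF I 1 2]]) (simp add: weighted_density_def vd)
qed

text \<open>The pointwise first variation. The volume factor contributes the negative pairing of the
  mean curvature with \<open>V\<close> through a frame trace, the exponential contributes the
  pairing of \<open>T\<close> with \<open>V\<close>, and normality of \<open>V\<close> replaces
  \<open>T\<close> by its normal part.\<close>

lemma weighted_density_derivative:
  fixes U :: "(real^'n::finite) set"
  assumes var: "variation \<Sigma> \<epsilon> \<phi>" and lp: "local_param \<Sigma> U \<psi>" and u: "u \<in> U"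
    and V: "\<And>x. x \<in> \<Sigma> \<Longrightarrow> ((\<lambda>s. \<phi> s x) has_vector_derivative V x) (at 0)"
    and V_normal: "\<And>x. x \<in> \<Sigma> \<Longrightarrow> V x \<in> normal_space_at \<Sigma> x"
  shows "frechet_derivative (weighted_density T \<phi> \<psi>) (at (0, u)) (1, 0) =
    volume_density \<psi> u * (((normal_proj \<Sigma> (\<psi> u) T - mean_curvature \<Sigma> (\<psi> u)) \<bullet> V (\<psi> u)) * exp (T \<bullet> \<psi> u))"
proof -
  let ?I = "{-\<epsilon><..<\<epsilon>} \<times> U" and ?\<Phi> = "\<lambda>p. \<phi> (fst p) (\<psi> (snd p))"
  have \<epsilon>: "\<epsilon> > 0" and \<phi>0: "\<And>x. x \<in> \<Sigma> \<Longrightarrow> \<phi> 0 x = x" using var by (auto simp: variation_def)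
  have I: "open ?I" using local_param_open[OF lp] by (simp add: open_Times)
  note \<Phi> = variation_chart_Ck[OF var lp]
  have in\<Sigma>: "\<psi> w \<in> \<Sigma>" if "w \<in> U" for w using that local_param_subset[OF lp] by auto
  have mem: "(0, w) \<in> ?I" if "w \<in> U" for w using that \<epsilon> by auto
  let ?N = "\<lambda>w. V (\<psi> w)"
  \<comment> \<open>The hypothesis gives \<open>V\<close> only pointwise; as the
    \<open>s\<close>-derivative of the jointly smooth map it becomes differentiable along the
    chart.\<close>
  have N: "?N w = frechet_derivative ?\<Phi> (at (0, w)) (1, 0)" if "w \<in> U" for w
    using vector_derivative_unique_at[OF V[OF in\<Sigma>[OF that]]]
      Ck_on_curve_derivative[OF \<Phi> mem[OF that]] by simp
  define N' where "N' c = frechet_derivative (\<lambda>p. frechet_derivative ?\<Phi> (at p) (1, 0)) (at (0, u)) (0, c)" for c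
  have D: "Ck_on (Suc 0) (\<lambda>p. frechet_derivative ?\<Phi> (at p) v) ?I" for v
    by (rule Ck_on_frechet_derivative[OF \<Phi>])
  have N': "(?N has_derivative N') (at u)"
  proof -
    have "((\<lambda>w. (0, w)) has_derivative (\<lambda>c. (0::real, c))) (at u)"
      by (auto intro!: derivative_eq_intros)
    from has_derivative_compose[OF this Ck_on_has_derivative[OF D mem[OF u]]]
    have "((\<lambda>w. frechet_derivative ?\<Phi> (at (0, w)) (1, 0)) has_derivative N') (at u)"
      unfolding N'_def .
    then show ?thesis
      by (rule has_derivative_transform_within_open[OF _ local_param_open[OF lp] u]) (simp add: N)
  qed
  obtain e c where ec: "\<And>i::'n. frechet_derivative \<psi> (at u) (c i) = e i"
    "\<And>i j. e i \<bullet> e j = (if i = j then 1 else 0)"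
    and H: "mean_curvature \<Sigma> (\<psi> u) \<bullet> ?N u = - (\<Sum>i\<in>UNIV. e i \<bullet> N' (c i))"
    by (rule mean_curvature_inner_normal[OF lp u _ N']) (use V_normal in\<Sigma> in blast)+
  define L where "L s = (\<lambda>c. frechet_derivative ?\<Phi> (at (s, u)) (0, c))" for s
  have slice: "frechet_derivative (\<lambda>u. \<phi> s (\<psi> u)) (at u) = L s" if "s \<in> {-\<epsilon><..<\<epsilon>}" for s
    unfolding L_def by (rule frechet_derivative_eqI[OF variation_slice_derivative[OF var lp that u]])
  have "linear (L s)" if "s \<in> {-\<epsilon><..<\<epsilon>}" for s
    using has_derivative_linear[OF variation_slice_derivative[OF var lp that u]] by (simp add: L_def)
  \<comment> \<open>Differentiating first in direction \<open>c\<close> and then in \<open>s\<close>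
    may be interchanged, by symmetry of second derivatives; the opposite order is the derivative of
    \<open>V\<close> along the chart.\<close>
  moreover have "((\<lambda>s. L s c) has_vector_derivative N' c) (at 0)" for c
    using Ck_on_curve_derivative[OF D mem[OF u], of "(0, c)"]
    unfolding L_def N'_def second_derivative_symmetric[OF I \<Phi> mem[OF u], of "(0, c)" "(1, 0)"] .
  moreover have L0: "L 0 = frechet_derivative \<psi> (at u)"
  proof -
    have "L 0 = frechet_derivative (\<lambda>u. \<phi> 0 (\<psi> u)) (at u)" using slice[of 0] \<epsilon> by simp
    also have "\<dots> = frechet_derivative \<psi> (at u)"
      by (rule frechet_derivative_cong_open[OF local_param_open[OF lp] u]) (simp add: \<phi>0 in\<Sigma>)
    finally show ?thesis .
  qed
  ultimately have "((\<lambda>s. sqrt (det (gram (L s)))) has_real_derivative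
      sqrt (det (gram (L 0))) * (\<Sum>i\<in>UNIV. e i \<bullet> N' (c i))) (at 0)"
    using \<epsilon> ec by (intro sqrt_det_gram_derivative[where \<epsilon> = \<epsilon>]) auto
  then have "((\<lambda>s. volume_density (\<lambda>u. \<phi> s (\<psi> u)) u) has_real_derivative
      volume_density \<psi> u * (- (mean_curvature \<Sigma> (\<psi> u) \<bullet> ?N u))) (at 0)"
    unfolding H minus_minus volume_density_eq_gram[of \<psi>] L0[symmetric]
    by (rule has_field_derivative_transform_within_open[where S = "{-\<epsilon><..<\<epsilon>}"]) (use \<epsilon> slice in \<open>auto simp: volume_density_eq_gram\<close>)
  moreover have "((\<lambda>s. exp (T \<bullet> \<phi> s (\<psi> u))) has_real_derivative (T \<bullet> ?N u) * exp (T \<bullet> \<psi> u)) (at 0)"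
  proof -
    have "((\<lambda>s. T \<bullet> \<phi> s (\<psi> u)) has_real_derivative T \<bullet> ?N u) (at 0)"
      using has_derivative_inner_right[OF V[OF in\<Sigma>[OF u], unfolded has_vector_derivative_def], of T]
      by (rule has_derivative_imp_has_field_derivative) simp
    from DERIV_chain2[OF DERIV_exp this] show ?thesis
      using \<phi>0[OF in\<Sigma>[OF u]] by (simp add: mult.commute)
  qed
  ultimately have "((\<lambda>s. weighted_density T \<phi> \<psi> (s, u)) has_real_derivative
      volume_density (\<lambda>u. \<phi> 0 (\<psi> u)) u * ((T \<bullet> ?N u) * exp (T \<bullet> \<psi> u)) +
      volume_density \<psi> u * (- (mean_curvature \<Sigma> (\<psi> u) \<bullet> ?N u)) * exp (T \<bullet> \<phi> 0 (\<psi> u))) (at 0)"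
    unfolding weighted_density_def fst_conv snd_conv
    by (intro DERIV_cong[OF DERIV_mult']) auto
  moreover have "((\<lambda>s. weighted_density T \<phi> \<psi> (s, u)) has_real_derivative
      frechet_derivative (weighted_density T \<phi> \<psi>) (at (0, u)) (1, 0)) (at 0)"
    using Ck_on_curve_derivative[OF weighted_density_Ck[OF var lp] mem[OF u]]
    by (simp add: has_real_derivative_iff_has_vector_derivative)
  ultimately have "frechet_derivative (weighted_density T \<phi> \<psi>) (at (0, u)) (1, 0) =
      volume_density (\<lambda>u. \<phi> 0 (\<psi> u)) u * ((T \<bullet> ?N u) * exp (T \<bullet> \<psi> u)) +
      volume_density \<psi> u * (- (mean_curvature \<Sigma> (\<psi> u) \<bullet> ?N u)) * exp (T \<bullet> \<phi> 0 (\<psi> u))"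
    using DERIV_unique by blast
  moreover have "volume_density (\<lambda>u. \<phi> 0 (\<psi> u)) u = volume_density \<psi> u"
    using slice[of 0] L0 \<epsilon> by (simp add: volume_density_eq_gram)
  moreover have "normal_proj \<Sigma> (\<psi> u) T \<bullet> ?N u = T \<bullet> ?N u"
    by (rule normal_proj_inner_normal[OF subspace_tangent_space_at[OF lp u] V_normal[OF in\<Sigma>[OF u]]])
  ultimately show ?thesis
    using \<phi>0[OF in\<Sigma>[OF u]] by (simp add: inner_diff_left algebra_simps)
qed

section \<open>First variation\<close>

text \<open>Measurability is asked of \<open>h\<close> cut off to \<open>B\<close>, because the
  integrand of the first variation will be shown to be continuous on a chart image.\<close>

lemma set_integral_induced_volume_chart:
  fixes U :: "(real^'n::finite) set" and h :: "'a::euclidean_space \<Rightarrow> real"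
  assumes \<Sigma>: "submanifold TYPE('n) \<Sigma>" and lp: "local_param \<Sigma> U \<psi>"
    and B: "B \<in> sets borel" "B \<subseteq> \<psi> ` U" and h: "(\<lambda>x. indicator B x *\<^sub>R h x) \<in> borel_measurable borel"
  shows "set_integrable (induced_volume TYPE('n) \<Sigma>) B h \<longleftrightarrow>
      set_integrable lborel (U \<inter> \<psi> -` B) (\<lambda>u. volume_density \<psi> u * h (\<psi> u))"
    and "(LINT x:B|induced_volume TYPE('n) \<Sigma>. h x) =
      (LINT u:U \<inter> \<psi> -` B|lborel. volume_density \<psi> u * h (\<psi> u))"
proof -
  let ?\<mu> = "induced_volume TYPE('n) \<Sigma>" and ?\<nu> = "chart_measure U \<psi>"
  let ?k = "\<lambda>x. indicator B x *\<^sub>R h x" and ?\<Psi> = "\<lambda>u. if u \<in> U then \<psi> u else 0"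
  have "B \<subseteq> \<Sigma>" using B local_param_subset[OF lp] by auto
  then have B': "B \<inter> space ?\<mu> \<in> sets ?\<mu>" "B \<inter> space ?\<nu> \<in> sets ?\<nu>"
    using B by (auto simp: sets_induced_volume_iff[OF \<Sigma>] space_induced_volume[OF \<Sigma>] Int_absorb2)
  note eq = restrict_space_induced_volume_chart[OF \<Sigma> lp B]
  have U: "U \<in> sets borel" using local_param_open[OF lp] by simp
  have m1: "(\<lambda>u. indicator U u * volume_density \<psi> u) \<in> borel_measurable lborel"
    using borel_measurable_continuous_on_indicator[OF U volume_density_continuous_on[OF lp]] by simp
  have m2: "?\<Psi> \<in> borel_measurable lborel"
    using U local_param_continuous_on[OF lp]
    by (simp, intro borel_measurable_continuous_on_if) auto
  have m3: "(\<lambda>u. ?k (?\<Psi> u)) \<in> borel_measurable lborel"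
    using measurable_compose[OF m2 h] .
  have pos: "AE u in lborel. 0 \<le> indicator U u * volume_density \<psi> u"
    using volume_density_pos[OF lp] by (intro AE_I2) (auto simp: indicator_def less_imp_le)
  have pt: "(indicator U u * volume_density \<psi> u) *\<^sub>R ?k (?\<Psi> u) =
      indicator (U \<inter> \<psi> -` B) u *\<^sub>R (volume_density \<psi> u * h (\<psi> u))" for u
    by (auto simp: indicator_def)
  let ?d = "density lborel (\<lambda>u. ennreal (indicator U u * volume_density \<psi> u))"
  have m2': "?\<Psi> \<in> measurable ?d borel" and m3': "(\<lambda>u. ?k (?\<Psi> u)) \<in> borel_measurable ?d"
    using m2 m3 by simp_all
  have "set_integrable ?\<mu> B h \<longleftrightarrow> integrable ?\<nu> ?k"
    unfolding set_integrable_def using integrable_restrict_space[OF B'(1), of h] integrable_restrict_space[OF B'(2), of h] eq by simp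
  also have "\<dots> \<longleftrightarrow> integrable ?d (\<lambda>u. ?k (?\<Psi> u))"
    unfolding chart_measure_def by (rule integrable_distr_eq[OF m2' h])
  also have "\<dots> \<longleftrightarrow> integrable lborel (\<lambda>u. (indicator U u * volume_density \<psi> u) *\<^sub>R ?k (?\<Psi> u))"
    by (rule integrable_density[OF m3 m1 pos])
  finally show "set_integrable ?\<mu> B h \<longleftrightarrow>
      set_integrable lborel (U \<inter> \<psi> -` B) (\<lambda>u. volume_density \<psi> u * h (\<psi> u))"
    unfolding pt set_integrable_def .
  have "(LINT x:B|?\<mu>. h x) = (LINT x|?\<nu>. ?k x)"
    unfolding set_lebesgue_integral_def
    using integral_restrict_space[OF B'(1), of h] integral_restrict_space[OF B'(2), of h] eq by simp
  also have "\<dots> = (LINT u|?d. ?k (?\<Psi> u))"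
    unfolding chart_measure_def by (rule integral_distr[OF m2' h])
  also have "\<dots> = (LINT u|lborel. (indicator U u * volume_density \<psi> u) *\<^sub>R ?k (?\<Psi> u))"
    by (rule integral_density[OF m3 m1 pos])
  finally show "(LINT x:B|?\<mu>. h x) = (LINT u:U \<inter> \<psi> -` B|lborel. volume_density \<psi> u * h (\<psi> u))"
    unfolding pt set_lebesgue_integral_def .
qed

lemma nn_integral_induced_volume_Un:
  assumes \<Sigma>: "submanifold TYPE('n::finite) \<Sigma>" and f: "f \<in> borel_measurable borel"
    and A: "A \<in> sets borel" "A \<subseteq> \<Sigma>" and B: "B \<in> sets borel" "B \<subseteq> \<Sigma>" and disj: "A \<inter> B = {}"
  shows "(\<integral>\<^sup>+x\<in>A \<union> B. f x \<partial>induced_volume TYPE('n) \<Sigma>) =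
    (\<integral>\<^sup>+x\<in>A. f x \<partial>induced_volume TYPE('n) \<Sigma>) + (\<integral>\<^sup>+x\<in>B. f x \<partial>induced_volume TYPE('n) \<Sigma>)"
proof -
  have "f \<in> borel_measurable (induced_volume TYPE('n) \<Sigma>)"
    using measurable_restrict_space1[OF f, of \<Sigma>] measurable_cong_sets[OF induced_volume_works(1)[OF \<Sigma>] refl, of borel]
    by blast
  then show ?thesis
    using A B disj by (intro nn_integral_disjoint_pair) (auto simp: sets_induced_volume_iff[OF \<Sigma>])
qed

definition variation_density :: "'a::euclidean_space \<Rightarrow> 'a set \<Rightarrow> ('a \<Rightarrow> 'a) \<Rightarrow> 'a \<Rightarrow> real" where
  "variation_density T \<Sigma> V x = ((normal_proj \<Sigma> x T - mean_curvature \<Sigma> x) \<bullet> V x) * exp (T \<bullet> x)"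

text \<open>The real function \<open>a\<close> records at once that the weighted volumes are finite
  for every \<open>s\<close> and that they are differentiable at 0, whereas \<open>enn2real\<close>
  would send an infinite value to 0. In this form the property passes to disjoint unions.\<close>

definition has_first_variation_over :: "'n::finite itself \<Rightarrow> 'a::euclidean_space \<Rightarrow> 'a set \<Rightarrow>
    (real \<Rightarrow> 'a \<Rightarrow> 'a) \<Rightarrow> real \<Rightarrow> ('a \<Rightarrow> 'a) \<Rightarrow> 'a set \<Rightarrow> bool" where
  "has_first_variation_over n T \<Sigma> \<phi> \<epsilon> V B \<longleftrightarrow>
     set_integrable (induced_volume n \<Sigma>) B (variation_density T \<Sigma> V) \<and>
     (\<exists>a. (\<forall>s\<in>{-\<epsilon><..<\<epsilon>}. 0 \<le> a s \<and> weighted_volume_over n T (\<phi> s ` \<Sigma>) (\<phi> s ` B) = ennreal (a s)) \<and>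
       (a has_real_derivative (LINT x:B|induced_volume n \<Sigma>. variation_density T \<Sigma> V x)) (at 0))"

context
  fixes T :: "'a::euclidean_space" and \<Sigma> :: "'a set"
    and \<phi> :: "real \<Rightarrow> 'a \<Rightarrow> 'a" and \<epsilon> :: real and V :: "'a \<Rightarrow> 'a"
  assumes \<Sigma>: "submanifold TYPE('n::finite) \<Sigma>"
    and var: "variation \<Sigma> \<epsilon> \<phi>"
    and V: "\<And>x. x \<in> \<Sigma> \<Longrightarrow> ((\<lambda>s. \<phi> s x) has_vector_derivative V x) (at 0)"
    and V_normal: "\<And>x. x \<in> \<Sigma> \<Longrightarrow> V x \<in> normal_space_at \<Sigma> x"
begin

lemma variation_interval_pos: "\<epsilon> > 0"
  using var by (simp add: variation_def)

lemma exp_inner_measurable: "(\<lambda>x. ennreal (exp (T \<bullet> x))) \<in> borel_measurable borel"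
  by measurable

lemma submanifold_variation_image_borel:
  "s \<in> {-\<epsilon><..<\<epsilon>} \<Longrightarrow> B \<in> sets borel \<Longrightarrow> B \<subseteq> \<Sigma> \<Longrightarrow> \<phi> s ` B \<in> sets borel"
  using variation_image_borel[OF var _ submanifold_borel[OF variation_submanifold[OF var \<Sigma>]]] .

text \<open>Injectivity of \<open>\<phi> s\<close> makes the coordinate domain of the varied piece
  the same for all \<open>s\<close>, and compactness of \<open>C\<close> gives integrability and the
  bounds for differentiating the integral.\<close>

lemma has_first_variation_over_chart:
  fixes U :: "(real^'n) set"
  assumes lp: "local_param \<Sigma> U \<psi>" and C: "compact C" "C \<subseteq> U" and B: "B \<in> sets borel" "B \<subseteq> \<psi> ` C"
  shows "has_first_variation_over TYPE('n) T \<Sigma> \<phi> \<epsilon> V B"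
proof -
  let ?F = "weighted_density T \<phi> \<psi>" and ?A = "U \<inter> \<psi> -` B"
  note F = weighted_density_Ck[OF var lp, of T]
  have BU: "B \<subseteq> \<psi> ` U" using B C by auto
  have BS: "B \<subseteq> \<Sigma>" using BU local_param_subset[OF lp] by auto
  have A: "?A \<in> sets borel" "?A \<subseteq> C"
    using local_param_vimage_borel[OF lp B(1)] B(2) C(2) inj_onD[OF local_param_inj_on[OF lp]] by auto
  have cont: "continuous_on ({-\<epsilon><..<\<epsilon>} \<times> U) ?F"
    "continuous_on ({-\<epsilon><..<\<epsilon>} \<times> U) (\<lambda>p. frechet_derivative ?F (at p) (1, 0))"
    using Ck_on_imp_continuous_on[OF F] Ck_on_imp_continuous_on[OF Ck_on_frechet_derivative[OF F]] .
  have 0: "0 \<in> {-\<epsilon><..<\<epsilon>}" using variation_interval_pos by auto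
  have slice: "continuous_on U (\<lambda>u. G (s, u))" if "continuous_on ({-\<epsilon><..<\<epsilon>} \<times> U) G" "s \<in> {-\<epsilon><..<\<epsilon>}"
    for s and G :: "real \<times> (real^'n) \<Rightarrow> real"
    using that(2) by (intro continuous_on_compose2[OF that(1)]) (auto intro!: continuous_intros)
  have D: "frechet_derivative ?F (at (0, u)) (1, 0) = volume_density \<psi> u * variation_density T \<Sigma> V (\<psi> u)" if "u \<in> U" for u
    unfolding variation_density_def by (rule weighted_density_derivative[OF var lp that V V_normal])
  \<comment> \<open>Projection and curvature are defined by choices, so continuity cannot be read
    from their definitions. It comes from fact \<open>D\<close>: in the chart the integrand is the
    quotient of a continuous derivative by the positive volume density.\<close>
  have "continuous_on (\<psi> ` U) (variation_density T \<Sigma> V)"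
  proof -
    have "continuous_on U (\<lambda>u. frechet_derivative ?F (at (0, u)) (1, 0) / volume_density \<psi> u)"
      using volume_density_pos[OF lp]
      by (intro continuous_on_divide slice[OF cont(2) 0] volume_density_continuous_on[OF lp]) force
    moreover have "frechet_derivative ?F (at (0, u)) (1, 0) / volume_density \<psi> u = variation_density T \<Sigma> V (\<psi> u)" if "u \<in> U" for u
      using D[OF that] volume_density_pos[OF lp that] by simp
    ultimately have "continuous_on U (\<lambda>u. variation_density T \<Sigma> V (\<psi> u))"
      by (simp cong: continuous_on_cong)
    moreover have "the_inv_into U \<psi> ` \<psi> ` U \<subseteq> U"
      using the_inv_into_f_f[OF local_param_inj_on[OF lp]] by auto
    ultimately have "continuous_on (\<psi> ` U) (\<lambda>x. variation_density T \<Sigma> V (\<psi> (the_inv_into U \<psi> x)))"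
      by (rule continuous_on_compose2[OF _ local_param_continuous_on_inverse[OF lp]])
    moreover have "\<psi> (the_inv_into U \<psi> x) = x" if "x \<in> \<psi> ` U" for x
      using f_the_inv_into_f[OF local_param_inj_on[OF lp] that] .
    ultimately show ?thesis by (simp cong: continuous_on_cong)
  qed
  then have hB: "(\<lambda>x. indicator B x *\<^sub>R variation_density T \<Sigma> V x) \<in> borel_measurable borel"
    using borel_measurable_continuous_on_indicator[OF B(1) continuous_on_subset[OF _ BU]] by blast
  note chart = set_integral_induced_volume_chart[OF \<Sigma> lp B(1) BU hB]
  have int0: "set_integrable lborel ?A (\<lambda>u. frechet_derivative ?F (at (0, u)) (1, 0))"
    by (rule compact_set_integrable[OF C(1) continuous_on_subset[OF slice[OF cont(2) 0] C(2)] A])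
  have 1: "set_integrable (induced_volume TYPE('n) \<Sigma>) B (variation_density T \<Sigma> V)"
    unfolding chart(1) by (rule iffD1[OF set_integrable_cong int0]) (auto simp: D)
  have 2: "((\<lambda>s. LINT u:?A|lborel. ?F (s, u)) has_real_derivative
      (LINT x:B|induced_volume TYPE('n) \<Sigma>. variation_density T \<Sigma> V x)) (at 0)"
  proof -
    have "(LINT u:?A|lborel. frechet_derivative ?F (at (0, u)) (1, 0)) =
        (LINT u:?A|lborel. volume_density \<psi> u * variation_density T \<Sigma> V (\<psi> u))"
      using A(1) D by (intro set_lebesgue_integral_cong) auto
    then show ?thesis
      using has_real_derivative_set_integral[OF variation_interval_pos F C A] chart(2) by simp
  qed
  have 3: "0 \<le> (LINT u:?A|lborel. ?F (s, u)) \<and>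
      (\<integral>\<^sup>+x\<in>\<phi> s ` B. ennreal (exp (T \<bullet> x)) \<partial>induced_volume TYPE('n) (\<phi> s ` \<Sigma>)) = ennreal (LINT u:?A|lborel. ?F (s, u))"
    if s: "s \<in> {-\<epsilon><..<\<epsilon>}" for s
  proof -
    let ?\<Psi> = "\<lambda>u. \<phi> s (\<psi> u)"
    note lps = variation_local_param[OF var lp s]
    have pos: "0 \<le> ?F (s, u)" if "u \<in> U" for u
      using volume_density_pos[OF lps that] by (simp add: weighted_density_def)
    have A_eq: "U \<inter> ?\<Psi> -` (\<phi> s ` B) = ?A"
      using inj_onD[OF variation_inj_on[OF var s]] BS local_param_subset[OF lp] by blast
    have "(\<integral>\<^sup>+x\<in>\<phi> s ` B. ennreal (exp (T \<bullet> x)) \<partial>induced_volume TYPE('n) (\<phi> s ` \<Sigma>)) =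
        (\<integral>\<^sup>+u\<in>?A. ennreal (volume_density ?\<Psi> u) * ennreal (exp (T \<bullet> ?\<Psi> u)) \<partial>lborel)"
      unfolding A_eq[symmetric]
      by (rule nn_integral_induced_volume_chart[OF variation_submanifold[OF var \<Sigma> s] lps
            submanifold_variation_image_borel[OF s B(1) BS] _ exp_inner_measurable]) (use BU in auto)
    also have "\<dots> = (\<integral>\<^sup>+u. ennreal (indicator ?A u *\<^sub>R ?F (s, u)) \<partial>lborel)"
      using volume_density_pos[OF lps]
      by (intro nn_integral_cong) (auto simp: indicator_def weighted_density_def ennreal_mult' less_imp_le)
    also have "\<dots> = ennreal (LINT u|lborel. indicator ?A u *\<^sub>R ?F (s, u))"
    proof (rule nn_integral_eq_integral)
      show "integrable lborel (\<lambda>u. indicator ?A u *\<^sub>R ?F (s, u))"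
        using compact_set_integrable[OF C(1) continuous_on_subset[OF slice[OF cont(1) s] C(2)] A]
        by (simp add: set_integrable_def)
    qed (use pos in \<open>auto simp: indicator_def\<close>)
    finally show ?thesis
      using pos by (auto simp: set_lebesgue_integral_def indicator_def intro!: Bochner_Integration.integral_nonneg)
  qed
  show ?thesis
    unfolding has_first_variation_over_def weighted_volume_over_def
    by (intro conjI[OF 1] exI[of _ "\<lambda>s. LINT u:?A|lborel. ?F (s, u)"] conjI[OF ballI[OF 3] 2])
qed

text \<open>Since \<open>\<phi> s\<close> is injective, disjoint pieces stay disjoint while they
  move, so their weighted volumes add for every \<open>s\<close>.\<close>

lemma has_first_variation_over_Un:
  assumes A: "A \<in> sets borel" "A \<subseteq> \<Sigma>" "has_first_variation_over TYPE('n) T \<Sigma> \<phi> \<epsilon> V A"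
    and B: "B \<in> sets borel" "B \<subseteq> \<Sigma>" "has_first_variation_over TYPE('n) T \<Sigma> \<phi> \<epsilon> V B" and disj: "A \<inter> B = {}"
  shows "has_first_variation_over TYPE('n) T \<Sigma> \<phi> \<epsilon> V (A \<union> B)"
proof -
  let ?I = "\<lambda>B. LINT x:B|induced_volume TYPE('n) \<Sigma>. variation_density T \<Sigma> V x"
  let ?e = "\<lambda>s B. \<integral>\<^sup>+x\<in>\<phi> s ` B. ennreal (exp (T \<bullet> x)) \<partial>induced_volume TYPE('n) (\<phi> s ` \<Sigma>)"
  obtain a where a: "\<And>s. s \<in> {-\<epsilon><..<\<epsilon>} \<Longrightarrow> 0 \<le> a s \<and> ?e s A = ennreal (a s)" "(a has_real_derivative ?I A) (at 0)"
    using A(3) unfolding has_first_variation_over_def weighted_volume_over_def by blast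
  obtain b where b: "\<And>s. s \<in> {-\<epsilon><..<\<epsilon>} \<Longrightarrow> 0 \<le> b s \<and> ?e s B = ennreal (b s)" "(b has_real_derivative ?I B) (at 0)"
    using B(3) unfolding has_first_variation_over_def weighted_volume_over_def by blast
  have int: "set_integrable (induced_volume TYPE('n) \<Sigma>) A (variation_density T \<Sigma> V)"
    "set_integrable (induced_volume TYPE('n) \<Sigma>) B (variation_density T \<Sigma> V)"
    using A(3) B(3) unfolding has_first_variation_over_def weighted_volume_over_def by auto
  have "?e s (A \<union> B) = ennreal (a s + b s)" if s: "s \<in> {-\<epsilon><..<\<epsilon>}" for s
  proof -
    have "\<phi> s ` A \<inter> \<phi> s ` B = {}"
      using inj_on_image_Int[OF variation_inj_on[OF var s] A(2) B(2)] disj by simp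
    then have "?e s (A \<union> B) = ?e s A + ?e s B"
      unfolding image_Un
      using A B by (intro nn_integral_induced_volume_Un[OF variation_submanifold[OF var \<Sigma> s] exp_inner_measurable]
          submanifold_variation_image_borel[OF s] image_mono) auto
    then show ?thesis using a(1)[OF s] b(1)[OF s] by simp
  qed
  moreover have "((\<lambda>s. a s + b s) has_real_derivative ?I (A \<union> B)) (at 0)"
    using DERIV_add[OF a(2) b(2)] set_integral_Un[OF disj int] by simp
  moreover have "set_integrable (induced_volume TYPE('n) \<Sigma>) (A \<union> B) (variation_density T \<Sigma> V)"
    using A B by (intro set_integrable_Un int) (auto simp: sets_induced_volume_iff[OF \<Sigma>])
  ultimately show ?thesis
    using a(1) b(1) unfolding has_first_variation_over_def weighted_volume_over_def
    by (intro conjI exI[of _ "\<lambda>s. a s + b s"]) auto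
qed

text \<open>Every point of \<open>\<Sigma>\<close> has a neighbourhood whose part in
  \<open>\<Sigma>\<close> lies in the image of a compact subset of a chart domain. Finitely many of
  these cover \<open>K\<close>, and an induction over them adds at each step only what is not yet
  covered, which keeps the pieces disjoint.\<close>

lemma has_first_variation_over_compact:
  assumes K: "compact K" "K \<subseteq> \<Sigma>"
  shows "has_first_variation_over TYPE('n) T \<Sigma> \<phi> \<epsilon> V K"
proof -
  define F where "F = {W. open W \<and> (\<exists>(U :: (real^'n) set) \<psi> C. local_param \<Sigma> U \<psi> \<and> compact C \<and> C \<subseteq> U \<and> \<Sigma> \<inter> W \<subseteq> \<psi> ` C)}"
  have "K \<subseteq> \<Union>F"
  proof
    fix x assume "x \<in> K"
    then have "x \<in> \<Sigma>" using K by auto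
    from bspec[OF \<Sigma>[unfolded submanifold_def] this]
    obtain U :: "(real^'n) set" and \<psi> where lp: "local_param \<Sigma> U \<psi>" "x \<in> \<psi> ` U" by auto
    then obtain u where u: "u \<in> U" "x = \<psi> u" by auto
    obtain r where r: "r > 0" "cball u r \<subseteq> U"
      using local_param_open[OF lp(1)] u(1) open_contains_cball by blast
    have "ball u r \<subseteq> U" using r(2) ball_subset_cball[of u r] by auto
    from local_param_open_map[OF lp(1) open_ball this]
    obtain W where W: "open W" "\<psi> ` ball u r = \<Sigma> \<inter> W"
      by (auto simp: openin_open)
    have "\<Sigma> \<inter> W \<subseteq> \<psi> ` cball u r"
      using W(2) ball_subset_cball[of u r] by blast
    then have "W \<in> F"
      unfolding F_def using W(1) lp(1) r(2) compact_cball by blast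
    moreover have "x \<in> W" using W(2) u r by auto
    ultimately show "x \<in> \<Union>F" by blast
  qed
  moreover have "\<And>W. W \<in> F \<Longrightarrow> open W" by (auto simp: F_def)
  ultimately obtain D where D: "D \<subseteq> F" "finite D" "K \<subseteq> \<Union>D"
    using compactE[OF K(1)] by metis
  have Kb: "K \<in> sets borel" using K(1) by (intro borel_closed compact_imp_closed)
  have "has_first_variation_over TYPE('n) T \<Sigma> \<phi> \<epsilon> V (K \<inter> \<Union>D)"
    using D(2,1)
  proof (induction D rule: finite_induct)
    case empty
    obtain U :: "(real^'n) set" and \<psi> where "local_param \<Sigma> U \<psi>" using local_param_empty by blast
    from has_first_variation_over_chart[OF this, of "{}" "{}"] show ?case by simp
  next
    case (insert W D)
    then have W: "W \<in> F" and D: "D \<subseteq> F" by auto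
    have op: "open W" "open (\<Union>D)" using W D by (auto simp: F_def)
    obtain U :: "(real^'n) set" and \<psi> C where lp: "local_param \<Sigma> U \<psi>" "compact C" "C \<subseteq> U" "\<Sigma> \<inter> W \<subseteq> \<psi> ` C"
      using W unfolding F_def by blast
    have 1: "has_first_variation_over TYPE('n) T \<Sigma> \<phi> \<epsilon> V (K \<inter> W - \<Union>D)"
      by (rule has_first_variation_over_chart[OF lp(1-3)]) (use Kb op lp(4) K(2) in auto)
    have "K \<inter> \<Union>(insert W D) = (K \<inter> \<Union>D) \<union> (K \<inter> W - \<Union>D)" by auto
    moreover have "has_first_variation_over TYPE('n) T \<Sigma> \<phi> \<epsilon> V ((K \<inter> \<Union>D) \<union> (K \<inter> W - \<Union>D))"
      using insert.IH[OF D] 1 Kb op K(2) by (intro has_first_variation_over_Un) auto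
    ultimately show ?case by simp
  qed
  then show ?thesis using D(3) by (simp add: Int_absorb2)
qed

lemma variation_density_eq_0:
  assumes "x \<in> \<Sigma>" "x \<notin> variation_support \<Sigma> \<epsilon> \<phi>"
  shows "variation_density T \<Sigma> V x = 0"
proof -
  have "((\<lambda>s. \<phi> s x) has_vector_derivative 0) (at 0)"
    by (rule has_vector_derivative_transform_within_open[OF has_vector_derivative_const open_greaterThanLessThan[of "-\<epsilon>" \<epsilon>]])
      (use variation_interval_pos variation_fixes_outside_support[OF assms] in auto)
  then have "V x = 0" using V[OF assms(1)] vector_derivative_unique_at by blast
  then show ?thesis by (simp add: variation_density_def)
qed

text \<open>\<open>R\<close> is split into the support, which is compact, and the rest, which is
  fixed and contributes a finite constant. Taking \<open>R\<close> to be \<open>\<Sigma>\<close> or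
  a compact set covers both cases of the theorem.\<close>

lemma first_variation_over:
  assumes S: "compact (variation_support \<Sigma> \<epsilon> \<phi>)"
    and R: "R \<in> sets borel" "variation_support \<Sigma> \<epsilon> \<phi> \<subseteq> R" "R \<subseteq> \<Sigma>"
    and fin: "(\<integral>\<^sup>+x\<in>R. ennreal (exp (T \<bullet> x)) \<partial>induced_volume TYPE('n) \<Sigma>) < \<infinity>"
  shows "((\<lambda>s. enn2real (\<integral>\<^sup>+x\<in>\<phi> s ` R. ennreal (exp (T \<bullet> x)) \<partial>induced_volume TYPE('n) (\<phi> s ` \<Sigma>)))
    has_real_derivative (LINT x|induced_volume TYPE('n) \<Sigma>. variation_density T \<Sigma> V x)) (at 0)"
proof -
  let ?S = "variation_support \<Sigma> \<epsilon> \<phi>" and ?e = "\<lambda>x. ennreal (exp (T \<bullet> x))"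
  let ?I = "\<lambda>s B. \<integral>\<^sup>+x\<in>B. ?e x \<partial>induced_volume TYPE('n) (\<phi> s ` \<Sigma>)"
  obtain a where a: "\<And>s. s \<in> {-\<epsilon><..<\<epsilon>} \<Longrightarrow> 0 \<le> a s \<and> ?I s (\<phi> s ` ?S) = ennreal (a s)"
    and a': "(a has_real_derivative (LINT x:?S|induced_volume TYPE('n) \<Sigma>. variation_density T \<Sigma> V x)) (at 0)"
    using has_first_variation_over_compact[OF S variation_support_subset]
    unfolding has_first_variation_over_def weighted_volume_over_def by blast
  \<comment> \<open>Where nothing moves \<open>V\<close> vanishes, so integrating over the support
    amounts to integrating over \<open>\<Sigma>\<close>.\<close>
  have LINT: "(LINT x:?S|induced_volume TYPE('n) \<Sigma>. variation_density T \<Sigma> V x) = (LINT x|induced_volume TYPE('n) \<Sigma>. variation_density T \<Sigma> V x)"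
    unfolding set_lebesgue_integral_def
    by (rule Bochner_Integration.integral_cong)
      (auto simp: space_induced_volume[OF \<Sigma>] indicator_def variation_density_eq_0)
  have Sb: "?S \<in> sets borel" using S by (intro borel_closed compact_imp_closed)
  let ?\<Omega> = "\<Sigma> - ?S"
  \<comment> \<open>The support is closed, so \<open>?\<Omega>\<close> is relatively open in
    \<open>\<Sigma>\<close>, and being fixed by the variation it is relatively open in the varied
    submanifold too. Hence both induced volumes agree on it.\<close>
  have \<Omega>: "openin (top_of_set \<Sigma>) ?\<Omega>"
    using openin_open_Int[OF open_Compl[OF compact_imp_closed[OF S]], of \<Sigma>] by (simp add: Diff_eq)
  define c where "c = (\<integral>\<^sup>+x\<in>R - ?S. ?e x \<partial>induced_volume TYPE('n) \<Sigma>)"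
  have "c \<le> (\<integral>\<^sup>+x\<in>R. ?e x \<partial>induced_volume TYPE('n) \<Sigma>)"
    unfolding c_def by (intro nn_integral_mono) (auto simp: indicator_def)
  \<comment> \<open>With a finite \<open>c\<close> the sum of the two contributions can be split
    under \<open>enn2real\<close>.\<close>
  then have c: "c < \<infinity>" using fin by (rule order_le_less_trans)
  have RS: "R - ?S \<in> sets borel" "R - ?S \<subseteq> ?\<Omega>" using R Sb by auto
  have "enn2real (?I s (\<phi> s ` R)) = a s + enn2real c" if s: "s \<in> {-\<epsilon><..<\<epsilon>}" for s
  proof -
    have fixed: "\<phi> s ` B = B" if "B \<subseteq> ?\<Omega>" for B
      using that variation_fixes_outside_support[OF _ _ s, of _ \<Sigma> \<phi>] by (force simp: image_iff)
    note sub = variation_submanifold[OF var \<Sigma> s]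
    have op: "openin (top_of_set (\<phi> s ` \<Sigma>)) ?\<Omega>"
      using variation_openin[OF var s \<Omega>] fixed[OF subset_refl] by simp
    have 1: "?I s (R - ?S) = c"
      using nn_integral_induced_volume_openin[OF sub op RS, of ?e]
        nn_integral_induced_volume_openin[OF \<Sigma> \<Omega> RS, of ?e] by (simp add: c_def)
    have R_eq: "\<phi> s ` R = \<phi> s ` ?S \<union> (R - ?S)"
      using R(2) fixed[OF RS(2)] by (metis Diff_partition image_Un)
    have disj: "\<phi> s ` ?S \<inter> (R - ?S) = {}"
      using inj_on_image_Int[OF variation_inj_on[OF var s] variation_support_subset, of "R - ?S"]
        fixed[OF RS(2)] R(3) by auto
    have "?I s (\<phi> s ` R) = ?I s (\<phi> s ` ?S) + ?I s (R - ?S)"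
      unfolding R_eq
    proof (rule nn_integral_induced_volume_Un[OF sub exp_inner_measurable _ _ RS(1) _ disj])
      show "\<phi> s ` ?S \<in> sets borel" by (rule submanifold_variation_image_borel[OF s Sb variation_support_subset])
      show "\<phi> s ` ?S \<subseteq> \<phi> s ` \<Sigma>" by (intro image_mono variation_support_subset)
      show "R - ?S \<subseteq> \<phi> s ` \<Sigma>" using openin_imp_subset[OF op] RS(2) by blast
    qed
    then show ?thesis
      using a[OF s] 1 c by (simp add: enn2real_plus)
  qed
  then show ?thesis
    using has_field_derivative_transform_within_open[OF DERIV_add[OF a' DERIV_const[of "enn2real c"]]
        open_greaterThanLessThan[of "-\<epsilon>" \<epsilon>], of "\<lambda>s. enn2real (?I s (\<phi> s ` R))"] variation_interval_pos
    by (simp add: LINT)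
qed

end

theorem lemma2p1:
  fixes T :: "'a::euclidean_space" and \<Sigma> :: "'a set" and p :: nat
    and \<phi> :: "real \<Rightarrow> 'a \<Rightarrow> 'a" and \<epsilon> :: real and V :: "'a \<Rightarrow> 'a"
  assumes dim: "DIM('a) = CARD('n::finite) + p"
    and \<Sigma>: "submanifold TYPE('n) \<Sigma>"
    and variation: "variation \<Sigma> \<epsilon> \<phi>"
    and compact_support: "compact (variation_support \<Sigma> \<epsilon> \<phi>)"
    and V: "\<And>x. x \<in> \<Sigma> \<Longrightarrow> ((\<lambda>s. \<phi> s x) has_vector_derivative V x) (at 0)"
    and V_normal: "\<And>x. x \<in> \<Sigma> \<Longrightarrow> V x \<in> normal_space_at \<Sigma> x"
  shows "(weighted_volume TYPE('n) T \<Sigma> < \<infinity> \<longrightarrow>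
      ((\<lambda>s. enn2real (weighted_volume TYPE('n) T (\<phi> s ` \<Sigma>))) has_real_derivative
        (LINT x|induced_volume TYPE('n) \<Sigma>.
          ((normal_proj \<Sigma> x T - mean_curvature \<Sigma> x) \<bullet> V x) * exp (T \<bullet> x))) (at 0)) \<and>
    (weighted_volume TYPE('n) T \<Sigma> = \<infinity> \<longrightarrow>
      (\<forall>K. compact K \<and> variation_support \<Sigma> \<epsilon> \<phi> \<subseteq> K \<and> K \<subseteq> \<Sigma> \<longrightarrow>
        ((\<lambda>s. enn2real (weighted_volume_over TYPE('n) T (\<phi> s ` \<Sigma>) (\<phi> s ` K))) has_real_derivative
          (LINT x|induced_volume TYPE('n) \<Sigma>.
            ((normal_proj \<Sigma> x T - mean_curvature \<Sigma> x) \<bullet> V x) * exp (T \<bullet> x))) (at 0)))"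
proof (intro conjI impI allI)
  note setting = \<Sigma> variation V V_normal
  \<comment> \<open>Instantiated with \<open>R = \<Sigma>\<close> when the weighted volume is finite
    and with \<open>R = K\<close> otherwise.\<close>
  note main = first_variation_over[OF setting compact_support, where T = T, unfolded variation_density_def]
  have \<epsilon>: "\<epsilon> > 0" and \<phi>0: "\<And>x. x \<in> \<Sigma> \<Longrightarrow> \<phi> 0 x = x" using variation by (auto simp: variation_def)
  have total: "weighted_volume TYPE('n) T M = (\<integral>\<^sup>+x\<in>M. ennreal (exp (T \<bullet> x)) \<partial>induced_volume TYPE('n) M)"
    if "submanifold TYPE('n) M" for M :: "'a set"
    unfolding weighted_volume_def
    by (intro nn_integral_cong) (simp add: space_induced_volume[OF that] indicator_def)
  {
    assume "weighted_volume TYPE('n) T \<Sigma> < \<infinity>"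
    then have "((\<lambda>s. enn2real (\<integral>\<^sup>+x\<in>\<phi> s ` \<Sigma>. ennreal (exp (T \<bullet> x)) \<partial>induced_volume TYPE('n) (\<phi> s ` \<Sigma>)))
        has_real_derivative (LINT x|induced_volume TYPE('n) \<Sigma>.
          ((normal_proj \<Sigma> x T - mean_curvature \<Sigma> x) \<bullet> V x) * exp (T \<bullet> x))) (at 0)"
      using submanifold_borel[OF \<Sigma>] variation_support_subset total[OF \<Sigma>] by (intro main) auto
    then show "((\<lambda>s. enn2real (weighted_volume TYPE('n) T (\<phi> s ` \<Sigma>))) has_real_derivative
        (LINT x|induced_volume TYPE('n) \<Sigma>.
          ((normal_proj \<Sigma> x T - mean_curvature \<Sigma> x) \<bullet> V x) * exp (T \<bullet> x))) (at 0)"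
      by (rule has_field_derivative_transform_within_open[OF _ open_greaterThanLessThan[of "-\<epsilon>" \<epsilon>]])
        (use \<epsilon> total variation_submanifold[OF variation \<Sigma>] in auto)
  }
  fix K assume K: "compact K \<and> variation_support \<Sigma> \<epsilon> \<phi> \<subseteq> K \<and> K \<subseteq> \<Sigma>"
  then have "has_first_variation_over TYPE('n) T \<Sigma> \<phi> \<epsilon> V K"
    using has_first_variation_over_compact[OF setting] by blast
  \<comment> \<open>At \<open>s = 0\<close> the property says that the weighted volume over
    \<open>K\<close> is a real number, which is the finiteness that \<open>main\<close> asks
    for.\<close>
  then have "(\<integral>\<^sup>+x\<in>\<phi> 0 ` K. ennreal (exp (T \<bullet> x)) \<partial>induced_volume TYPE('n) (\<phi> 0 ` \<Sigma>)) < \<infinity>"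
    unfolding has_first_variation_over_def weighted_volume_over_def using \<epsilon> by auto
  moreover have "\<phi> 0 ` B = B" if "B \<subseteq> \<Sigma>" for B using that \<phi>0 by (force simp: image_iff)
  ultimately have "(\<integral>\<^sup>+x\<in>K. ennreal (exp (T \<bullet> x)) \<partial>induced_volume TYPE('n) \<Sigma>) < \<infinity>"
    using K by simp
  then show "((\<lambda>s. enn2real (weighted_volume_over TYPE('n) T (\<phi> s ` \<Sigma>) (\<phi> s ` K))) has_real_derivative
      (LINT x|induced_volume TYPE('n) \<Sigma>.
        ((normal_proj \<Sigma> x T - mean_curvature \<Sigma> x) \<bullet> V x) * exp (T \<bullet> x))) (at 0)"
    unfolding weighted_volume_over_def
    using K by (intro main) (auto intro: borel_closed compact_imp_closed)
qed

end
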